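(* Let $d,s\ge 1$ be integers, $\bar{s}:=\min(s,d)$, and $V>0$. Let $\mathbf{x}^{(1)},\dots,\mathbf{x}^{(n)}$ be i.i.d. with density $p_0$ on $\mathbb{R}^d$ and $y_i=f^*(\mathbf{x}^{(i)})+\xi_i$, where the errors $\xi_i$ are i.i.d., mean-zero, and independent of the covariates. Suppose that for some $M_1,\dots,M_d>0$ $$p_0(\mathbf{x})=0\ \text{ for }\mathbf{x}\notin\prod_{j=1}^d\Big[-\frac{M_j}{2},\frac{M_j}{2}\Big]\quad\text{and}\quad B:=M_1\cdots M_d\cdot\sup_{\mathbf{x}}p_0(\mathbf{x})<\infty,$$ and that $\|\xi_i\|_{3,1}:=\int_0^\infty\mathbb{P}(|\xi_i|>t)^{1/3}\,dt<\infty$. Then the minimax risk $$\mathfrak{M}^{d,s}_{n,V}:=\inf_{\hat{f}_n}\ \sup_{\substack{f^*\in\mathcal{F}^{d,s}_{\infty-\text{ST}}\\ V^{d,s}_{\infty-\text{XGB}}(f^* )\le V}}\mathbb{E}\|\hat{f}_n-f^*\|_{p_0,2}^2,$$ where the infimum is over all estimators $\hat{f}_n$ based on the data $(\mathbf{x}^{(1)},y_1),\dots,(\mathbf{x}^{(n)},y_n)$, satisfies $$\mathfrak{M}^{d,s}_{n,V}\le O\big(d^{4\bar{s}}(1+\log d)^{4(\bar{s}-1)}(V+1)^2\cdot n^{-2/3}(\log n)^{4(\bar{s}-1)/3}\big),$$ where the constant factor underlying $O(\cdot)$ depends on $B$, $s$, and the moments of $\xi_i$.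
   Context: Notation: $[d]=\{1,\dots,d\}$ and $\|g\|_{p_0,2}^2=\int_{\mathbb{R}^d}g^2(\mathbf{x})p_0(\mathbf{x})\,d\mathbf{x}$. Function class. For (not necessarily disjoint) $L,U\subseteq[d]$ with $0<|L|+|U|\le s$ and threshold vectors $\mathbf{l}=(l_j,j\in L)$, $\mathbf{u}=(u_j,j\in U)$, let $b^{L,U}_{\mathbf{l},\mathbf{u}}(x_1,\dots,x_d)=\prod_{j\in L}\mathbf{1}(x_j\ge l_j)\cdot\prod_{j\in U}\mathbf{1}(x_j<u_j)$. For $c\in\mathbb{R}$ and finite signed Borel measures $\nu_{L,U}$ on $\mathbb{R}^{|L|+|U|}$, let $$f^{d,s}_{c,\{\nu_{L,U}\}}(\mathbf{x})=c+\sum_{0<|L|+|U|\le s}\int_{\mathbb{R}^{|L|+|U|}}b^{L,U}_{\mathbf{l},\mathbf{u}}(\mathbf{x})\,d\nu_{L,U}(\mathbf{l},\mathbf{u}).$$ $\mathcal{F}^{d,s}_{\infty-\text{ST}}$ is the set of all such functions, and for $f$ in it, $V^{d,s}_{\infty-\text{XGB}}(f)=\inf\{\sum_{0<|L|+|U|\le s}\|\nu_{L,U}\|_{\text{TV}}: f^{d,s}_{c,\{\nu_{L,U}\}}\equiv f\}$, with $\|\nu\|_{\text{TV}}=|\nu|(\mathbb{R}^{|L|+|U|})$. Convention: $O(g_n)$ denotes a quantity bounded by $K g_n$ for all $n\ge 2$, where $K$ depends only on the listed quantities (the "moments of $\xi_i$" being understood to include $\|\xi_1\|_{3,1}$). 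*)

theory Defs
  imports "HOL-Probability.Probability"
begin

section \<open>Signed measures\<close>

text \<open>A finite signed measure on the \<open>\<sigma>\<close>-algebra of \<open>M\<close> is a real-valued countably additive
  set function; only the measurable space underlying \<open>M\<close> is used. Finiteness of the total
  variation follows from real-valuedness.\<close>

definition signed_measure :: "'a measure \<Rightarrow> ('a set \<Rightarrow> real) \<Rightarrow> bool" where
  "signed_measure M \<nu> \<longleftrightarrow>
     \<nu> {} = 0 \<and>
     (\<forall>A :: nat \<Rightarrow> 'a set. range A \<subseteq> sets M \<longrightarrow> disjoint_family A \<longrightarrow>
        (\<lambda>i. \<nu> (A i)) sums \<nu> (\<Union>i. A i))"

definition variation :: "'a measure \<Rightarrow> ('a set \<Rightarrow> real) \<Rightarrow> 'a set \<Rightarrow> ennreal" where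
  "variation M \<nu> A =
     (SUP P \<in> {P. finite P \<and> partition_on A P \<and> P \<subseteq> sets M}. \<Sum>E\<in>P. ennreal \<bar>\<nu> E\<bar>)"

definition tv_norm :: "'a measure \<Rightarrow> ('a set \<Rightarrow> real) \<Rightarrow> ennreal" where
  "tv_norm M \<nu> = variation M \<nu> (space M)"

text \<open>The Jordan decomposition \<open>\<nu>\<^sup>+ = (|\<nu>| + \<nu>) / 2\<close>, \<open>\<nu>\<^sup>- = (|\<nu>| - \<nu>) / 2\<close>.\<close>

definition pos_variation :: "'a measure \<Rightarrow> ('a set \<Rightarrow> real) \<Rightarrow> 'a measure" where
  "pos_variation M \<nu> = measure_of (space M) (sets M)
     (\<lambda>A. ennreal ((enn2real (variation M \<nu> A) + \<nu> A) / 2))"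

definition neg_variation :: "'a measure \<Rightarrow> ('a set \<Rightarrow> real) \<Rightarrow> 'a measure" where
  "neg_variation M \<nu> = measure_of (space M) (sets M)
     (\<lambda>A. ennreal ((enn2real (variation M \<nu> A) - \<nu> A) / 2))"

definition signed_integral :: "'a measure \<Rightarrow> ('a set \<Rightarrow> real) \<Rightarrow> ('a \<Rightarrow> real) \<Rightarrow> real" where
  "signed_integral M \<nu> f =
     (\<integral>x. f x \<partial>pos_variation M \<nu>) - (\<integral>x. f x \<partial>neg_variation M \<nu>)"


section \<open>The function class and its complexity measure\<close>

text \<open>Points of \<open>\<real>\<^sup>d\<close> are functions on \<open>{1..d}\<close> (extended by \<open>undefined\<close>), so that \<open>d\<close> can be
  quantified over inside a formula; \<open>Rd d\<close> carries the product (Borel) \<open>\<sigma>\<close>-algebra and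
  Lebesgue measure.\<close>

definition Rd :: "nat \<Rightarrow> (nat \<Rightarrow> real) measure" where
  "Rd d = (\<Pi>\<^sub>M j\<in>{1..d}. lborel)"

definition basis_fun ::
  "nat set \<Rightarrow> nat set \<Rightarrow> (nat \<Rightarrow> real) \<Rightarrow> (nat \<Rightarrow> real) \<Rightarrow> (nat \<Rightarrow> real) \<Rightarrow> real" where
  "basis_fun L U l u x = (\<Prod>j\<in>L. of_bool (x j \<ge> l j)) * (\<Prod>j\<in>U. of_bool (x j < u j))"

definition index_pairs :: "nat \<Rightarrow> nat \<Rightarrow> (nat set \<times> nat set) set" where
  "index_pairs d s =
     {(L, U). L \<subseteq> {1..d} \<and> U \<subseteq> {1..d} \<and> 0 < card L + card U \<and> card L + card U \<le> s}"

text \<open>Since \<open>L\<close> and \<open>U\<close> may overlap, \<open>\<real>\<^bsup>|L|+|U|\<^esup>\<close> is rendered as \<open>\<real>\<^sup>L \<times> \<real>\<^sup>U\<close>, whose elements are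
  the pairs of threshold vectors.\<close>

definition threshold_space :: "nat set \<Rightarrow> nat set \<Rightarrow> ((nat \<Rightarrow> real) \<times> (nat \<Rightarrow> real)) measure" where
  "threshold_space L U = (\<Pi>\<^sub>M j\<in>L. borel) \<Otimes>\<^sub>M (\<Pi>\<^sub>M j\<in>U. borel)"

type_synonym measure_family =
  "nat set \<Rightarrow> nat set \<Rightarrow> ((nat \<Rightarrow> real) \<times> (nat \<Rightarrow> real)) set \<Rightarrow> real"

definition xgb_fun :: "nat \<Rightarrow> nat \<Rightarrow> real \<Rightarrow> measure_family \<Rightarrow> (nat \<Rightarrow> real) \<Rightarrow> real" where
  "xgb_fun d s c \<nu> x =
     c + (\<Sum>(L, U)\<in>index_pairs d s.
            signed_integral (threshold_space L U) (\<nu> L U) (\<lambda>(l, u). basis_fun L U l u x))"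

definition represents ::
  "nat \<Rightarrow> nat \<Rightarrow> real \<Rightarrow> measure_family \<Rightarrow> ((nat \<Rightarrow> real) \<Rightarrow> real) \<Rightarrow> bool" where
  "represents d s c \<nu> f \<longleftrightarrow>
     (\<forall>(L, U)\<in>index_pairs d s. signed_measure (threshold_space L U) (\<nu> L U)) \<and>
     (\<forall>x\<in>space (Rd d). xgb_fun d s c \<nu> x = f x)"

definition F_ST :: "nat \<Rightarrow> nat \<Rightarrow> ((nat \<Rightarrow> real) \<Rightarrow> real) set" where
  "F_ST d s = {f. \<exists>c \<nu>. represents d s c \<nu> f}"

definition V_XGB :: "nat \<Rightarrow> nat \<Rightarrow> ((nat \<Rightarrow> real) \<Rightarrow> real) \<Rightarrow> ennreal" where
  "V_XGB d s f =
     (INF \<nu> \<in> {\<nu>. \<exists>c. represents d s c \<nu> f}.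
        \<Sum>(L, U)\<in>index_pairs d s. tv_norm (threshold_space L U) (\<nu> L U))"


section \<open>Regression model and minimax risk\<close>

definition L2_sq :: "nat \<Rightarrow> ((nat \<Rightarrow> real) \<Rightarrow> real) \<Rightarrow> ((nat \<Rightarrow> real) \<Rightarrow> real) \<Rightarrow> ennreal" where
  "L2_sq d p0 g = (\<integral>\<^sup>+x. ennreal ((g x)\<^sup>2 * p0 x) \<partial>Rd d)"

definition design_law :: "nat \<Rightarrow> ((nat \<Rightarrow> real) \<Rightarrow> real) \<Rightarrow> (nat \<Rightarrow> real) measure" where
  "design_law d p0 = density (Rd d) (\<lambda>x. ennreal (p0 x))"

text \<open>The canonical probability space of the model: coordinate \<open>i\<close> is the pair of covariate vector
  and error, and the \<open>n\<close> pairs are i.i.d. with independent components, the errors having law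
  \<open>\<mu>\<close>. Expectations of functions of the data depend only on this joint law; working with it,
  rather than with random variables on an arbitrary space, lets one quantify over all models
  within a formula.\<close>

definition model_space ::
  "nat \<Rightarrow> nat \<Rightarrow> ((nat \<Rightarrow> real) \<Rightarrow> real) \<Rightarrow> real measure \<Rightarrow> (nat \<Rightarrow> (nat \<Rightarrow> real) \<times> real) measure" where
  "model_space d n p0 \<mu> = (\<Pi>\<^sub>M i\<in>{1..n}. design_law d p0 \<Otimes>\<^sub>M \<mu>)"

definition data ::
  "nat \<Rightarrow> ((nat \<Rightarrow> real) \<Rightarrow> real) \<Rightarrow> (nat \<Rightarrow> (nat \<Rightarrow> real) \<times> real) \<Rightarrow> (nat \<Rightarrow> (nat \<Rightarrow> real) \<times> real)" where
  "data n f \<omega> = (\<lambda>i\<in>{1..n}. (fst (\<omega> i), f (fst (\<omega> i)) + snd (\<omega> i)))"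

text \<open>An estimator maps a data set and an evaluation point to a real, measurably in both jointly.
  It may depend on \<open>p0\<close>, \<open>\<mu>\<close> and the class, but not on the regression function.\<close>

definition estimators ::
  "nat \<Rightarrow> nat \<Rightarrow> ((nat \<Rightarrow> (nat \<Rightarrow> real) \<times> real) \<Rightarrow> (nat \<Rightarrow> real) \<Rightarrow> real) set" where
  "estimators d n =
     {T. case_prod T \<in> borel_measurable ((\<Pi>\<^sub>M i\<in>{1..n}. Rd d \<Otimes>\<^sub>M borel) \<Otimes>\<^sub>M Rd d)}"

definition risk ::
  "nat \<Rightarrow> nat \<Rightarrow> ((nat \<Rightarrow> real) \<Rightarrow> real) \<Rightarrow> real measure \<Rightarrow>
   ((nat \<Rightarrow> (nat \<Rightarrow> real) \<times> real) \<Rightarrow> (nat \<Rightarrow> real) \<Rightarrow> real) \<Rightarrow> ((nat \<Rightarrow> real) \<Rightarrow> real) \<Rightarrow> ennreal" where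
  "risk d n p0 \<mu> T f =
     (\<integral>\<^sup>+\<omega>. L2_sq d p0 (\<lambda>x. T (data n f \<omega>) x - f x) \<partial>model_space d n p0 \<mu>)"

text \<open>The canonical model loses no generality: the risk is the expected loss in every i.i.d.
  realization of the design and the errors.\<close>

lemma risk_realization:
  assumes \<Omega>: "prob_space \<Omega>" and n: "n \<ge> 1"
    and indep: "prob_space.indep_vars \<Omega> (\<lambda>_. Rd d \<Otimes>\<^sub>M borel) (\<lambda>i \<omega>. (X i \<omega>, \<xi> i \<omega>)) {1..n}"
    and law: "\<And>i. i \<in> {1..n} \<Longrightarrow>
      distr \<Omega> (Rd d \<Otimes>\<^sub>M borel) (\<lambda>\<omega>. (X i \<omega>, \<xi> i \<omega>)) = design_law d p0 \<Otimes>\<^sub>M \<mu>"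
    and p0[measurable]: "p0 \<in> borel_measurable (Rd d)"
    and f[measurable]: "f \<in> borel_measurable (Rd d)"
    and T: "T \<in> estimators d n"
  shows "risk d n p0 \<mu> T f =
    (\<integral>\<^sup>+\<omega>. L2_sq d p0 (\<lambda>x. T (\<lambda>i\<in>{1..n}. (X i \<omega>, f (X i \<omega>) + \<xi> i \<omega>)) x - f x) \<partial>\<Omega>)"
proof -
  interpret prob_space \<Omega> by fact
  let ?Z = "\<lambda>\<omega>. \<lambda>i\<in>{1..n}. (X i \<omega>, \<xi> i \<omega>)"
  let ?N = "\<Pi>\<^sub>M i\<in>{1..n}. Rd d \<Otimes>\<^sub>M borel"
  have rv: "random_variable (Rd d \<Otimes>\<^sub>M borel) (\<lambda>\<omega>. (X i \<omega>, \<xi> i \<omega>))" if "i \<in> {1..n}" for i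
    using indep that by (auto simp: indep_vars_def)
  have Zm: "?Z \<in> measurable \<Omega> ?N"
    by (rule measurable_restrict) (use rv in auto)
  have "distr \<Omega> ?N ?Z =
      (\<Pi>\<^sub>M i\<in>{1..n}. distr \<Omega> (Rd d \<Otimes>\<^sub>M borel) (\<lambda>\<omega>. (X i \<omega>, \<xi> i \<omega>)))"
    using indep n rv by (subst indep_vars_iff_distr_eq_PiM'[symmetric]) auto
  also have "\<dots> = model_space d n p0 \<mu>"
    unfolding model_space_def by (rule PiM_cong) (use law in auto)
  finally have joint: "distr \<Omega> ?N ?Z = model_space d n p0 \<mu>" .
  interpret R: sigma_finite_measure "Rd d"
    unfolding Rd_def by (intro product_sigma_finite.sigma_finite) (unfold_locales, auto)
  have Tm: "case_prod T \<in> borel_measurable (?N \<Otimes>\<^sub>M Rd d)"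
    using T by (simp add: estimators_def)
  have Dm: "data n f \<in> measurable ?N ?N"
    unfolding data_def by measurable
  have TD: "(\<lambda>z. T (data n f (fst z)) (snd z)) \<in> borel_measurable (?N \<Otimes>\<^sub>M Rd d)"
    using measurable_compose[OF _ Tm, of "\<lambda>z. (data n f (fst z), snd z)" "?N \<Otimes>\<^sub>M Rd d"] Dm
    by (auto simp: split_beta intro!: measurable_Pair measurable_compose[OF measurable_fst])
  have meas: "(\<lambda>\<omega>. L2_sq d p0 (\<lambda>x. T (data n f \<omega>) x - f x)) \<in> borel_measurable ?N"
    unfolding L2_sq_def using TD by (intro R.borel_measurable_nn_integral) (simp add: split_beta)
  have "risk d n p0 \<mu> T f =
      (\<integral>\<^sup>+\<omega>. L2_sq d p0 (\<lambda>x. T (data n f \<omega>) x - f x) \<partial>distr \<Omega> ?N ?Z)"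
    by (simp only: risk_def joint)
  moreover have "\<dots> = (\<integral>\<^sup>+\<omega>. L2_sq d p0 (\<lambda>x. T (data n f (?Z \<omega>)) x - f x) \<partial>\<Omega>)"
    using meas by (intro nn_integral_distr Zm) auto
  moreover have "data n f (?Z \<omega>) = (\<lambda>i\<in>{1..n}. (X i \<omega>, f (X i \<omega>) + \<xi> i \<omega>))" for \<omega>
    by (auto simp: data_def fun_eq_iff)
  ultimately show ?thesis by (simp only:)
qed

definition minimax_risk ::
  "nat \<Rightarrow> nat \<Rightarrow> nat \<Rightarrow> real \<Rightarrow> ((nat \<Rightarrow> real) \<Rightarrow> real) \<Rightarrow> real measure \<Rightarrow> ennreal" where
  "minimax_risk d s n V p0 \<mu> =
     (INF T\<in>estimators d n. SUP f\<in>{f \<in> F_ST d s. V_XGB d s f \<le> ennreal V}. risk d n p0 \<mu> T f)"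

definition norm31 :: "real measure \<Rightarrow> ennreal" where
  "norm31 \<mu> = (\<integral>\<^sup>+t\<in>{0..}. ennreal (measure \<mu> {e. \<bar>e\<bar> > t} powr (1/3)) \<partial>lborel)"

definition abs_moments :: "real measure \<Rightarrow> nat \<Rightarrow> ennreal" where
  "abs_moments \<mu> k = (\<integral>\<^sup>+e. ennreal (\<bar>e\<bar> ^ k) \<partial>\<mu>)"

end

theory Submission
  imports Defs
begin

text \<open>The estimator is a median-of-means tournament on a finite net of the function class. Since
  \<open>p0\<close> is known, comparing two net functions \<open>g\<close>, \<open>g'\<close> only requires the inner product of the
  regression function with \<open>g - g'\<close>; block means of differenced responses times \<open>g - g'\<close> estimate it
  with probability of failure \<open>4 ^ (- k)\<close> under second moments of the errors alone, and differencing
  removes the unbounded additive constant of the class, which is estimated by the mean response.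
  The risk is then at most a multiple of the squared radius of the net plus its entropy over \<open>n\<close>.

  For the entropy, a product of threshold indicators is telescoped along dyadic grids in every variable.
  A function in the class becomes a sum over multilevels \<open>q\<close> of functions which are constant on
  disjoint boxes of probability at most \<open>B * 2 ^ (- \<Sum>q)\<close>, and the coefficients of each multilevel are
  bounded in \<open>\<ell>\<^sup>1\<close> by the total variation. Quantizing these coefficients, and adding errors and code
  lengths over the about \<open>Q ^ (sb - 1)\<close> multilevels with \<open>\<Sum>q = Q\<close>, gives the radius
  \<open>2 ^ (- q0) * q0 ^ (sb - 1)\<close> with entropy \<open>2 ^ q0 * q0 ^ (sb - 1)\<close>, and
  \<open>2 ^ (3 * q0) = n * (ln n) ^ (sb - 1)\<close> balances the two terms.\<close>

section \<open>Jordan decomposition\<close>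

text \<open>The entropy is of the order of the inverse radius, up to logarithms, because the
  coefficients of a multilevel are bounded in l1 by the total variation, however many cells there
  are. Truncating them toward zero with step R/m, where R is the l1 bound, leaves an error whose sum
  of squares is a multiple of R^2/m: it is paid for by the size of the coefficients and not by the
  number of cells. Disjointness of the boxes turns this into a squared L2 error B * 2^(-Q) * R^2/m.
  At the critical level m = 2^Q = 2^q0 this is of order 2^(-2 q0), at an entropy of order 2^q0. With
  h = sb - 1, balancing 2^(-2 q0) * q0^(2h) against 2^q0 * q0^h / n is where n^(-2/3) * (ln
  n)^(4h/3) comes from.

  A further obstacle is that the infimum defining the complexity need not be attained. The proof
  therefore works with functions that have an actual representation of total variation below V + 1,
  which fits the factor (V + 1)^2.\<close>

lemma signed_measure_sums:
  assumes "signed_measure M \<nu>" "range A \<subseteq> sets M" "disjoint_family A"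
  shows "(\<lambda>i::nat. \<nu> (A i)) sums \<nu> (\<Union>i. A i)"
  using assms unfolding signed_measure_def by blast

text \<open>Triangle inequality for a series known only to converge: if it does not converge
  absolutely, the right-hand side is infinite.\<close>

lemma ennreal_abs_sums_le:
  fixes x :: "nat \<Rightarrow> real"
  assumes "x sums y"
  shows "ennreal \<bar>y\<bar> \<le> (\<Sum>i. ennreal \<bar>x i\<bar>)"
proof (cases "summable (\<lambda>i. \<bar>x i\<bar>)")
  case True
  have "\<bar>y\<bar> \<le> (\<Sum>i. \<bar>x i\<bar>)"
    using summable_rabs[OF True] assms by (simp add: sums_iff)
  then show ?thesis
    by (subst suminf_ennreal2) (auto simp: True)
next
  case False
  have "(\<Sum>i. ennreal \<bar>x i\<bar>) = \<top>"
    using False summable_suminf_not_top[of "\<lambda>i. \<bar>x i\<bar>"] abs_ge_zero by blast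
  then show ?thesis by simp
qed

lemma sum_le_variation:
  assumes "finite P" "partition_on A P" "P \<subseteq> sets M"
  shows "(\<Sum>E\<in>P. ennreal \<bar>\<nu> E\<bar>) \<le> variation M \<nu> A"
  unfolding variation_def using assms by (intro SUP_upper) auto

lemma abs_le_variation:
  assumes "signed_measure M \<nu>" "A \<in> sets M"
  shows "ennreal \<bar>\<nu> A\<bar> \<le> variation M \<nu> A"
proof (cases "A = {}")
  case True
  then show ?thesis using assms by (simp add: signed_measure_def)
next
  case False
  show ?thesis
    using sum_le_variation[of "{A}" A M \<nu>] False assms partition_on_space[OF False] by simp
qed

lemma variation_empty: "variation M \<nu> {} = 0"
proof -
  have "{P. finite P \<and> partition_on {} P \<and> P \<subseteq> sets M} = {{}}"
    by (auto simp: partition_on_empty)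
  then show ?thesis by (simp add: variation_def)
qed

text \<open>The traces of the pieces on A form a partition of A once the empty ones are dropped, as
  \<open>partition_on\<close> excludes the empty set; empty traces contribute
  \<open>\<nu> {} = 0\<close>.\<close>

lemma variation_restrict_sum_le:
  assumes \<nu>: "signed_measure M \<nu>" and P: "finite P" "disjoint P" "P \<subseteq> sets M" "A \<subseteq> \<Union>P" "A \<in> sets M"
  shows "(\<Sum>E\<in>P. ennreal \<bar>\<nu> (E \<inter> A)\<bar>) \<le> variation M \<nu> A"
proof -
  let ?Q = "(\<lambda>E. E \<inter> A) ` P - {{}}"
  have 1: "(\<Sum>E\<in>P. ennreal \<bar>\<nu> (E \<inter> A)\<bar>) = (\<Sum>E\<in>{E\<in>P. E \<inter> A \<noteq> {}}. ennreal \<bar>\<nu> (E \<inter> A)\<bar>)"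
    by (rule sum.mono_neutral_right) (use P \<nu> in \<open>auto simp: signed_measure_def\<close>)
  have inj: "inj_on (\<lambda>E. E \<inter> A) {E\<in>P. E \<inter> A \<noteq> {}}"
    using P(2) by (fastforce simp: inj_on_def disjoint_def)
  have im: "(\<lambda>E. E \<inter> A) ` {E\<in>P. E \<inter> A \<noteq> {}} = ?Q" by auto
  have "(\<Sum>E\<in>?Q. ennreal \<bar>\<nu> E\<bar>) = (\<Sum>E\<in>{E\<in>P. E \<inter> A \<noteq> {}}. ennreal \<bar>\<nu> (E \<inter> A)\<bar>)"
    unfolding im[symmetric] by (subst sum.reindex[OF inj]) simp
  moreover have "(\<Sum>E\<in>?Q. ennreal \<bar>\<nu> E\<bar>) \<le> variation M \<nu> A"
  proof (rule sum_le_variation)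
    show "partition_on A ?Q"
    proof (rule partition_onI)
      show "\<Union> ?Q = A" using P(4) by blast
      show "disjnt X Y" if "X \<in> ?Q" "Y \<in> ?Q" "X \<noteq> Y" for X Y
        using that P(2) by (fastforce simp: disjnt_def disjoint_def)
    qed auto
  qed (use P in auto)
  ultimately show ?thesis using 1 by simp
qed

text \<open>Every finite partition of the union is refined by the sets A i. Countable additivity of
  \<nu> on each piece and the triangle inequality for series bound its sum, and exchanging the
  finite with the infinite sum leaves, for each i, a partition sum over A i.\<close>

lemma variation_UN_le:
  assumes \<nu>: "signed_measure M \<nu>" and A: "range A \<subseteq> sets M" "disjoint_family A"
  shows "variation M \<nu> (\<Union>i. A i) \<le> (\<Sum>i::nat. variation M \<nu> (A i))"
  unfolding variation_def[of M \<nu> "\<Union>i. A i"]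
proof (rule SUP_least, clarify)
  fix P assume P: "finite P" "partition_on (\<Union>i. A i) P" "P \<subseteq> sets M"
  have "(\<Sum>E\<in>P. ennreal \<bar>\<nu> E\<bar>) \<le> (\<Sum>E\<in>P. \<Sum>i. ennreal \<bar>\<nu> (E \<inter> A i)\<bar>)"
  proof (rule sum_mono)
    fix E assume E: "E \<in> P"
    have "(\<lambda>i. \<nu> (E \<inter> A i)) sums \<nu> (\<Union>i. E \<inter> A i)"
    proof (rule signed_measure_sums[OF \<nu>])
      show "range (\<lambda>i. E \<inter> A i) \<subseteq> sets M" using E P(3) A(1) by auto
      show "disjoint_family (\<lambda>i. E \<inter> A i)" using A(2) unfolding disjoint_family_on_def by blast
    qed
    moreover have "(\<Union>i. E \<inter> A i) = E"
      using E partition_onD1[OF P(2)] by blast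
    ultimately show "ennreal \<bar>\<nu> E\<bar> \<le> (\<Sum>i. ennreal \<bar>\<nu> (E \<inter> A i)\<bar>)"
      using ennreal_abs_sums_le by metis
  qed
  also have "\<dots> = (\<Sum>i. \<Sum>E\<in>P. ennreal \<bar>\<nu> (E \<inter> A i)\<bar>)"
    by (rule suminf_sum[symmetric]) auto
  also have "\<dots> \<le> (\<Sum>i. variation M \<nu> (A i))"
  proof (rule suminf_le)
    fix i show "(\<Sum>E\<in>P. ennreal \<bar>\<nu> (E \<inter> A i)\<bar>) \<le> variation M \<nu> (A i)"
      using P A partition_onD1[OF P(2)] partition_onD2[OF P(2)]
      by (intro variation_restrict_sum_le[OF \<nu>]) auto
  qed auto
  finally show "(\<Sum>E\<in>P. ennreal \<bar>\<nu> E\<bar>) \<le> (\<Sum>i. variation M \<nu> (A i))" .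
qed

lemma le_enn2real_iff: "x < \<infinity> \<Longrightarrow> r \<le> enn2real x \<longleftrightarrow> ennreal r \<le> x"
  by (metis enn2real_nonneg ennreal_enn2real ennreal_le_iff infinity_ennreal_def)

text \<open>Needed because addition commutes with suprema in \<open>ennreal\<close> only over
  nonempty index sets.\<close>

lemma partition_sets_nonempty:
  assumes "A \<in> sets M"
  shows "{P. finite P \<and> partition_on A P \<and> P \<subseteq> sets M} \<noteq> {}"
proof (cases "A = {}")
  case True
  then have "{} \<in> {P. finite P \<and> partition_on A P \<and> P \<subseteq> sets M}"
    by (simp add: partition_on_empty)
  then show ?thesis by blast
next
  case False
  then have "{A} \<in> {P. finite P \<and> partition_on A P \<and> P \<subseteq> sets M}"
    using assms by (simp add: partition_on_space)
  then show ?thesis by blast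
qed

text \<open>A partition of A and one of B together partition the disjoint union. They share no
  piece, since such a piece would be nonempty and contained in both sets. The suprema over the two
  partitions are then taken one after the other.\<close>

lemma variation_superadd:
  assumes "A \<inter> B = {}" "A \<in> sets M" "B \<in> sets M"
  shows "variation M \<nu> A + variation M \<nu> B \<le> variation M \<nu> (A \<union> B)"
proof -
  let ?S = "\<lambda>A. {P. finite P \<and> partition_on A P \<and> P \<subseteq> sets M}"
  have *: "(\<Sum>E\<in>P. ennreal \<bar>\<nu> E\<bar>) + (\<Sum>E\<in>Q. ennreal \<bar>\<nu> E\<bar>) \<le> variation M \<nu> (A \<union> B)"
    if P: "P \<in> ?S A" and Q: "Q \<in> ?S B" for P Q
  proof -
    have disj: "P \<inter> Q = {}"
    proof (rule ccontr)
      assume "P \<inter> Q \<noteq> {}"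
      then obtain E where E: "E \<in> P" "E \<in> Q" by blast
      have "E \<subseteq> A" "E \<subseteq> B" "E \<noteq> {}"
        using E P Q partition_onD1[of A P] partition_onD1[of B Q] partition_onD3[of A P] by blast+
      then show False using assms(1) by blast
    qed
    have "(\<Sum>E\<in>P. ennreal \<bar>\<nu> E\<bar>) + (\<Sum>E\<in>Q. ennreal \<bar>\<nu> E\<bar>) = (\<Sum>E\<in>P \<union> Q. ennreal \<bar>\<nu> E\<bar>)"
      using P Q disj by (subst sum.union_disjoint) auto
    also have "\<dots> \<le> variation M \<nu> (A \<union> B)"
    proof (rule sum_le_variation)
      have U: "\<Union>P = A" "\<Union>Q = B" using P Q partition_onD1 by blast+
      show "partition_on (A \<union> B) (P \<union> Q)"
      proof (rule partition_onI)
        fix X Y assume XY: "X \<in> P \<union> Q" "Y \<in> P \<union> Q" "X \<noteq> Y"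
        have "disjnt X Y" if "X \<in> P" "Y \<in> P" using that XY P by (auto simp: partition_on_def disjoint_def disjnt_def)
        moreover have "disjnt X Y" if "X \<in> Q" "Y \<in> Q" using that XY Q by (auto simp: partition_on_def disjoint_def disjnt_def)
        moreover have "disjnt X Y" if "X \<in> P \<and> Y \<in> Q \<or> X \<in> Q \<and> Y \<in> P"
          using that U assms(1) unfolding disjnt_def by blast
        ultimately show "disjnt X Y" using XY by blast
      next
        show "{} \<notin> P \<union> Q" using P Q partition_onD3 by blast
        show "\<Union> (P \<union> Q) = A \<union> B" using U by blast
      qed
    qed (use P Q in auto)
    finally show ?thesis .
  qed
  have "(SUP P\<in>?S A. (\<Sum>E\<in>P. ennreal \<bar>\<nu> E\<bar>) + variation M \<nu> B) \<le> variation M \<nu> (A \<union> B)"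
  proof (rule SUP_least)
    fix P assume P: "P \<in> ?S A"
    have "(\<Sum>E\<in>P. ennreal \<bar>\<nu> E\<bar>) + variation M \<nu> B = (SUP Q\<in>?S B. (\<Sum>E\<in>P. ennreal \<bar>\<nu> E\<bar>) + (\<Sum>E\<in>Q. ennreal \<bar>\<nu> E\<bar>))"
      unfolding variation_def[of M \<nu> B]
      using ennreal_SUP_add_right[OF partition_sets_nonempty[OF assms(3)],
        of "\<Sum>E\<in>P. ennreal \<bar>\<nu> E\<bar>" "\<lambda>Q. \<Sum>E\<in>Q. ennreal \<bar>\<nu> E\<bar>"] .
    also have "\<dots> \<le> variation M \<nu> (A \<union> B)"
      by (rule SUP_least) (rule *[OF P])
    finally show "(\<Sum>E\<in>P. ennreal \<bar>\<nu> E\<bar>) + variation M \<nu> B \<le> variation M \<nu> (A \<union> B)" .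
  qed
  also have "(SUP P\<in>?S A. (\<Sum>E\<in>P. ennreal \<bar>\<nu> E\<bar>) + variation M \<nu> B) = variation M \<nu> A + variation M \<nu> B"
    unfolding variation_def[of M \<nu> A]
    by (rule ennreal_SUP_add_left[OF partition_sets_nonempty[OF assms(2)],
        of "\<lambda>P. \<Sum>E\<in>P. ennreal \<bar>\<nu> E\<bar>" "variation M \<nu> B"])
  finally show ?thesis .
qed

lemma variation_mono:
  assumes "A \<subseteq> B" "A \<in> sets M" "B \<in> sets M"
  shows "variation M \<nu> A \<le> variation M \<nu> B"
proof -
  have "variation M \<nu> A + 0 \<le> variation M \<nu> A + variation M \<nu> (B - A)"
    by (intro add_left_mono) simp
  also have "\<dots> \<le> variation M \<nu> (A \<union> (B - A))"
    using assms by (intro variation_superadd) auto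
  also have "A \<union> (B - A) = B" using assms by auto
  finally show ?thesis by simp
qed

lemma variation_finite_superadd:
  fixes A :: "nat \<Rightarrow> 'a set"
  assumes A: "range A \<subseteq> sets M" "disjoint_family A"
  shows "(\<Sum>i<n. variation M \<nu> (A i)) \<le> variation M \<nu> (\<Union>i<n. A i)"
proof (induction n)
  case (Suc n)
  have "(\<Sum>i<Suc n. variation M \<nu> (A i)) \<le> variation M \<nu> (\<Union>i<n. A i) + variation M \<nu> (A n)"
    using Suc by (simp add: add_right_mono)
  also have "\<dots> \<le> variation M \<nu> ((\<Union>i<n. A i) \<union> A n)"
  proof (rule variation_superadd)
    show "(\<Union>i<n. A i) \<inter> A n = {}"
    proof -
      have "A i \<inter> A n = {}" if "i < n" for i
        by (rule disjoint_family_onD[OF A(2)]) (use that in auto)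
      then show ?thesis by blast
    qed
  qed (use A in auto)
  also have "(\<Union>i<n. A i) \<union> A n = (\<Union>i<Suc n. A i)"
    by (auto simp: less_Suc_eq)
  finally show ?case .
qed simp

text \<open>One inequality follows from superadditivity applied to partial sums, the other from
  refining partitions; finiteness of the variation plays no part at this point.\<close>

lemma variation_countably_additive:
  fixes A :: "nat \<Rightarrow> 'a set"
  assumes \<nu>: "signed_measure M \<nu>" and A: "range A \<subseteq> sets M" "disjoint_family A"
  shows "(\<Sum>i. variation M \<nu> (A i)) = variation M \<nu> (\<Union>i. A i)"
proof (rule antisym)
  show "(\<Sum>i. variation M \<nu> (A i)) \<le> variation M \<nu> (\<Union>i. A i)"
  proof (rule suminf_le_const)
    fix n
    have "(\<Union>i<n. A i) \<in> sets M" "(\<Union>i. A i) \<in> sets M" using A by auto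
    then show "(\<Sum>i<n. variation M \<nu> (A i)) \<le> variation M \<nu> (\<Union>i. A i)"
      by (intro order_trans[OF variation_finite_superadd[OF A]] variation_mono) auto
  qed simp
  show "variation M \<nu> (\<Union>i. A i) \<le> (\<Sum>i. variation M \<nu> (A i))"
    using variation_UN_le[OF \<nu> A] .
qed

text \<open>\<open>measure_of\<close> returns the intended set function only if it is positive and
  countably additive. Finite total variation lets \<open>enn2real\<close> respect sums, and |\<nu>
  A| being at most the variation of A makes both parts nonnegative. The sign c serves the positive
  and the negative part at once.\<close>

lemma variation_parts_emeasure:
  assumes \<nu>: "signed_measure M \<nu>" and fin: "tv_norm M \<nu> < \<infinity>" and c: "c = 1 \<or> c = (-1::real)"
    and A: "A \<in> sets M"
  shows "emeasure (measure_of (space M) (sets M)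
      (\<lambda>A. ennreal ((enn2real (variation M \<nu> A) + c * \<nu> A) / 2))) A
    = ennreal ((enn2real (variation M \<nu> A) + c * \<nu> A) / 2)"
proof -
  let ?m = "\<lambda>A. (enn2real (variation M \<nu> A) + c * \<nu> A) / 2"
  have vfin: "variation M \<nu> A < \<infinity>" if "A \<in> sets M" for A
    using variation_mono[where \<nu>=\<nu>, OF sets.sets_into_space[OF that] that sets.top] fin
    unfolding tv_norm_def by (rule le_less_trans)
  have nonneg: "0 \<le> ?m A" if "A \<in> sets M" for A
  proof -
    have "\<bar>\<nu> A\<bar> \<le> enn2real (variation M \<nu> A)"
      using abs_le_variation[OF \<nu> that] vfin[OF that]
      by (subst le_enn2real_iff; simp)
    then show ?thesis using c by auto
  qed
  have "countably_additive (sets M) (\<lambda>A. ennreal (?m A))"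
  proof (rule countably_additiveI)
    fix F :: "nat \<Rightarrow> 'a set" assume F: "range F \<subseteq> sets M" "disjoint_family F" and U: "(\<Union>i. F i) \<in> sets M"
    have "(\<lambda>i. ennreal (enn2real (variation M \<nu> (F i)))) sums ennreal (enn2real (variation M \<nu> (\<Union>i. F i)))"
      using variation_countably_additive[OF \<nu> F] vfin U F(1)
      by (simp add: sums_iff image_subset_iff)
    then have "(\<lambda>i. enn2real (variation M \<nu> (F i))) sums enn2real (variation M \<nu> (\<Union>i. F i))"
      by (simp add: sums_ennreal)
    then have "(\<lambda>i. ?m (F i)) sums ?m (\<Union>i. F i)"
      by (intro sums_divide sums_add sums_mult signed_measure_sums[OF \<nu> F])
    then have "(\<lambda>i. ennreal (?m (F i))) sums ennreal (?m (\<Union>i. F i))"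
    proof (subst sums_ennreal)
      show "0 \<le> ?m (F i)" for i using F(1) by (intro nonneg) auto
    qed (use nonneg[OF U] in auto)
    then show "(\<Sum>i. ennreal (?m (F i))) = ennreal (?m (\<Union>i. F i))"
      by (simp add: sums_iff)
  qed
  moreover have "positive (sets M) (\<lambda>A. ennreal (?m A))"
    using \<nu> by (simp add: positive_def variation_empty signed_measure_def)
  ultimately show ?thesis
    using A by (intro emeasure_measure_of_sigma) (auto intro: sets.sigma_algebra_axioms)
qed

text \<open>The identity for the total masses is what later turns l1 bounds for the two positive
  parts into a bound by the variation norm without any loss.\<close>

lemma
  assumes \<nu>: "signed_measure M \<nu>" and fin: "tv_norm M \<nu> < \<infinity>"
  shows finite_measure_pos_variation: "finite_measure (pos_variation M \<nu>)"
    and finite_measure_neg_variation: "finite_measure (neg_variation M \<nu>)"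
    and measure_pos_neg_variation_space:
      "measure (pos_variation M \<nu>) (space M) + measure (neg_variation M \<nu>) (space M) = enn2real (tv_norm M \<nu>)"
proof -
  have p: "emeasure (pos_variation M \<nu>) (space M) = ennreal ((enn2real (variation M \<nu> (space M)) + \<nu> (space M)) / 2)"
    using variation_parts_emeasure[OF \<nu> fin, of 1 "space M"] by (simp add: pos_variation_def)
  have n: "emeasure (neg_variation M \<nu>) (space M) = ennreal ((enn2real (variation M \<nu> (space M)) - \<nu> (space M)) / 2)"
    using variation_parts_emeasure[OF \<nu> fin, of "-1" "space M"] by (simp add: neg_variation_def)
  have sp: "space (pos_variation M \<nu>) = space M" "space (neg_variation M \<nu>) = space M"
    by (auto simp: pos_variation_def neg_variation_def space_measure_of_conv)
  show "finite_measure (pos_variation M \<nu>)" "finite_measure (neg_variation M \<nu>)"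
    by (auto intro!: finite_measureI simp: sp p n)
  have "\<bar>\<nu> (space M)\<bar> \<le> enn2real (variation M \<nu> (space M))"
    using abs_le_variation[OF \<nu> sets.top] fin unfolding tv_norm_def
    by (subst le_enn2real_iff; simp)
  then show "measure (pos_variation M \<nu>) (space M) + measure (neg_variation M \<nu>) (space M) = enn2real (tv_norm M \<nu>)"
    by (simp add: measure_def p n tv_norm_def field_simps)
qed

lemma sets_pos_variation [simp, measurable_cong]: "sets (pos_variation M \<nu>) = sets M"
  and sets_neg_variation [simp, measurable_cong]: "sets (neg_variation M \<nu>) = sets M"
  and space_pos_variation [simp]: "space (pos_variation M \<nu>) = space M"
  and space_neg_variation [simp]: "space (neg_variation M \<nu>) = space M"
  by (auto simp: pos_variation_def neg_variation_def space_measure_of_conv)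

section \<open>Independent sums and medians of means\<close>

context prob_space
begin

lemma indep_vars_mult_integral:
  fixes X :: "'i \<Rightarrow> 'a \<Rightarrow> real"
  assumes ind: "indep_vars (\<lambda>_. borel) X I" and ij: "i \<in> I" "j \<in> I" "i \<noteq> j"
    and int: "integrable M (X i)" "integrable M (X j)"
  shows "integrable M (\<lambda>\<omega>. X i \<omega> * X j \<omega>)"
    and "expectation (\<lambda>\<omega>. X i \<omega> * X j \<omega>) = expectation (X i) * expectation (X j)"
proof -
  have i2: "indep_vars (\<lambda>_. borel) X {i, j}"
    by (rule indep_vars_subset[OF ind]) (use ij in auto)
  have p: "(\<Prod>l\<in>{i,j}. f l) = f i * f j" for f :: "'i \<Rightarrow> real"
    using ij by simp
  show "integrable M (\<lambda>\<omega>. X i \<omega> * X j \<omega>)"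
    using indep_vars_integrable[OF _ i2] int unfolding p by auto
  show "expectation (\<lambda>\<omega>. X i \<omega> * X j \<omega>) = expectation (X i) * expectation (X j)"
    using indep_vars_lebesgue_integral[OF _ i2] int unfolding p by auto
qed

text \<open>Centring only lowers second moments, so a bound v on the raw second moment suffices; the
  cross terms of the centred variables vanish by independence.\<close>

lemma indep_mean_sq_deviation:
  fixes X :: "'i \<Rightarrow> 'a \<Rightarrow> real"
  assumes fin: "finite I" "I \<noteq> {}" and ind: "indep_vars (\<lambda>_. borel) X I"
    and sq: "\<And>i. i \<in> I \<Longrightarrow> integrable M (\<lambda>\<omega>. (X i \<omega>)\<^sup>2)"
    and mean: "\<And>i. i \<in> I \<Longrightarrow> expectation (X i) = m"
    and v: "\<And>i. i \<in> I \<Longrightarrow> expectation (\<lambda>\<omega>. (X i \<omega>)\<^sup>2) \<le> v"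
  shows "integrable M (\<lambda>\<omega>. ((\<Sum>i\<in>I. X i \<omega>) / real (card I) - m)\<^sup>2)"
    and "expectation (\<lambda>\<omega>. ((\<Sum>i\<in>I. X i \<omega>) / real (card I) - m)\<^sup>2) \<le> v / real (card I)"
proof -
  define Y where "Y = (\<lambda>i \<omega>. X i \<omega> - m)"
  have rv: "X i \<in> borel_measurable M" if "i \<in> I" for i
    using ind that by (auto simp: indep_vars_def)
  have intX: "integrable M (X i)" if "i \<in> I" for i
    using square_integrable_imp_integrable[OF rv[OF that] sq[OF that]] .
  have indY: "indep_vars (\<lambda>_. borel) Y I"
    unfolding Y_def by (rule indep_vars_compose2[OF ind]) auto
  have intY: "integrable M (Y i)" if "i \<in> I" for i
    unfolding Y_def using intX[OF that] by simp
  have EY: "expectation (Y i) = 0" if "i \<in> I" for i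
    unfolding Y_def using intX[OF that] mean[OF that] by (simp add: prob_space)
  have Ysq: "(Y i \<omega>)\<^sup>2 = (X i \<omega>)\<^sup>2 - 2 * m * X i \<omega> + m\<^sup>2" for i \<omega>
    by (simp add: Y_def power2_eq_square algebra_simps)
  have intY2: "integrable M (\<lambda>\<omega>. (Y i \<omega>)\<^sup>2)" if "i \<in> I" for i
    unfolding Ysq using intX[OF that] sq[OF that] by simp
  have EY2: "expectation (\<lambda>\<omega>. (Y i \<omega>)\<^sup>2) \<le> v" if "i \<in> I" for i
  proof -
    have "expectation (\<lambda>\<omega>. (Y i \<omega>)\<^sup>2) = expectation (\<lambda>\<omega>. (X i \<omega>)\<^sup>2) - m\<^sup>2"
      unfolding Ysq using intX[OF that] sq[OF that] mean[OF that]
      by (simp add: prob_space power2_eq_square)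
    also have "\<dots> \<le> v" using v[OF that] by (smt (verit) zero_le_power2)
    finally show ?thesis .
  qed
  have intYY: "integrable M (\<lambda>\<omega>. Y i \<omega> * Y j \<omega>)" if "i \<in> I" "j \<in> I" for i j
    using intY2[OF that(1)] indep_vars_mult_integral(1)[OF indY that _ intY intY] that
    by (cases "i = j") (auto simp: power2_eq_square)
  have EYY: "expectation (\<lambda>\<omega>. Y i \<omega> * Y j \<omega>) = (if i = j then expectation (\<lambda>\<omega>. (Y i \<omega>)\<^sup>2) else 0)"
    if "i \<in> I" "j \<in> I" for i j
    using indep_vars_mult_integral(2)[OF indY that _ intY intY] that EY
    by (cases "i = j") (auto simp: power2_eq_square)
  have sqsum: "(\<Sum>i\<in>I. Y i \<omega>)\<^sup>2 = (\<Sum>i\<in>I. \<Sum>j\<in>I. Y i \<omega> * Y j \<omega>)" for \<omega>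
    by (simp add: power2_eq_square sum_product)
  have c: "real (card I) > 0" using fin by (simp add: card_gt_0_iff)
  have dev: "(\<Sum>i\<in>I. X i \<omega>) / real (card I) - m = (\<Sum>i\<in>I. Y i \<omega>) / real (card I)" for \<omega>
    using c by (simp add: Y_def sum_subtractf field_simps)
  have int: "integrable M (\<lambda>\<omega>. (\<Sum>i\<in>I. Y i \<omega>)\<^sup>2)"
    unfolding sqsum using intYY by (intro Bochner_Integration.integrable_sum) auto
  show "integrable M (\<lambda>\<omega>. ((\<Sum>i\<in>I. X i \<omega>) / real (card I) - m)\<^sup>2)"
    unfolding dev power_divide using int by simp
  have "expectation (\<lambda>\<omega>. (\<Sum>i\<in>I. Y i \<omega>)\<^sup>2) = (\<Sum>i\<in>I. \<Sum>j\<in>I. expectation (\<lambda>\<omega>. Y i \<omega> * Y j \<omega>))"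
    unfolding sqsum using intYY by (subst Bochner_Integration.integral_sum; (intro sum.cong refl Bochner_Integration.integral_sum Bochner_Integration.integrable_sum)?; simp)
  also have "\<dots> = (\<Sum>i\<in>I. expectation (\<lambda>\<omega>. (Y i \<omega>)\<^sup>2))"
    using fin by (intro sum.cong refl) (simp add: EYY)
  also have "\<dots> \<le> real (card I) * v"
    using EY2 by (intro sum_bounded_above) auto
  finally have "expectation (\<lambda>\<omega>. (\<Sum>i\<in>I. Y i \<omega>)\<^sup>2) \<le> real (card I) * v" .
  then show "expectation (\<lambda>\<omega>. ((\<Sum>i\<in>I. X i \<omega>) / real (card I) - m)\<^sup>2) \<le> v / real (card I)"
    unfolding dev power_divide using c by (simp add: power2_eq_square field_simps)
qed

text \<open>Chebyshev's inequality. The strict inequality in the event keeps the degenerate case t =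
  0 true, where Z vanishes almost surely; this case arises when two compared net functions agree
  almost everywhere.\<close>

lemma prob_deviation_le:
  fixes Z :: "'a \<Rightarrow> real"
  assumes Z[measurable]: "Z \<in> borel_measurable M" and int: "integrable M (\<lambda>\<omega>. (Z \<omega>)\<^sup>2)"
    and E: "expectation (\<lambda>\<omega>. (Z \<omega>)\<^sup>2) \<le> t\<^sup>2 / 64" and t: "t \<ge> 0"
  shows "prob {\<omega>\<in>space M. t < \<bar>Z \<omega>\<bar>} \<le> 1/64"
proof (cases "t = 0")
  case True
  then have "expectation (\<lambda>\<omega>. (Z \<omega>)\<^sup>2) = 0"
    using E by (intro antisym) (auto intro!: integral_nonneg_AE)
  then have "AE \<omega> in M. (Z \<omega>)\<^sup>2 = 0"
    using integral_nonneg_eq_0_iff_AE[OF int] by auto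
  then have "AE \<omega> in M. \<not> t < \<bar>Z \<omega>\<bar>"
    by (rule AE_mp) (use True in auto)
  then have "prob {\<omega>\<in>space M. t < \<bar>Z \<omega>\<bar>} = 0"
    by (intro prob_eq_0_AE) auto
  then show ?thesis by simp
next
  case False
  then have t: "t > 0" using t by simp
  have "prob {\<omega>\<in>space M. t < \<bar>Z \<omega>\<bar>} \<le> prob {\<omega>\<in>space M. t \<le> \<bar>Z \<omega>\<bar>}"
    by (intro finite_measure_mono) auto
  also have "\<dots> \<le> expectation (\<lambda>\<omega>. (Z \<omega>)\<^sup>2) / t\<^sup>2"
    by (rule second_moment_method) (use int t in auto)
  also have "\<dots> \<le> 1/64" using E t by (simp add: field_simps)
  finally show ?thesis .
qed

text \<open>Each block is bad with probability at most 1/64 = 1/8^2. A given set of at least k/2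
  blocks is entirely bad with probability at most 64^(-k/2) = 8^(-k) by independence, and there are
  at most 2^k such sets, which leaves 4^(-k).\<close>

lemma median_of_means_deviation:
  fixes W :: "nat \<Rightarrow> 'a \<Rightarrow> real"
  assumes ind: "indep_vars (\<lambda>_. borel) W {..<k*b}" and b: "b > 0"
    and sq: "\<And>i. i < k*b \<Longrightarrow> integrable M (\<lambda>\<omega>. (W i \<omega>)\<^sup>2)"
    and mean: "\<And>i. i < k*b \<Longrightarrow> expectation (W i) = m"
    and v: "\<And>i. i < k*b \<Longrightarrow> expectation (\<lambda>\<omega>. (W i \<omega>)\<^sup>2) \<le> v"
    and t: "64 * v \<le> real b * t\<^sup>2" "t \<ge> 0"
  defines "bad \<equiv> \<lambda>\<beta> \<omega>. t < \<bar>(\<Sum>p\<in>{\<beta>*b..<\<beta>*b+b}. W p \<omega>) / real b - m\<bar>"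
  shows "{\<omega>\<in>space M. k \<le> 2 * card {\<beta>\<in>{..<k}. bad \<beta> \<omega>}} \<in> events"
    and "prob {\<omega>\<in>space M. k \<le> 2 * card {\<beta>\<in>{..<k}. bad \<beta> \<omega>}} \<le> 1 / 4 ^ k"
proof -
  define K where "K = (\<lambda>\<beta>. {\<beta>*b..<\<beta>*b+b})"
  define S where "S = (\<lambda>\<beta> \<omega>. (\<Sum>p\<in>K \<beta>. W p \<omega>) / real b)"
  have Kle: "K \<beta> \<subseteq> {..<k*b}" if "\<beta> < k" for \<beta>
  proof -
    have "(\<beta> + 1) * b \<le> k * b" using that by (intro mult_right_mono) auto
    then show ?thesis by (auto simp: K_def)
  qed
  have Kdisj: "disjoint_family_on K {..<k}"
  proof -
    have "\<beta> = \<gamma>" if "p \<in> K \<beta>" "p \<in> K \<gamma>" for p \<beta> \<gamma>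
    proof -
      have "\<beta> = p div b" "\<gamma> = p div b"
        using that b by (auto simp: K_def intro!: sym[OF div_nat_eqI] simp: mult.commute)
      then show ?thesis by simp
    qed
    then show ?thesis unfolding disjoint_family_on_def by blast
  qed
  have rv[measurable]: "W i \<in> borel_measurable M" if "i < k * b" for i
    using ind that by (auto simp: indep_vars_def)
  have rvS: "S \<beta> \<in> borel_measurable M" if "\<beta> < k" for \<beta>
    unfolding S_def using rv Kle[OF that] by (intro borel_measurable_divide borel_measurable_sum) auto
  have indS: "indep_vars (\<lambda>_. borel) S {..<k}"
  proof -
    have "indep_vars (\<lambda>\<beta>. PiM (K \<beta>) (\<lambda>_. borel)) (\<lambda>\<beta> \<omega>. restrict (\<lambda>i. W i \<omega>) (K \<beta>)) {..<k}"
      by (rule indep_vars_restrict[OF ind _ Kdisj]) (use Kle in auto)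
    then have "indep_vars (\<lambda>_. borel) (\<lambda>\<beta> \<omega>. (\<lambda>\<beta> x. (\<Sum>p\<in>K \<beta>. x p) / real b) \<beta> (restrict (\<lambda>i. W i \<omega>) (K \<beta>))) {..<k}"
      by (rule indep_vars_compose2) auto
    then show ?thesis by (simp add: S_def)
  qed
  have cK: "finite (K \<beta>)" "K \<beta> \<noteq> {}" "card (K \<beta>) = b" for \<beta> using b by (auto simp: K_def)
  define A where "A = {x::real. t < \<bar>x - m\<bar>}"
  have A: "A \<in> sets borel" unfolding A_def by measurable
  have bad: "bad \<beta> \<omega> \<longleftrightarrow> S \<beta> \<omega> \<in> A" for \<beta> \<omega> by (simp add: bad_def S_def A_def K_def)
  have pbad: "prob (S \<beta> -` A \<inter> space M) \<le> 1/64" if "\<beta> < k" for \<beta>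
  proof -
    have indK: "indep_vars (\<lambda>_. borel) W (K \<beta>)"
      by (rule indep_vars_subset[OF ind Kle[OF that]])
    have in_k: "p < k * b" if "p \<in> K \<beta>" for p using Kle[OF \<open>\<beta> < k\<close>] that by auto
    have int: "integrable M (\<lambda>\<omega>. (S \<beta> \<omega> - m)\<^sup>2)"
      and le: "expectation (\<lambda>\<omega>. (S \<beta> \<omega> - m)\<^sup>2) \<le> v / real b"
      using indep_mean_sq_deviation[OF cK(1,2) indK sq[OF in_k] mean[OF in_k] v[OF in_k]]
      unfolding S_def cK(3) by auto
    have "v / real b \<le> t\<^sup>2 / 64" using t b by (simp add: field_simps)
    with le have "expectation (\<lambda>\<omega>. (S \<beta> \<omega> - m)\<^sup>2) \<le> t\<^sup>2 / 64" by (rule order_trans)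
    then have "prob {\<omega>\<in>space M. t < \<bar>S \<beta> \<omega> - m\<bar>} \<le> 1/64"
      using rvS[OF that] t(2) int by (intro prob_deviation_le) auto
    moreover have "{\<omega>\<in>space M. t < \<bar>S \<beta> \<omega> - m\<bar>} = S \<beta> -` A \<inter> space M"
      by (auto simp: A_def)
    ultimately show ?thesis by simp
  qed
  define \<J> where "\<J> = {J. J \<subseteq> {..<k} \<and> k \<le> 2 * card J}"
  define B where "B = (\<lambda>J. {\<omega>\<in>space M. \<forall>\<beta>\<in>J. S \<beta> \<omega> \<in> A})"
  have fJ: "finite \<J>" and cJ: "card \<J> \<le> 2 ^ k"
  proof -
    have sub: "\<J> \<subseteq> Pow {..<k}" by (auto simp: \<J>_def)
    show "finite \<J>" by (rule finite_subset[OF sub]) simp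
    show "card \<J> \<le> 2 ^ k" using card_mono[OF _ sub] by (simp add: card_Pow)
  qed
  have Bev: "B J \<in> events" if "J \<in> \<J>" for J
  proof -
    have "finite J" using that by (auto simp: \<J>_def intro: finite_subset)
    moreover have "{\<omega>\<in>space M. S \<beta> \<omega> \<in> A} \<in> events" if "\<beta> \<in> J" for \<beta>
      using measurable_sets[OF rvS A, of \<beta>] that \<open>J \<in> \<J>\<close>
      by (auto simp: \<J>_def vimage_def Int_def conj_commute)
    ultimately show ?thesis unfolding B_def by (intro sets.sets_Collect_finite_All) auto
  qed
  have pB: "prob (B J) \<le> 1 / 8 ^ k" if J: "J \<in> \<J>" for J
  proof (cases "J = {}")
    case True
    then have "k = 0" using J by (simp add: \<J>_def)
    then show ?thesis by simp
  next
    case False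
    have Jf: "finite J" and Js: "J \<subseteq> {..<k}" and Jc: "k \<le> 2 * card J"
      using J by (auto simp: \<J>_def intro: finite_subset)
    have "B J = (\<Inter>\<beta>\<in>J. S \<beta> -` A \<inter> space M)"
      using False by (auto simp: B_def)
    then have "prob (B J) = (\<Prod>\<beta>\<in>J. prob (S \<beta> -` A \<inter> space M))"
      using indep_varsD[OF indS False Jf Js] A by simp
    also have "\<dots> \<le> (\<Prod>\<beta>\<in>J. 1/64)"
      using pbad Js by (intro prod_mono) auto
    also have "\<dots> = 1 / 8 ^ (2 * card J)" by (simp add: power_mult power_divide)
    also have "\<dots> \<le> 1 / 8 ^ k" using Jc by (intro divide_left_mono power_increasing) auto
    finally show ?thesis .
  qed
  have eq: "{\<omega>\<in>space M. k \<le> 2 * card {\<beta>\<in>{..<k}. bad \<beta> \<omega>}} = (\<Union>J\<in>\<J>. B J)"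
  proof (intro set_eqI iffI)
    fix \<omega> assume \<omega>: "\<omega> \<in> {\<omega>\<in>space M. k \<le> 2 * card {\<beta>\<in>{..<k}. bad \<beta> \<omega>}}"
    then have "{\<beta>\<in>{..<k}. bad \<beta> \<omega>} \<in> \<J>" "\<omega> \<in> B {\<beta>\<in>{..<k}. bad \<beta> \<omega>}"
      by (auto simp: \<J>_def B_def bad)
    then show "\<omega> \<in> (\<Union>J\<in>\<J>. B J)" by blast
  next
    fix \<omega> assume "\<omega> \<in> (\<Union>J\<in>\<J>. B J)"
    then obtain J where J: "J \<in> \<J>" "\<omega> \<in> B J" by blast
    then have "J \<subseteq> {\<beta>\<in>{..<k}. bad \<beta> \<omega>}" by (auto simp: \<J>_def B_def bad)
    then have "card J \<le> card {\<beta>\<in>{..<k}. bad \<beta> \<omega>}" by (intro card_mono) auto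
    then show "\<omega> \<in> {\<omega>\<in>space M. k \<le> 2 * card {\<beta>\<in>{..<k}. bad \<beta> \<omega>}}"
      using J by (auto simp: \<J>_def B_def)
  qed
  show "{\<omega>\<in>space M. k \<le> 2 * card {\<beta>\<in>{..<k}. bad \<beta> \<omega>}} \<in> events"
    unfolding eq using Bev fJ by auto
  have "prob (\<Union>J\<in>\<J>. B J) \<le> (\<Sum>J\<in>\<J>. prob (B J))"
    using Bev fJ by (intro finite_measure_subadditive_finite) auto
  also have "\<dots> \<le> real (card \<J>) * (1 / 8 ^ k)"
    using pB by (intro sum_bounded_above) auto
  also have "\<dots> \<le> 2 ^ k * (1 / 8 ^ k)"
    using cJ by (intro mult_right_mono) (simp_all add: numeral_power_le_of_nat_cancel_iff of_nat_le_numeral_power_cancel_iff)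
  also have "\<dots> = 1 / 4 ^ k"
  proof -
    have "(8::real) ^ k = 2 ^ k * 4 ^ k" by (simp flip: power_mult_distrib)
    then show ?thesis by simp
  qed
  finally show "prob {\<omega>\<in>space M. k \<le> 2 * card {\<beta>\<in>{..<k}. bad \<beta> \<omega>}} \<le> 1 / 4 ^ k"
    unfolding eq .
qed

end

text \<open>A majority of blocks favouring \<open>i\<close> and a majority of accurate blocks have a common block.\<close>

lemma tournament_selection:
  fixes D :: "nat \<Rightarrow> real" and st :: "nat \<Rightarrow> nat \<Rightarrow> nat \<Rightarrow> real"
  assumes good: "\<And>i j. i < m \<Longrightarrow> j < m \<Longrightarrow>
      k < 2 * card {\<beta>\<in>{..<k}. \<bar>st \<beta> i j - ((D i)\<^sup>2 - (D j)\<^sup>2) / 2\<bar> \<le> \<tau> * E i j}"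
    and E: "\<And>i j. i < m \<Longrightarrow> j < m \<Longrightarrow> E i j \<le> D i + D j"
    and D: "\<And>i. D i \<ge> 0" and \<tau>: "\<tau> \<ge> 0" and i0: "i0 < m" "D i0 \<le> \<epsilon>"
  defines "acc \<equiv> \<lambda>i. \<forall>j<m. k < 2 * card {\<beta>\<in>{..<k}. st \<beta> i j \<le> (\<epsilon> + \<tau>)\<^sup>2 / 2}"
  shows "acc i0" and "\<And>i. i < m \<Longrightarrow> acc i \<Longrightarrow> D i \<le> 3 * (\<epsilon> + \<tau>)"
proof -
  have eps: "\<epsilon> \<ge> 0" using D[of i0] i0 by simp
  show "acc i0" unfolding acc_def
  proof (intro allI impI)
    fix j assume j: "j < m"
    have "{\<beta>\<in>{..<k}. \<bar>st \<beta> i0 j - ((D i0)\<^sup>2 - (D j)\<^sup>2) / 2\<bar> \<le> \<tau> * E i0 j}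
        \<subseteq> {\<beta>\<in>{..<k}. st \<beta> i0 j \<le> (\<epsilon> + \<tau>)\<^sup>2 / 2}"
    proof safe
      fix \<beta> assume *: "\<bar>st \<beta> i0 j - ((D i0)\<^sup>2 - (D j)\<^sup>2) / 2\<bar> \<le> \<tau> * E i0 j"
      have "\<tau> * E i0 j \<le> \<tau> * (\<epsilon> + D j)"
        using E[OF i0(1) j] i0 \<tau> by (intro mult_left_mono) auto
      moreover have "(D i0)\<^sup>2 \<le> \<epsilon>\<^sup>2" using i0 D by (intro power_mono) auto
      \<comment> \<open>This absorbs the term linear in D j into -(D j)^2/2. What remains is
        (\<epsilon>^2 + 2 \<tau> \<epsilon> + \<tau>^2)/2, which is the origin of the acceptance
        threshold (\<epsilon> + \<tau>)^2/2.\<close>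
      moreover have "2 * (\<tau> * D j) \<le> \<tau>\<^sup>2 + (D j)\<^sup>2" using sum_squares_bound[of \<tau> "D j"] by simp
      moreover have "(\<epsilon> + \<tau>)\<^sup>2 = \<epsilon>\<^sup>2 + 2 * (\<tau> * \<epsilon>) + \<tau>\<^sup>2" by (simp add: power2_sum)
      ultimately show "st \<beta> i0 j \<le> (\<epsilon> + \<tau>)\<^sup>2 / 2"
        using abs_le_D1[OF *] unfolding distrib_left by argo
    qed
    then have "card {\<beta>\<in>{..<k}. \<bar>st \<beta> i0 j - ((D i0)\<^sup>2 - (D j)\<^sup>2) / 2\<bar> \<le> \<tau> * E i0 j}
      \<le> card {\<beta>\<in>{..<k}. st \<beta> i0 j \<le> (\<epsilon> + \<tau>)\<^sup>2 / 2}"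
      by (intro card_mono) auto
    then show "k < 2 * card {\<beta>\<in>{..<k}. st \<beta> i0 j \<le> (\<epsilon> + \<tau>)\<^sup>2 / 2}"
      using good[OF i0(1) j] by simp
  qed
  fix i assume i: "i < m" "acc i"
  let ?A = "{\<beta>\<in>{..<k}. st \<beta> i i0 \<le> (\<epsilon> + \<tau>)\<^sup>2 / 2}"
  let ?G = "{\<beta>\<in>{..<k}. \<bar>st \<beta> i i0 - ((D i)\<^sup>2 - (D i0)\<^sup>2) / 2\<bar> \<le> \<tau> * E i i0}"
  have "k < 2 * card ?A" "k < 2 * card ?G" using i i0 good by (auto simp: acc_def)
  moreover have "card (?A \<union> ?G) \<le> k" using card_mono[of "{..<k}" "?A \<union> ?G"] by auto
  moreover have "card ?A + card ?G = card (?A \<union> ?G) + card (?A \<inter> ?G)" by (rule card_Un_Int) auto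
  ultimately have "card (?A \<inter> ?G) > 0" by simp
  then have "?A \<inter> ?G \<noteq> {}" using card_gt_0_iff by blast
  then obtain \<beta> where b: "st \<beta> i i0 \<le> (\<epsilon> + \<tau>)\<^sup>2 / 2"
    "\<bar>st \<beta> i i0 - ((D i)\<^sup>2 - (D i0)\<^sup>2) / 2\<bar> \<le> \<tau> * E i i0" by auto
  have "\<tau> * E i i0 \<le> \<tau> * (D i + \<epsilon>)" using E[OF i(1) i0(1)] i0 \<tau> by (intro mult_left_mono) auto
  moreover have "(D i0)\<^sup>2 \<le> \<epsilon>\<^sup>2" using i0 D by (intro power_mono) auto
  \<comment> \<open>Completing the square in D i: the terms \<epsilon>^2 + 2 \<tau> \<epsilon> +
    \<tau>^2 add up to one copy of (\<epsilon> + \<tau>)^2, the acceptance threshold gives the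
    second. Replacing sqrt 2 by 2 then yields the constant 3.\<close>
  ultimately have 1: "(D i - \<tau>)\<^sup>2 \<le> 2 * (\<epsilon> + \<tau>)\<^sup>2"
    using b zero_le_power2[of \<tau>] by (simp add: power2_eq_square algebra_simps abs_le_iff)
  have "(D i - \<tau>)\<^sup>2 \<le> (2 * (\<epsilon> + \<tau>))\<^sup>2"
    unfolding power_mult_distrib by (rule order_trans[OF 1 mult_right_mono]) simp_all
  then have "D i - \<tau> \<le> 2 * (\<epsilon> + \<tau>)"
    by (rule power2_le_imp_le) (use eps \<tau> in simp)
  then show "D i \<le> 3 * (\<epsilon> + \<tau>)" using eps by simp
qed

section \<open>Robust selection from a finite net\<close>

lemma (in prob_space) bounded_integrable:
  fixes u :: "'a \<Rightarrow> real"
  assumes "u \<in> borel_measurable M" "\<And>x. x \<in> space M \<Longrightarrow> \<bar>u x\<bar> \<le> C"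
  shows "integrable M u"
  using assms by (intro integrable_const_bound[where B=C]) auto

lemma abs_mult_le_bound: "\<bar>a\<bar> \<le> C \<Longrightarrow> \<bar>b\<bar> \<le> C \<Longrightarrow> \<bar>a * b\<bar> \<le> C * C" for a b C :: real
  unfolding abs_mult by (intro mult_mono) auto

lemma (in prob_space) L2_triangle:
  fixes u v :: "'a \<Rightarrow> real"
  assumes [measurable]: "u \<in> borel_measurable M" "v \<in> borel_measurable M"
    and u: "\<And>x. x \<in> space M \<Longrightarrow> \<bar>u x\<bar> \<le> C" and v: "\<And>x. x \<in> space M \<Longrightarrow> \<bar>v x\<bar> \<le> C"
  shows "sqrt (expectation (\<lambda>x. (u x + v x)\<^sup>2)) \<le> sqrt (expectation (\<lambda>x. (u x)\<^sup>2)) + sqrt (expectation (\<lambda>x. (v x)\<^sup>2))"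
proof -
  have C: "\<bar>u x * v x\<bar> \<le> C * C" "\<bar>(u x)\<^sup>2\<bar> \<le> C * C" "\<bar>(v x)\<^sup>2\<bar> \<le> C * C" if "x \<in> space M" for x
    unfolding power2_eq_square by (intro abs_mult_le_bound u v that)+
  have iu: "integrable M (\<lambda>x. (u x)\<^sup>2)" and iv: "integrable M (\<lambda>x. (v x)\<^sup>2)"
    and iuv: "integrable M (\<lambda>x. u x * v x)"
    using C by (auto intro!: bounded_integrable[where C="C*C"])
  define a b where "a = expectation (\<lambda>x. (u x)\<^sup>2)" and "b = expectation (\<lambda>x. (v x)\<^sup>2)"
  have ab: "a \<ge> 0" "b \<ge> 0" by (auto simp: a_def b_def intro!: integral_nonneg_AE)
  have "(\<integral>\<^sup>+x. ennreal \<bar>u x\<bar> * ennreal \<bar>v x\<bar> \<partial>M)\<^sup>2 \<le> (\<integral>\<^sup>+x. (ennreal \<bar>u x\<bar>)\<^sup>2 \<partial>M) * (\<integral>\<^sup>+x. (ennreal \<bar>v x\<bar>)\<^sup>2 \<partial>M)"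
    by (rule Cauchy_Schwarz_nn_integral) auto
  also have "(\<integral>\<^sup>+x. (ennreal \<bar>u x\<bar>)\<^sup>2 \<partial>M) = ennreal a"
    using iu by (simp add: a_def nn_integral_eq_integral ennreal_power)
  also have "(\<integral>\<^sup>+x. (ennreal \<bar>v x\<bar>)\<^sup>2 \<partial>M) = ennreal b"
    using iv by (simp add: b_def nn_integral_eq_integral ennreal_power)
  also have "(\<integral>\<^sup>+x. ennreal \<bar>u x\<bar> * ennreal \<bar>v x\<bar> \<partial>M) = ennreal (expectation (\<lambda>x. \<bar>u x * v x\<bar>))"
    using nn_integral_eq_integral[OF integrable_abs[OF iuv]]
    by (simp add: abs_mult flip: ennreal_mult)
  finally have "(expectation (\<lambda>x. \<bar>u x * v x\<bar>))\<^sup>2 \<le> a * b"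
    using ab by (simp add: ennreal_power flip: ennreal_mult)
  then have "expectation (\<lambda>x. \<bar>u x * v x\<bar>) \<le> sqrt a * sqrt b"
    by (simp add: real_le_rsqrt real_sqrt_mult[symmetric])
  moreover have "expectation (\<lambda>x. u x * v x) \<le> expectation (\<lambda>x. \<bar>u x * v x\<bar>)"
    using iuv by (intro integral_mono) auto
  ultimately have cs: "expectation (\<lambda>x. u x * v x) \<le> sqrt a * sqrt b" by simp
  have "expectation (\<lambda>x. (u x + v x)\<^sup>2) = expectation (\<lambda>x. (u x)\<^sup>2 + (v x)\<^sup>2 + 2 * (u x * v x))"
    by (simp add: power2_sum mult.assoc)
  also have "\<dots> = a + b + 2 * expectation (\<lambda>x. u x * v x)"
    using iu iv iuv by (simp add: a_def b_def)
  also have "\<dots> \<le> (sqrt a + sqrt b)\<^sup>2"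
    using cs ab by (simp add: power2_sum)
  finally show ?thesis
    unfolding a_def[symmetric] b_def[symmetric] using ab by (intro real_le_lsqrt) auto
qed

section \<open>Regression with an arbitrary known design law\<close>

locale regression_model =
  fixes D :: "(nat \<Rightarrow> real) measure" and \<mu> :: "real measure" and n :: nat
  assumes D: "prob_space D" and mu: "prob_space \<mu>" and sets_mu [measurable_cong]: "sets \<mu> = sets borel"
    and sq_noise: "integrable \<mu> (\<lambda>e. e\<^sup>2)" and mean_noise: "(\<integral>e. e \<partial>\<mu>) = 0"
    and n: "n \<ge> 1"
begin

definition P where "P = D \<Otimes>\<^sub>M \<mu>"
definition N where "N = (\<Pi>\<^sub>M i\<in>{1..n}. P)"
definition \<sigma>2 where "\<sigma>2 = (\<integral>e. e\<^sup>2 \<partial>\<mu>)"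

sublocale D: prob_space D by (rule D)
sublocale mu: prob_space \<mu> by (rule mu)
sublocale PD: pair_prob_space D \<mu> ..
sublocale P: prob_space P unfolding P_def by (rule PD.prob_space_axioms)
sublocale N: prob_space N unfolding N_def by (intro prob_space_PiM P.prob_space_axioms)

lemma sets_P [measurable_cong]: "sets P = sets (D \<Otimes>\<^sub>M borel)"
  unfolding P_def by (intro sets_pair_measure_cong sets_mu refl)

lemma sets_N [measurable_cong]: "sets N = sets (\<Pi>\<^sub>M i\<in>{1..n}. P)"
  by (simp add: N_def)

lemma space_P: "space P = space D \<times> UNIV"
  using sets_eq_imp_space_eq[OF sets_mu] by (simp add: P_def space_pair_measure)

lemma noise_integrable: "integrable \<mu> (\<lambda>e. e)"
  by (rule mu.square_integrable_imp_integrable) (auto intro: sq_noise)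

lemma integral_P_mult:
  assumes u: "integrable D u" and v: "integrable \<mu> v"
  shows "integrable P (\<lambda>z. u (fst z) * v (snd z))" (is ?int)
    and "(\<integral>z. u (fst z) * v (snd z) \<partial>P) = (\<integral>x. u x \<partial>D) * (\<integral>e. v e \<partial>\<mu> :: real)"
proof -
  have [measurable]: "u \<in> borel_measurable D" "v \<in> borel_measurable \<mu>"
    using u v by auto
  show i: ?int unfolding P_def
  proof (rule PD.Fubini_integrable)
    have "(\<lambda>x. \<integral>y. norm (u (fst (x, y)) * v (snd (x, y))) \<partial>\<mu>) = (\<lambda>x. \<bar>u x\<bar> * (\<integral>y. \<bar>v y\<bar> \<partial>\<mu>))"
      by (simp add: abs_mult)
    then show "integrable D (\<lambda>x. \<integral>y. norm (u (fst (x, y)) * v (snd (x, y))) \<partial>\<mu>)"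
      using u by simp
  qed (use v in auto)
  show "(\<integral>z. u (fst z) * v (snd z) \<partial>P) = (\<integral>x. u x \<partial>D) * (\<integral>e. v e \<partial>\<mu>)"
    using PD.integral_fst'[OF i[unfolded P_def]] by (simp add: P_def)
qed

lemma indep_coordinates: "N.indep_vars (\<lambda>_. P) (\<lambda>i \<omega>. \<omega> i) {1..n}"
proof (subst N.indep_vars_iff_distr_eq_PiM')
  have "distr N (\<Pi>\<^sub>M i\<in>{1..n}. P) (\<lambda>x. \<lambda>i\<in>{1..n}. x i) = distr N N (\<lambda>x. x)"
    by (rule distr_cong) (auto simp: N_def space_PiM PiE_def extensional_def)
  also have "\<dots> = N" by simp
  also have "\<dots> = (\<Pi>\<^sub>M i\<in>{1..n}. distr N P (\<lambda>\<omega>. \<omega> i))"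
    unfolding N_def
    by (intro PiM_cong refl sym[OF distr_PiM_component[of "{1..n}" "\<lambda>_. P"]]) (auto simp: P.prob_space_axioms)
  finally show "distr N (\<Pi>\<^sub>M i\<in>{1..n}. P) (\<lambda>x. \<lambda>i\<in>{1..n}. x i) = (\<Pi>\<^sub>M i\<in>{1..n}. distr N P (\<lambda>\<omega>. \<omega> i))" .
qed (use n in \<open>auto simp: N_def\<close>)

lemma integral_N_coordinate:
  fixes u :: "_ \<Rightarrow> real"
  assumes i: "i \<in> {1..n}" and u: "integrable P u"
  shows "integrable N (\<lambda>\<omega>. u (\<omega> i))" and "(\<integral>\<omega>. u (\<omega> i) \<partial>N) = (\<integral>z. u z \<partial>P)"
proof -
  have m: "(\<lambda>\<omega>. \<omega> i) \<in> measurable N P" using i by (auto simp: N_def)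
  have d: "distr N P (\<lambda>\<omega>. \<omega> i) = P"
    unfolding N_def using i by (intro distr_PiM_component P.prob_space_axioms)
  show "integrable N (\<lambda>\<omega>. u (\<omega> i))"
    using integrable_distr[OF m, of u] u d by simp
  show "(\<integral>\<omega>. u (\<omega> i) \<partial>N) = (\<integral>z. u z \<partial>P)"
    using integral_distr[OF m, of u] u d by simp
qed

lemma integral_N_two_coordinates:
  fixes u v :: "_ \<Rightarrow> real"
  assumes ij: "i \<in> {1..n}" "j \<in> {1..n}" "i \<noteq> j" and u: "integrable P u" and v: "integrable P v"
  shows "integrable N (\<lambda>\<omega>. u (\<omega> i) * v (\<omega> j))"
    and "(\<integral>\<omega>. u (\<omega> i) * v (\<omega> j) \<partial>N) = (\<integral>z. u z \<partial>P) * (\<integral>z. v z \<partial>P)"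
proof -
  \<comment> \<open>Independence is stated for one family indexed by the coordinates, so u and v are
    merged into such a family: u on coordinate i, v on all others.\<close>
  define X where "X = (\<lambda>l \<omega>. (if l = i then u else v) (\<omega> l))"
  have ind: "N.indep_vars (\<lambda>_. borel) X {1..n}"
    unfolding X_def by (rule N.indep_vars_compose2[OF indep_coordinates]) (use u v in auto)
  have X: "X i = (\<lambda>\<omega>. u (\<omega> i))" "X j = (\<lambda>\<omega>. v (\<omega> j))" using ij by (auto simp: X_def)
  show "integrable N (\<lambda>\<omega>. u (\<omega> i) * v (\<omega> j))"
    and "(\<integral>\<omega>. u (\<omega> i) * v (\<omega> j) \<partial>N) = (\<integral>z. u z \<partial>P) * (\<integral>z. v z \<partial>P)"
    using N.indep_vars_mult_integral[OF ind ij] integral_N_coordinate ij u v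
    unfolding X by auto
qed

end

text \<open>The oscillation of f is bounded instead of f itself, because functions of the class
  carry an arbitrary additive constant. \<open>f0\<close> is the centred function and
  \<open>r\<close> the response minus its mean; differences of responses equal differences of
  \<open>r\<close>.\<close>

locale regression_fun = regression_model +
  fixes f :: "(nat \<Rightarrow> real) \<Rightarrow> real" and A :: real
  assumes f [measurable]: "f \<in> borel_measurable D"
    and osc: "\<And>x x'. x \<in> space D \<Longrightarrow> x' \<in> space D \<Longrightarrow> \<bar>f x - f x'\<bar> \<le> A"
begin

definition Ef where "Ef = (\<integral>x. f x \<partial>D)"
definition f0 where "f0 = (\<lambda>x. f x - Ef)"
definition r where "r = (\<lambda>z. f0 (fst z) + snd z :: real)"

lemma f0_measurable [measurable]: "f0 \<in> borel_measurable D"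
  by (simp add: f0_def)

lemma r_measurable [measurable]: "r \<in> borel_measurable P"
  unfolding r_def by measurable

lemma f_integrable: "integrable D f"
proof -
  obtain x0 where x0: "x0 \<in> space D" using D.not_empty by blast
  show ?thesis
  proof (rule D.bounded_integrable[where C="\<bar>f x0\<bar> + A"])
    show "\<bar>f x\<bar> \<le> \<bar>f x0\<bar> + A" if "x \<in> space D" for x using osc[OF that x0] by linarith
  qed simp
qed

lemma A_nonneg: "A \<ge> 0"
  using osc D.not_empty by fastforce

lemma f0_bound: "\<bar>f0 x\<bar> \<le> A" if x: "x \<in> space D"
proof -
  have "f0 x = (\<integral>y. f x - f y \<partial>D)"
    using f_integrable by (simp add: f0_def Ef_def D.prob_space)
  also have "\<bar>\<dots>\<bar> \<le> (\<integral>y. \<bar>f x - f y\<bar> \<partial>D)" by (rule integral_abs_bound)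
  also have "\<dots> \<le> (\<integral>y. A \<partial>D)"
    using osc[OF x] f_integrable by (intro integral_mono) auto
  finally show ?thesis by (simp add: D.prob_space)
qed

lemma f0_mean: "(\<integral>x. f0 x \<partial>D) = 0" and f0_integrable: "integrable D f0"
  using f_integrable by (auto simp: f0_def Ef_def D.prob_space)

lemma response_mult:
  assumes h [measurable]: "h \<in> borel_measurable D" and hb: "\<And>x. x \<in> space D \<Longrightarrow> \<bar>h x\<bar> \<le> C"
  shows "integrable P (\<lambda>z. r z * h (fst z))"
    and "(\<integral>z. r z * h (fst z) \<partial>P) = (\<integral>x. f0 x * h x \<partial>D)"
proof -
  have ih: "integrable D h" by (rule D.bounded_integrable[OF h hb])
  have i1: "integrable D (\<lambda>x. f0 x * h x)"
  proof (rule D.bounded_integrable[where C="A * C"])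
    show "\<bar>f0 x * h x\<bar> \<le> A * C" if "x \<in> space D" for x
      using f0_bound[OF that] hb[OF that] A_nonneg by (simp add: abs_mult mult_mono)
  qed simp
  have eq: "r z * h (fst z) = f0 (fst z) * h (fst z) * 1 + h (fst z) * snd z" for z
    by (simp add: r_def algebra_simps)
  have one: "integrable \<mu> (\<lambda>e. 1::real)" by simp
  show "integrable P (\<lambda>z. r z * h (fst z))"
    unfolding eq by (intro Bochner_Integration.integrable_add integral_P_mult(1)[OF i1 one]
      integral_P_mult(1)[OF ih noise_integrable])
  show "(\<integral>z. r z * h (fst z) \<partial>P) = (\<integral>x. f0 x * h x \<partial>D)"
    unfolding eq using integral_P_mult[OF i1 one] integral_P_mult[OF ih noise_integrable]
    by (simp add: mean_noise mu.prob_space)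
qed

lemma response_sq_mult:
  assumes h [measurable]: "h \<in> borel_measurable D" and hb: "\<And>x. x \<in> space D \<Longrightarrow> \<bar>h x\<bar> \<le> C"
  shows "integrable P (\<lambda>z. (r z)\<^sup>2 * (h (fst z))\<^sup>2)"
    and "(\<integral>z. (r z)\<^sup>2 * (h (fst z))\<^sup>2 \<partial>P) \<le> 2 * (A\<^sup>2 + \<sigma>2) * (\<integral>x. (h x)\<^sup>2 \<partial>D)"
proof -
  have ih: "integrable D (\<lambda>x. (h x)\<^sup>2)"
  proof (rule D.bounded_integrable[where C="C * C"])
    show "\<bar>(h x)\<^sup>2\<bar> \<le> C * C" if "x \<in> space D" for x
      unfolding power2_eq_square by (intro abs_mult_le_bound hb that)
  qed simp
  have one: "integrable \<mu> (\<lambda>e. 1::real)" by simp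
  define U where "U = (\<lambda>z. 2 * A\<^sup>2 * ((h (fst z))\<^sup>2 * 1) + 2 * ((h (fst z))\<^sup>2 * (snd z :: real)\<^sup>2))"
  have iU: "integrable P U"
    unfolding U_def by (intro Bochner_Integration.integrable_add integrable_mult_right
      integral_P_mult(1)[OF ih one] integral_P_mult(1)[OF ih sq_noise])
  have EU: "(\<integral>z. U z \<partial>P) = 2 * (A\<^sup>2 + \<sigma>2) * (\<integral>x. (h x)\<^sup>2 \<partial>D)"
    unfolding U_def using integral_P_mult[OF ih one] integral_P_mult[OF ih sq_noise]
    by (simp add: \<sigma>2_def mu.prob_space algebra_simps)
  have le: "(r z)\<^sup>2 * (h (fst z))\<^sup>2 \<le> U z" if "z \<in> space P" for z
  proof -
    have "(f0 (fst z))\<^sup>2 \<le> A\<^sup>2"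
      using f0_bound[of "fst z"] that by (auto simp: space_P abs_le_square_iff[symmetric])
    moreover have "(r z)\<^sup>2 \<le> 2 * (f0 (fst z))\<^sup>2 + 2 * (snd z)\<^sup>2"
      using sum_squares_bound[of "f0 (fst z)" "snd z"] by (simp add: r_def power2_sum)
    ultimately have "(r z)\<^sup>2 \<le> 2 * A\<^sup>2 + 2 * (snd z)\<^sup>2" by linarith
    then have "(r z)\<^sup>2 * (h (fst z))\<^sup>2 \<le> (2 * A\<^sup>2 + 2 * (snd z)\<^sup>2) * (h (fst z))\<^sup>2"
      by (intro mult_right_mono) auto
    then show ?thesis by (simp add: U_def algebra_simps)
  qed
  show i: "integrable P (\<lambda>z. (r z)\<^sup>2 * (h (fst z))\<^sup>2)"
    using le by (intro Bochner_Integration.integrable_bound[OF iU]) (auto intro!: AE_I2 order_trans[OF le abs_ge_self])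
  show "(\<integral>z. (r z)\<^sup>2 * (h (fst z))\<^sup>2 \<partial>P) \<le> 2 * (A\<^sup>2 + \<sigma>2) * (\<integral>x. (h x)\<^sup>2 \<partial>D)"
    unfolding EU[symmetric] using i iU le by (rule integral_mono)
qed

lemma response_mean: "integrable P r" "(\<integral>z. r z \<partial>P) = 0"
  using response_mult[of "\<lambda>_. 1" 1] f0_mean by auto

lemma response_sq: "integrable P (\<lambda>z. (r z)\<^sup>2)" "(\<integral>z. (r z)\<^sup>2 \<partial>P) \<le> 2 * (A\<^sup>2 + \<sigma>2)"
  using response_sq_mult[of "\<lambda>_. 1" 1] by (auto simp: D.prob_space)

text \<open>Differencing the responses removes the unknown mean of \<open>f\<close>.\<close>

lemma differenced_response:
  assumes h [measurable]: "h \<in> borel_measurable D" and hb: "\<And>x. x \<in> space D \<Longrightarrow> \<bar>h x\<bar> \<le> C"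
    and ij: "i \<in> {1..n}" "j \<in> {1..n}" "i \<noteq> j"
  shows "(\<integral>\<omega>. (r (\<omega> j) - r (\<omega> i)) * h (fst (\<omega> j)) \<partial>N) = (\<integral>x. f0 x * h x \<partial>D)"
    and "integrable N (\<lambda>\<omega>. ((r (\<omega> j) - r (\<omega> i)) * h (fst (\<omega> j)))\<^sup>2)"
    and "(\<integral>\<omega>. ((r (\<omega> j) - r (\<omega> i)) * h (fst (\<omega> j)))\<^sup>2 \<partial>N) \<le> 8 * (A\<^sup>2 + \<sigma>2) * (\<integral>x. (h x)\<^sup>2 \<partial>D)"
proof -
  have one: "integrable \<mu> (\<lambda>e. 1::real)" by simp
  have ih: "integrable D h" by (rule D.bounded_integrable[OF h hb])
  have ih2: "integrable D (\<lambda>x. (h x)\<^sup>2)"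
  proof (rule D.bounded_integrable[where C="C * C"])
    show "\<bar>(h x)\<^sup>2\<bar> \<le> C * C" if "x \<in> space D" for x
      unfolding power2_eq_square by (intro abs_mult_le_bound hb that)
  qed simp
  have iPh: "integrable P (\<lambda>z. h (fst z))" and iPh2: "integrable P (\<lambda>z. (h (fst z))\<^sup>2)"
    and EPh2: "(\<integral>z. (h (fst z))\<^sup>2 \<partial>P) = (\<integral>x. (h x)\<^sup>2 \<partial>D)"
    using integral_P_mult[OF ih one] integral_P_mult[OF ih2 one] by (auto simp: mu.prob_space)
  note rj = integral_N_coordinate[OF ij(2) response_mult(1)[OF h hb]]
  note ri = integral_N_two_coordinates[OF ij response_mean(1) iPh]
  \<comment> \<open>The part with \<open>r (\<omega> i)\<close> factorizes by independence of the
    two observations and vanishes because \<open>r\<close> has mean zero.\<close>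
  show "(\<integral>\<omega>. (r (\<omega> j) - r (\<omega> i)) * h (fst (\<omega> j)) \<partial>N) = (\<integral>x. f0 x * h x \<partial>D)"
    unfolding left_diff_distrib using rj ri response_mult(2)[OF h hb] response_mean(2)
    by simp
  note sj = integral_N_coordinate[OF ij(2) response_sq_mult(1)[OF h hb]]
  note si = integral_N_two_coordinates[OF ij response_sq(1) iPh2]
  \<comment> \<open>Both halves of this majorant integrate to at most 4 * (A^2 + \<sigma>2) times
    the integral of h^2. In the second half r and h are taken at different observations, so the
    integral factorizes.\<close>
  define U where "U = (\<lambda>\<omega>. 2 * ((r (\<omega> j))\<^sup>2 * (h (fst (\<omega> j)))\<^sup>2) + 2 * ((r (\<omega> i))\<^sup>2 * (h (fst (\<omega> j)))\<^sup>2))"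
  have iU: "integrable N U" unfolding U_def using sj si by auto
  have "(\<integral>\<omega>. U \<omega> \<partial>N) = 2 * (\<integral>z. (r z)\<^sup>2 * (h (fst z))\<^sup>2 \<partial>P) + 2 * ((\<integral>z. (r z)\<^sup>2 \<partial>P) * (\<integral>x. (h x)\<^sup>2 \<partial>D))"
    unfolding U_def using sj si EPh2 by simp
  also have "\<dots> \<le> 2 * (2 * (A\<^sup>2 + \<sigma>2) * (\<integral>x. (h x)\<^sup>2 \<partial>D)) + 2 * (2 * (A\<^sup>2 + \<sigma>2) * (\<integral>x. (h x)\<^sup>2 \<partial>D))"
    using response_sq_mult(2)[OF h hb] response_sq(2)
    by (intro add_mono mult_left_mono mult_right_mono) (auto intro!: integral_nonneg_AE)
  finally have EU: "(\<integral>\<omega>. U \<omega> \<partial>N) \<le> 8 * (A\<^sup>2 + \<sigma>2) * (\<integral>x. (h x)\<^sup>2 \<partial>D)" by (simp add: algebra_simps)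
  have le: "((r (\<omega> j) - r (\<omega> i)) * h (fst (\<omega> j)))\<^sup>2 \<le> U \<omega>" for \<omega>
  proof -
    have "(r (\<omega> j) - r (\<omega> i))\<^sup>2 \<le> 2 * (r (\<omega> j))\<^sup>2 + 2 * (r (\<omega> i))\<^sup>2"
      using sum_squares_bound[of "r (\<omega> j)" "- r (\<omega> i)"] by (simp add: power2_diff)
    then have "(r (\<omega> j) - r (\<omega> i))\<^sup>2 * (h (fst (\<omega> j)))\<^sup>2 \<le> (2 * (r (\<omega> j))\<^sup>2 + 2 * (r (\<omega> i))\<^sup>2) * (h (fst (\<omega> j)))\<^sup>2"
      by (intro mult_right_mono) auto
    then show ?thesis unfolding U_def power_mult_distrib by (simp add: distrib_right mult.assoc)
  qed
  have meas: "(\<lambda>\<omega>. ((r (\<omega> j) - r (\<omega> i)) * h (fst (\<omega> j)))\<^sup>2) \<in> borel_measurable N"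
    using ij(1,2) by measurable
  show i: "integrable N (\<lambda>\<omega>. ((r (\<omega> j) - r (\<omega> i)) * h (fst (\<omega> j)))\<^sup>2)"
  proof (rule Bochner_Integration.integrable_bound[OF iU meas], rule AE_I2)
    fix \<omega>
    have "norm (((r (\<omega> j) - r (\<omega> i)) * h (fst (\<omega> j)))\<^sup>2) \<le> U \<omega>" using le[of \<omega>] by simp
    also have "\<dots> \<le> norm (U \<omega>)" by simp
    finally show "norm (((r (\<omega> j) - r (\<omega> i)) * h (fst (\<omega> j)))\<^sup>2) \<le> norm (U \<omega>)" .
  qed
  have "(\<integral>\<omega>. ((r (\<omega> j) - r (\<omega> i)) * h (fst (\<omega> j)))\<^sup>2 \<partial>N) \<le> (\<integral>\<omega>. U \<omega> \<partial>N)"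
    using i iU le by (intro integral_mono) auto
  then show "(\<integral>\<omega>. ((r (\<omega> j) - r (\<omega> i)) * h (fst (\<omega> j)))\<^sup>2 \<partial>N) \<le> 8 * (A\<^sup>2 + \<sigma>2) * (\<integral>x. (h x)\<^sup>2 \<partial>D)"
    using EU by simp
qed

lemma mean_response_deviation:
  shows "integrable N (\<lambda>\<omega>. ((\<Sum>i\<in>{1..n}. r (\<omega> i)) / real n)\<^sup>2)"
    and "(\<integral>\<omega>. ((\<Sum>i\<in>{1..n}. r (\<omega> i)) / real n)\<^sup>2 \<partial>N) \<le> 2 * (A\<^sup>2 + \<sigma>2) / real n"
proof -
  have ind: "N.indep_vars (\<lambda>_. borel) (\<lambda>i \<omega>. r (\<omega> i)) {1..n}"
    by (rule N.indep_vars_compose2[OF indep_coordinates]) auto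
  have "finite {1..n}" "{1..n} \<noteq> {}" using n by auto
  from N.indep_mean_sq_deviation[OF this ind, of 0 "2 * (A\<^sup>2 + \<sigma>2)"]
  show "integrable N (\<lambda>\<omega>. ((\<Sum>i\<in>{1..n}. r (\<omega> i)) / real n)\<^sup>2)"
    and "(\<integral>\<omega>. ((\<Sum>i\<in>{1..n}. r (\<omega> i)) / real n)\<^sup>2 \<partial>N) \<le> 2 * (A\<^sup>2 + \<sigma>2) / real n"
    using integral_N_coordinate[OF _ response_sq(1)] integral_N_coordinate[OF _ response_mean(1)]
      response_sq(2) response_mean(2) by auto
qed

text \<open>The observations 2p+1 and 2p+2 form disjoint pairs, so the products \<open>W p\<close>
  are independent. Their second moment is at most 8 * (A^2 + \<sigma>2) times that of h, and the
  median of means asks for a factor 64 more: hence 512 = 64 * 8.\<close>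

lemma block_deviation:
  assumes h [measurable]: "h \<in> borel_measurable D" and hb: "\<And>x. x \<in> space D \<Longrightarrow> \<bar>h x\<bar> \<le> C"
    and b: "b > 0" "2 * (k * b) \<le> n" and \<tau>: "\<tau> \<ge> 0" "512 * (A\<^sup>2 + \<sigma>2) \<le> real b * \<tau>\<^sup>2"
  defines "W \<equiv> \<lambda>p \<omega>. (r (\<omega> (2*p+2)) - r (\<omega> (2*p+1))) * h (fst (\<omega> (2*p+2)))"
  defines "bad \<equiv> \<lambda>\<beta> \<omega>. \<tau> * sqrt (\<integral>x. (h x)\<^sup>2 \<partial>D) < \<bar>(\<Sum>p\<in>{\<beta>*b..<\<beta>*b+b}. W p \<omega>) / real b - (\<integral>x. f0 x * h x \<partial>D)\<bar>"
  shows "{\<omega>\<in>space N. k \<le> 2 * card {\<beta>\<in>{..<k}. bad \<beta> \<omega>}} \<in> sets N"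
    and "measure N {\<omega>\<in>space N. k \<le> 2 * card {\<beta>\<in>{..<k}. bad \<beta> \<omega>}} \<le> 1 / 4 ^ k"
proof -
  have in_n: "2*p+1 \<in> {1..n}" "2*p+2 \<in> {1..n}" "2*p+1 \<noteq> 2*p+2" if "p < k*b" for p
    using that b by auto
  have ind: "N.indep_vars (\<lambda>_. borel) W {..<k*b}"
  proof -
    define K where "K = (\<lambda>p::nat. {2*p+1, 2*p+2})"
    have "N.indep_vars (\<lambda>p. PiM (K p) (\<lambda>_. P)) (\<lambda>p \<omega>. restrict (\<lambda>i. \<omega> i) (K p)) {..<k*b}"
    proof (rule N.indep_vars_restrict[OF indep_coordinates])
      show "disjoint_family_on K {..<k*b}"
        unfolding disjoint_family_on_def K_def by (auto; presburger)
    qed (use in_n in \<open>auto simp: K_def\<close>)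
    then have "N.indep_vars (\<lambda>_. borel) (\<lambda>p \<omega>. (\<lambda>p x. (r (x (2*p+2)) - r (x (2*p+1))) * h (fst (x (2*p+2)))) p (restrict (\<lambda>i. \<omega> i) (K p))) {..<k*b}"
    proof (rule N.indep_vars_compose2)
      fix p assume "p \<in> {..<k*b}"
      have c: "(\<lambda>x. x (2*p+2)) \<in> measurable (PiM (K p) (\<lambda>_. P)) P"
        "(\<lambda>x. x (2*p+1)) \<in> measurable (PiM (K p) (\<lambda>_. P)) P"
        by (auto simp: K_def)
      have hf: "(\<lambda>z. h (fst z)) \<in> borel_measurable P" by measurable
      show "(\<lambda>x. (r (x (2*p+2)) - r (x (2*p+1))) * h (fst (x (2*p+2)))) \<in> borel_measurable (PiM (K p) (\<lambda>_. P))"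
        by (intro borel_measurable_times borel_measurable_diff
          measurable_compose[OF c(1) r_measurable] measurable_compose[OF c(2) r_measurable]
          measurable_compose[OF c(1) hf])
    qed
    then show ?thesis by (simp add: W_def K_def)
  qed
  have h2: "0 \<le> (\<integral>x. (h x)\<^sup>2 \<partial>D)" by (intro integral_nonneg_AE) auto
  have t: "64 * (8 * (A\<^sup>2 + \<sigma>2) * (\<integral>x. (h x)\<^sup>2 \<partial>D)) \<le> real b * (\<tau> * sqrt (\<integral>x. (h x)\<^sup>2 \<partial>D))\<^sup>2"
    using mult_right_mono[OF \<tau>(2) h2] h2 by (simp add: power_mult_distrib algebra_simps)
  have t0: "\<tau> * sqrt (\<integral>x. (h x)\<^sup>2 \<partial>D) \<ge> 0" using \<tau> h2 by simp
  have W: "integrable N (\<lambda>\<omega>. (W p \<omega>)\<^sup>2)" "(\<integral>\<omega>. W p \<omega> \<partial>N) = (\<integral>x. f0 x * h x \<partial>D)"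
    "(\<integral>\<omega>. (W p \<omega>)\<^sup>2 \<partial>N) \<le> 8 * (A\<^sup>2 + \<sigma>2) * (\<integral>x. (h x)\<^sup>2 \<partial>D)" if "p < k*b" for p
    unfolding W_def
    by (rule differenced_response(2)[OF h hb in_n[OF that]] differenced_response(1)[OF h hb in_n[OF that]]
      differenced_response(3)[OF h hb in_n[OF that]]; assumption)+
  note mom = N.median_of_means_deviation[OF ind b(1) W t t0]
  show "{\<omega>\<in>space N. k \<le> 2 * card {\<beta>\<in>{..<k}. bad \<beta> \<omega>}} \<in> sets N"
    unfolding bad_def by (rule mom(1))
  show "measure N {\<omega>\<in>space N. k \<le> 2 * card {\<beta>\<in>{..<k}. bad \<beta> \<omega>}} \<le> 1 / 4 ^ k"
    unfolding bad_def by (rule mom(2))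
qed

end

text \<open>Used for the measurability of the selection: the number of blocks is a finite sum of
  indicators of measurable events.\<close>

lemma pred_majority:
  assumes "\<And>\<beta>. \<beta> < k \<Longrightarrow> Measurable.pred M (P \<beta>)"
  shows "Measurable.pred M (\<lambda>z. k < 2 * card {\<beta>\<in>{..<k::nat}. P \<beta> z})"
proof -
  have "real (card {\<beta>\<in>{..<k}. P \<beta> z}) = (\<Sum>\<beta><k. if P \<beta> z then 1 else 0)" for z
    by (subst sum.If_cases) (auto simp: Int_def)
  then have "k < 2 * card {\<beta>\<in>{..<k}. P \<beta> z} \<longleftrightarrow> real k < 2 * (\<Sum>\<beta><k. if P \<beta> z then 1 else 0)" for z
    by (metis of_nat_less_iff of_nat_mult of_nat_numeral)
  moreover have "Measurable.pred M (\<lambda>z. real k < 2 * (\<Sum>\<beta><k. if P \<beta> z then 1 else 0))"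
    using assms by (intro borel_measurable_pred_less borel_measurable_const borel_measurable_times
      borel_measurable_sum measurable_If) (auto simp: pred_def)
  ultimately show ?thesis by simp
qed

section \<open>Risk of the selected net function\<close>

context regression_fun
begin

text \<open>For a fixed data set the error is \<open>g i - f0\<close> plus a constant, the deviation
  of the mean response. Since \<open>g i - f0\<close> has mean zero under D, the cross term vanishes
  and the loss is exactly a sum of two squares. No independence between the selected index and the
  mean response is needed, although both use the same data.\<close>

lemma selection_risk:
  fixes g :: "nat \<Rightarrow> (nat \<Rightarrow> real) \<Rightarrow> real" and sel :: "(nat \<Rightarrow> (nat \<Rightarrow> real) \<times> real) \<Rightarrow> nat"
  assumes g [measurable]: "\<And>i. g i \<in> borel_measurable D" and gb: "\<And>i x. x \<in> space D \<Longrightarrow> \<bar>g i x\<bar> \<le> A"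
    and g0: "\<And>i. (\<integral>x. g i x \<partial>D) = 0"
    and B: "B \<in> sets N" and p: "measure N B \<le> p" and c: "c \<ge> 0"
    and le: "\<And>\<omega>. \<omega> \<in> space N \<Longrightarrow>
      (\<integral>x. (g (sel (data n f \<omega>)) x - f0 x)\<^sup>2 \<partial>D) \<le> c + 4 * A\<^sup>2 * indicator B \<omega>"
  defines "T \<equiv> \<lambda>z x. g (sel z) x + (\<Sum>i\<in>{1..n}. snd (z i)) / real n"
  shows "(\<integral>\<^sup>+\<omega>. (\<integral>\<^sup>+x. ennreal ((T (data n f \<omega>) x - f x)\<^sup>2) \<partial>D) \<partial>N)
    \<le> ennreal (c + 4 * A\<^sup>2 * p + 2 * (A\<^sup>2 + \<sigma>2) / real n)"
proof -
  define y where "y = (\<lambda>\<omega>. (\<Sum>i\<in>{1..n}. r (\<omega> i)) / real n)"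
  have mean: "(\<Sum>i\<in>{1..n}. snd (data n f \<omega> i)) / real n = y \<omega> + Ef" for \<omega>
    using n by (simp add: data_def y_def r_def f0_def sum.distrib sum_subtractf field_simps)
  have inner: "(\<integral>\<^sup>+x. ennreal ((T (data n f \<omega>) x - f x)\<^sup>2) \<partial>D)
      = ennreal ((\<integral>x. (g (sel (data n f \<omega>)) x - f0 x)\<^sup>2 \<partial>D) + (y \<omega>)\<^sup>2)" for \<omega>
  proof -
    define h where "h = (\<lambda>x. g (sel (data n f \<omega>)) x - f0 x)"
    have hm[measurable]: "h \<in> borel_measurable D" by (simp add: h_def)
    have hb: "\<bar>h x\<bar> \<le> 2 * A" if "x \<in> space D" for x
      using gb[OF that, of "sel (data n f \<omega>)"] f0_bound[OF that] by (simp add: h_def)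
    have ig: "integrable D (g i)" for i by (rule D.bounded_integrable[OF g gb])
    have h0: "(\<integral>x. h x \<partial>D) = 0" and ih: "integrable D h"
      using ig g0 f0_mean f0_integrable by (auto simp: h_def)
    have ih2: "integrable D (\<lambda>x. (h x)\<^sup>2)"
      unfolding power2_eq_square
      by (intro D.bounded_integrable[where C="(2*A)*(2*A)"] abs_mult_le_bound hb) auto
    have eq: "(T (data n f \<omega>) x - f x)\<^sup>2 = (h x)\<^sup>2 + 2 * y \<omega> * h x + (y \<omega>)\<^sup>2" for x
    proof -
      have "T (data n f \<omega>) x - f x = h x + y \<omega>"
        unfolding T_def mean by (simp add: h_def f0_def)
      then show ?thesis by (simp add: power2_sum mult.commute)
    qed
    have i: "integrable D (\<lambda>x. (h x)\<^sup>2 + 2 * y \<omega> * h x + (y \<omega>)\<^sup>2)"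
      using ih ih2 by simp
    have "(\<integral>\<^sup>+x. ennreal ((T (data n f \<omega>) x - f x)\<^sup>2) \<partial>D) = ennreal (\<integral>x. (T (data n f \<omega>) x - f x)\<^sup>2 \<partial>D)"
      using i unfolding eq[symmetric] by (intro nn_integral_eq_integral) auto
    also have "(\<integral>x. (T (data n f \<omega>) x - f x)\<^sup>2 \<partial>D) = (\<integral>x. (h x)\<^sup>2 \<partial>D) + (y \<omega>)\<^sup>2"
      unfolding eq using ih ih2 h0 by (simp add: D.prob_space)
    finally show ?thesis by (simp add: h_def)
  qed
  have iy: "integrable N (\<lambda>\<omega>. (y \<omega>)\<^sup>2)" and Ey: "(\<integral>\<omega>. (y \<omega>)\<^sup>2 \<partial>N) \<le> 2 * (A\<^sup>2 + \<sigma>2) / real n"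
    using mean_response_deviation by (auto simp: y_def)
  have iB: "integrable N (indicator B :: _ \<Rightarrow> real)" using B by (simp add: less_top[symmetric])
  define U where "U = (\<lambda>\<omega>. c + 4 * A\<^sup>2 * indicator B \<omega> + (y \<omega>)\<^sup>2)"
  have "(\<integral>\<^sup>+\<omega>. (\<integral>\<^sup>+x. ennreal ((T (data n f \<omega>) x - f x)\<^sup>2) \<partial>D) \<partial>N) \<le> (\<integral>\<^sup>+\<omega>. ennreal (U \<omega>) \<partial>N)"
    unfolding inner U_def using le by (intro nn_integral_mono ennreal_leI) auto
  also have "\<dots> = ennreal (\<integral>\<omega>. U \<omega> \<partial>N)"
    using iy iB c unfolding U_def by (intro nn_integral_eq_integral) auto
  also have "(\<integral>\<omega>. U \<omega> \<partial>N) = c + 4 * A\<^sup>2 * measure N B + (\<integral>\<omega>. (y \<omega>)\<^sup>2 \<partial>N)"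
    using iy iB B sets.sets_into_space[OF B] unfolding U_def by (simp add: N.prob_space Int_absorb2)
  also have "ennreal \<dots> \<le> ennreal (c + 4 * A\<^sup>2 * p + 2 * (A\<^sup>2 + \<sigma>2) / real n)"
    using p Ey by (intro ennreal_leI add_mono mult_left_mono) auto
  finally show ?thesis .
qed

end

text \<open>The condition on k is the union bound: m^2 pairs, each failing with probability at most
  4^(-k), fail altogether with probability at most 1/n. On failure the squared error is at most 4
  A^2, which costs another A^2/n. The estimator is built from D, the net, \<epsilon> and the moment
  \<sigma>2 before f is introduced, as the order of quantifiers demands.\<close>

lemma (in regression_model) finite_net_estimator:
  fixes g :: "nat \<Rightarrow> (nat \<Rightarrow> real) \<Rightarrow> real"
  assumes m: "m > 0" and g [measurable]: "\<And>i. g i \<in> borel_measurable D"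
    and gb: "\<And>i x. x \<in> space D \<Longrightarrow> \<bar>g i x\<bar> \<le> A" and g0: "\<And>i. (\<integral>x. g i x \<partial>D) = 0"
    and \<epsilon>: "\<epsilon> \<ge> 0" and k: "k \<ge> 1" and mk: "(real m)\<^sup>2 * real n \<le> 4 ^ k"
  shows "\<exists>T. case_prod T \<in> borel_measurable ((\<Pi>\<^sub>M i\<in>{1..n}. D \<Otimes>\<^sub>M borel) \<Otimes>\<^sub>M D) \<and>
    (\<forall>f\<in>borel_measurable D. (\<forall>x\<in>space D. \<forall>x'\<in>space D. \<bar>f x - f x'\<bar> \<le> A) \<longrightarrow>
      (\<exists>i<m. (\<integral>x. (f x - (\<integral>x. f x \<partial>D) - g i x)\<^sup>2 \<partial>D) \<le> \<epsilon>\<^sup>2) \<longrightarrow>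
      (\<integral>\<^sup>+\<omega>. (\<integral>\<^sup>+x. ennreal ((T (data n f \<omega>) x - f x)\<^sup>2) \<partial>D) \<partial>N)
        \<le> ennreal (18 * \<epsilon>\<^sup>2 + 40000 * (A\<^sup>2 + \<sigma>2) * real k / real n))"
proof -
  have s2: "\<sigma>2 \<ge> 0" by (auto simp: \<sigma>2_def intro!: integral_nonneg_AE)
  have A2: "A\<^sup>2 + \<sigma>2 \<ge> 0" using s2 by simp
  let ?Z = "\<Pi>\<^sub>M i\<in>{1..n}. D \<Otimes>\<^sub>M (borel :: real measure)"
  have reg: "regression_fun D \<mu> n f A" if "f \<in> borel_measurable D"
    "\<forall>x\<in>space D. \<forall>x'\<in>space D. \<bar>f x - f x'\<bar> \<le> A" for f
    using that by unfold_locales auto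
  have ymeas: "(\<lambda>z. (\<Sum>i\<in>{1..n}. snd (z i)) / real n) \<in> borel_measurable ?Z"
  proof (intro borel_measurable_divide borel_measurable_sum borel_measurable_const)
    fix i assume "i \<in> {1..n}"
    then have "(\<lambda>z. z i) \<in> measurable ?Z (D \<Otimes>\<^sub>M borel)" by (rule measurable_component_singleton)
    then show "(\<lambda>z. snd (z i)) \<in> borel_measurable ?Z" by (rule measurable_compose[OF _ measurable_snd])
  qed
  have Tmeas: "case_prod (\<lambda>z x. g (sel z) x + (\<Sum>i\<in>{1..n}. snd (z i)) / real n) \<in> borel_measurable (?Z \<Otimes>\<^sub>M D)"
    if sel: "sel \<in> measurable ?Z (count_space UNIV)" for sel
  proof -
    have "(\<lambda>w. g (sel (fst w)) (snd w)) \<in> borel_measurable (?Z \<Otimes>\<^sub>M D)"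
    proof (rule measurable_compose_countable[where f="\<lambda>i w. g i (snd w)" and g="\<lambda>w. sel (fst w)"])
      show "(\<lambda>w. sel (fst w)) \<in> measurable (?Z \<Otimes>\<^sub>M D) (count_space UNIV)"
        by (rule measurable_compose[OF measurable_fst sel])
    qed measurable
    moreover have "(\<lambda>w. (\<Sum>i\<in>{1..n}. snd (fst w i)) / real n) \<in> borel_measurable (?Z \<Otimes>\<^sub>M D)"
      by (rule measurable_compose[OF measurable_fst ymeas])
    ultimately show ?thesis by (simp add: case_prod_beta)
  qed
  have k1: "real k \<ge> 1" and n1: "real n \<ge> 1" using k n by auto
  show ?thesis
  \<comment> \<open>If there are fewer than k pairs of observations, blocks cannot be formed. Then
    k/n exceeds 1/2 and the claimed bound already covers the trivial error 4 A^2, so always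
    selecting \<open>g 0\<close> suffices.\<close>
  proof (cases "2 * k > n")
    case True
    define T where "T = (\<lambda>z x. g ((\<lambda>_. 0) z) x + (\<Sum>i\<in>{1..n}. snd (z i :: (nat \<Rightarrow> real) \<times> real)) / real n)"
    have "(\<integral>\<^sup>+\<omega>. (\<integral>\<^sup>+x. ennreal ((T (data n f \<omega>) x - f x)\<^sup>2) \<partial>D) \<partial>N)
        \<le> ennreal (18 * \<epsilon>\<^sup>2 + 40000 * (A\<^sup>2 + \<sigma>2) * real k / real n)"
      if f: "f \<in> borel_measurable D" "\<forall>x\<in>space D. \<forall>x'\<in>space D. \<bar>f x - f x'\<bar> \<le> A" for f
    proof -
      interpret regression_fun D \<mu> n f A by (rule reg[OF f])
      have "(\<integral>x. (g 0 x - f0 x)\<^sup>2 \<partial>D) \<le> 4 * A\<^sup>2"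
      proof -
        have b: "(g 0 x - f0 x)\<^sup>2 \<le> 4 * A\<^sup>2" if "x \<in> space D" for x
        proof -
          have "\<bar>g 0 x - f0 x\<bar> \<le> 2 * A" using gb[OF that, of 0] f0_bound[OF that] by linarith
          then have "(g 0 x - f0 x)\<^sup>2 \<le> (2 * A)\<^sup>2" by (intro power2_le_iff_abs_le[THEN iffD2]) auto
          then show ?thesis by (simp add: power_mult_distrib)
        qed
        have "(\<integral>x. (g 0 x - f0 x)\<^sup>2 \<partial>D) \<le> (\<integral>x. 4 * A\<^sup>2 \<partial>D)"
          using b by (intro integral_mono D.bounded_integrable[where C="4*A\<^sup>2"]) auto
        then show ?thesis by (simp add: D.prob_space)
      qed
      then have "(\<integral>\<^sup>+\<omega>. (\<integral>\<^sup>+x. ennreal ((T (data n f \<omega>) x - f x)\<^sup>2) \<partial>D) \<partial>N)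
        \<le> ennreal (0 + 4 * A\<^sup>2 * 1 + 2 * (A\<^sup>2 + \<sigma>2) / real n)"
        unfolding T_def by (intro selection_risk[where B="space N"] g gb g0) (auto simp: N.prob_space)
      also have "\<dots> \<le> ennreal (18 * \<epsilon>\<^sup>2 + 40000 * (A\<^sup>2 + \<sigma>2) * real k / real n)"
      proof (rule ennreal_leI)
        have "4 * A\<^sup>2 * real n \<le> 4 * (A\<^sup>2 + \<sigma>2) * (2 * real k)"
          using True s2 by (intro mult_mono) auto
        moreover have "2 * (A\<^sup>2 + \<sigma>2) * 1 \<le> 2 * (A\<^sup>2 + \<sigma>2) * real k"
          using k1 A2 by (intro mult_left_mono) auto
        moreover have "0 \<le> (A\<^sup>2 + \<sigma>2) * real k" using A2 by simp
        ultimately have "4 * A\<^sup>2 * real n + 2 * (A\<^sup>2 + \<sigma>2) \<le> 40000 * (A\<^sup>2 + \<sigma>2) * real k"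
          by linarith
        then have "(4 * A\<^sup>2 * real n + 2 * (A\<^sup>2 + \<sigma>2)) / real n \<le> 40000 * (A\<^sup>2 + \<sigma>2) * real k / real n"
          by (rule divide_right_mono) simp
        moreover have "(4 * A\<^sup>2 * real n + 2 * (A\<^sup>2 + \<sigma>2)) / real n = 4 * A\<^sup>2 + 2 * (A\<^sup>2 + \<sigma>2) / real n"
          using n1 by (simp add: add_divide_distrib)
        ultimately have "4 * A\<^sup>2 + 2 * (A\<^sup>2 + \<sigma>2) / real n \<le> 40000 * (A\<^sup>2 + \<sigma>2) * real k / real n"
          by simp
        then show "0 + 4 * A\<^sup>2 * 1 + 2 * (A\<^sup>2 + \<sigma>2) / real n \<le> 18 * \<epsilon>\<^sup>2 + 40000 * (A\<^sup>2 + \<sigma>2) * real k / real n"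
          using zero_le_power2[of \<epsilon>] by linarith
      qed
      finally show ?thesis .
    qed
    moreover have "case_prod T \<in> borel_measurable (?Z \<Otimes>\<^sub>M D)"
      unfolding T_def by (rule Tmeas) simp
    ultimately show ?thesis by blast
  next
    case False
    define b where "b = n div (2 * k)"
    have b0: "b > 0" using False k by (simp add: b_def div_greater_zero_iff)
    have kb: "2 * (k * b) \<le> n" unfolding b_def by (metis div_times_less_eq_dividend mult.assoc mult.commute)
    \<comment> \<open>Rounding down to the block length b loses at most a factor 2, since b is at
      least 1.\<close>
    have nb: "real n \<le> 4 * real k * real b"
    proof -
      have "n < 2 * k * (b + 1)" unfolding b_def using k dividend_less_div_times[of "2*k" n] by (simp add: algebra_simps)
      also have "\<dots> \<le> 2 * k * (2 * b)" using b0 by (intro mult_left_mono) auto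
      finally have "n \<le> 4 * k * b" by simp
      then show ?thesis by (metis of_nat_le_iff of_nat_mult of_nat_numeral)
    qed
    define \<tau> where "\<tau> = sqrt (512 * (A\<^sup>2 + \<sigma>2) / real b)"
    have \<tau>0: "\<tau> \<ge> 0" and \<tau>sq: "\<tau>\<^sup>2 = 512 * (A\<^sup>2 + \<sigma>2) / real b" using A2 by (auto simp: \<tau>_def)
    have \<tau>b: "512 * (A\<^sup>2 + \<sigma>2) \<le> real b * \<tau>\<^sup>2" using b0 by (simp add: \<tau>sq)
    define q where "q = (\<lambda>i. \<integral>x. (g i x)\<^sup>2 \<partial>D)"
    \<comment> \<open>An estimate, from block \<beta>, of half the difference between the squared
      distances of g i and g j to f0. Only the inner product of f0 with g j - g i is estimated; the
      norms \<open>q\<close> are known because D is.\<close>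
    define st where "st = (\<lambda>\<beta> i j (z :: nat \<Rightarrow> (nat \<Rightarrow> real) \<times> real).
      (\<Sum>p\<in>{\<beta>*b..<\<beta>*b+b}. (snd (z (2*p+2)) - snd (z (2*p+1))) * (g j (fst (z (2*p+2))) - g i (fst (z (2*p+2))))) / real b - (q j - q i) / 2)"
    define acc where "acc = (\<lambda>i z. \<forall>j<m. k < 2 * card {\<beta>\<in>{..<k}. st \<beta> i j z \<le> (\<epsilon> + \<tau>)\<^sup>2 / 2})"
    \<comment> \<open>The disjunct \<open>i = m - 1\<close> is a default that makes the least
      element exist for all data. It does not spoil the selection: if some index is accepted and the
      least one is \<open>m - 1\<close>, then \<open>m - 1\<close> is that accepted index.\<close>
    define sel where "sel = (\<lambda>z. LEAST i. (i < m \<and> acc i z) \<or> i = m - 1)"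
    define T where "T = (\<lambda>z x. g (sel z) x + (\<Sum>i\<in>{1..n}. snd (z i)) / real n)"
    have pin: "2*p+1 \<in> {1..n}" "2*p+2 \<in> {1..n}" if "\<beta> < k" "p \<in> {\<beta>*b..<\<beta>*b+b}" for p \<beta>
    proof -
      have "(\<beta> + 1) * b \<le> k * b" using that by (intro mult_right_mono) auto
      then have "p < k * b" using that by auto
      then show "2*p+1 \<in> {1..n}" "2*p+2 \<in> {1..n}" using kb by auto
    qed
    have stm: "st \<beta> i j \<in> borel_measurable ?Z" if "\<beta> < k" for \<beta> i j
    proof -
      have c: "(\<lambda>z. z l) \<in> measurable ?Z (D \<Otimes>\<^sub>M borel)" if "l \<in> {1..n}" for l
        using that by (rule measurable_component_singleton)
      have gm: "(\<lambda>w. g i (fst w)) \<in> borel_measurable (D \<Otimes>\<^sub>M (borel :: real measure))" for i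
        by measurable
      show ?thesis unfolding st_def
        by (intro borel_measurable_diff borel_measurable_divide borel_measurable_sum borel_measurable_times
          borel_measurable_const measurable_compose[OF c measurable_snd] measurable_compose[OF c gm] pin[OF that])
    qed
    have accm: "Measurable.pred ?Z (acc i)" for i
    proof -
      have "Measurable.pred ?Z (\<lambda>z. st \<beta> i j z \<le> (\<epsilon> + \<tau>)\<^sup>2 / 2)" if "\<beta> < k" for \<beta> i j
        unfolding pred_def by (rule borel_measurable_le[OF stm[OF that] borel_measurable_const])
      then have "Measurable.pred ?Z (\<lambda>z. k < 2 * card {\<beta>\<in>{..<k}. st \<beta> i j z \<le> (\<epsilon> + \<tau>)\<^sup>2 / 2})" for i j
        by (rule pred_majority)
      then have "Measurable.pred ?Z (\<lambda>z. \<forall>j\<in>{..<m}. k < 2 * card {\<beta>\<in>{..<k}. st \<beta> i j z \<le> (\<epsilon> + \<tau>)\<^sup>2 / 2})"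
        by (rule pred_intros_finite(3)[OF finite_lessThan])
      then show ?thesis by (simp only: acc_def lessThan_iff Ball_def)
    qed
    have selm: "sel \<in> measurable ?Z (count_space UNIV)"
      unfolding sel_def
    proof (rule measurable_Least)
      fix i
      have "Measurable.pred ?Z (\<lambda>z. i < m)" "Measurable.pred ?Z (\<lambda>z. i = m - 1)" by simp_all
      then show "Measurable.pred ?Z (\<lambda>z. i < m \<and> acc i z \<or> i = m - 1)"
        by (intro pred_intros_logic(5) pred_intros_logic(3) accm)
    qed
    have sel: "sel z < m \<and> acc (sel z) z" if "i < m" "acc i z" for i z
    proof -
      let ?Q = "\<lambda>i. (i < m \<and> acc i z) \<or> i = m - 1"
      have "?Q (sel z)" unfolding sel_def by (rule LeastI[where k=i]) (use that in auto)
      moreover have le_i: "sel z \<le> i" unfolding sel_def by (rule Least_le) (use that in auto)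
      moreover have "sel z = i" if "sel z = m - 1" using le_i \<open>i < m\<close> that by linarith
      ultimately show ?thesis using that by auto
    qed
    have "(\<integral>\<^sup>+\<omega>. (\<integral>\<^sup>+x. ennreal ((T (data n f \<omega>) x - f x)\<^sup>2) \<partial>D) \<partial>N)
        \<le> ennreal (18 * \<epsilon>\<^sup>2 + 40000 * (A\<^sup>2 + \<sigma>2) * real k / real n)"
      if f: "f \<in> borel_measurable D" "\<forall>x\<in>space D. \<forall>x'\<in>space D. \<bar>f x - f x'\<bar> \<le> A"
        and i0: "i0 < m" "(\<integral>x. (f x - (\<integral>x. f x \<partial>D) - g i0 x)\<^sup>2 \<partial>D) \<le> \<epsilon>\<^sup>2" for f i0
    proof -
      interpret regression_fun D \<mu> n f A by (rule reg[OF f])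
      define S where "S = (\<lambda>i j \<beta> \<omega>. (\<Sum>p\<in>{\<beta>*b..<\<beta>*b+b}. (r (\<omega> (2*p+2)) - r (\<omega> (2*p+1))) * (g j (fst (\<omega> (2*p+2))) - g i (fst (\<omega> (2*p+2))))) / real b)"
      define E where "E = (\<lambda>i j. sqrt (\<integral>x. (g j x - g i x)\<^sup>2 \<partial>D))"
      define d where "d = (\<lambda>i. sqrt (\<integral>x. (g i x - f0 x)\<^sup>2 \<partial>D))"
      define bad where "bad = (\<lambda>i j \<beta> \<omega>. \<tau> * E i j < \<bar>S i j \<beta> \<omega> - (\<integral>x. f0 x * (g j x - g i x) \<partial>D)\<bar>)"
      define Bij where "Bij = (\<lambda>i j. {\<omega>\<in>space N. k \<le> 2 * card {\<beta>\<in>{..<k}. bad i j \<beta> \<omega>}})"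
      define B where "B = (\<Union>i<m. \<Union>j<m. Bij i j)"
      have gbb: "\<bar>g j x - g i x\<bar> \<le> 2 * A" if "x \<in> space D" for i j x
        using gb[OF that, of i] gb[OF that, of j] by linarith
      have gfb: "\<bar>g j x - f0 x\<bar> \<le> 2 * A" if "x \<in> space D" for j x
        using f0_bound[OF that] gb[OF that, of j] by linarith
      have Bij: "Bij i j \<in> sets N" "measure N (Bij i j) \<le> 1 / 4 ^ k" for i j
      proof -
        have gm: "(\<lambda>x. g j x - g i x) \<in> borel_measurable D" by measurable
        show "Bij i j \<in> sets N" "measure N (Bij i j) \<le> 1 / 4 ^ k"
          unfolding Bij_def bad_def S_def E_def
          by (rule block_deviation[OF gm gbb b0 kb \<tau>0 \<tau>b]; assumption)+
      qed
      have Bs: "B \<in> sets N" unfolding B_def by (intro sets.finite_UN finite_lessThan Bij(1))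
      have pB: "measure N B \<le> 1 / real n"
      proof -
        have "measure N B \<le> (\<Sum>i<m. measure N (\<Union>j<m. Bij i j))"
          unfolding B_def using Bij by (intro N.finite_measure_subadditive_finite) auto
        also have "\<dots> \<le> (\<Sum>i<m. \<Sum>j<m. measure N (Bij i j))"
          using Bij by (intro sum_mono N.finite_measure_subadditive_finite) auto
        also have "\<dots> \<le> (\<Sum>i<m. \<Sum>j<m. 1 / 4 ^ k)"
          using Bij by (intro sum_mono) auto
        also have "\<dots> = (real m)\<^sup>2 / 4 ^ k" by (simp add: power2_eq_square)
        also have "\<dots> \<le> 1 / real n" using mk n1 by (simp add: field_simps)
        finally show ?thesis .
      qed
      have iprod: "integrable D (\<lambda>x. u x * v x)"
        if "u \<in> borel_measurable D" "v \<in> borel_measurable D" "\<And>x. x \<in> space D \<Longrightarrow> \<bar>u x\<bar> \<le> A" "\<And>x. x \<in> space D \<Longrightarrow> \<bar>v x\<bar> \<le> A" for u v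
        using that by (intro D.bounded_integrable[where C="A*A"] abs_mult_le_bound) auto
      \<comment> \<open>Polarization: the common term, the squared norm of f0, cancels from the two
        squared distances.\<close>
      have polar: "(\<integral>x. f0 x * (g j x - g i x) \<partial>D) - (q j - q i) / 2 = ((d i)\<^sup>2 - (d j)\<^sup>2) / 2" for i j
      proof -
        have dd: "(d i)\<^sup>2 = q i - 2 * (\<integral>x. f0 x * g i x \<partial>D) + (\<integral>x. f0 x * f0 x \<partial>D)" for i
        proof -
          have "(d i)\<^sup>2 = (\<integral>x. (g i x - f0 x)\<^sup>2 \<partial>D)" unfolding d_def by simp
          also have "\<dots> = (\<integral>x. g i x * g i x - 2 * (f0 x * g i x) + f0 x * f0 x \<partial>D)"
            by (intro Bochner_Integration.integral_cong refl) (simp add: power2_eq_square algebra_simps)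
          also have "\<dots> = q i - 2 * (\<integral>x. f0 x * g i x \<partial>D) + (\<integral>x. f0 x * f0 x \<partial>D)"
            using iprod[OF g g gb gb, of i i] iprod[OF f0_measurable g f0_bound gb, of i]
              iprod[OF f0_measurable f0_measurable f0_bound f0_bound]
            by (simp add: q_def power2_eq_square)
          finally show ?thesis .
        qed
        have "(\<integral>x. f0 x * (g j x - g i x) \<partial>D) = (\<integral>x. f0 x * g j x \<partial>D) - (\<integral>x. f0 x * g i x \<partial>D)"
          using iprod[OF f0_measurable g f0_bound gb, of i] iprod[OF f0_measurable g f0_bound gb, of j]
          by (simp add: right_diff_distrib)
        then show ?thesis unfolding dd by (simp add: field_simps)
      qed
      have tri: "E i j \<le> d i + d j" for i j
      proof -
        have "E i j = sqrt (\<integral>x. ((g j x - f0 x) + (f0 x - g i x))\<^sup>2 \<partial>D)" by (simp add: E_def)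
        also have "\<dots> \<le> sqrt (\<integral>x. (g j x - f0 x)\<^sup>2 \<partial>D) + sqrt (\<integral>x. (f0 x - g i x)\<^sup>2 \<partial>D)"
          using gfb by (intro D.L2_triangle[where C="2*A"]) (auto simp: abs_minus_commute)
        also have "(\<lambda>x. (f0 x - g i x)\<^sup>2) = (\<lambda>x. (g i x - f0 x)\<^sup>2)" by (simp add: power2_commute)
        finally show ?thesis by (simp add: d_def)
      qed
      have d0: "d i \<ge> 0" for i unfolding d_def by (auto intro!: integral_nonneg_AE)
      have di0: "d i0 \<le> \<epsilon>"
      proof -
        have "(\<lambda>x. (f x - (\<integral>x. f x \<partial>D) - g i0 x)\<^sup>2) = (\<lambda>x. (g i0 x - f0 x)\<^sup>2)"
          by (simp add: f0_def Ef_def power2_commute)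
        then show ?thesis unfolding d_def using i0 \<epsilon> by (intro real_le_lsqrt) auto
      qed
      have good: "(\<integral>x. (g (sel (data n f \<omega>)) x - f0 x)\<^sup>2 \<partial>D) \<le> 9 * (\<epsilon> + \<tau>)\<^sup>2"
        if \<omega>: "\<omega> \<in> space N" "\<omega> \<notin> B" for \<omega>
      proof -
        define z where "z = data n f \<omega>"
        have stS: "st \<beta> i j z = S i j \<beta> \<omega> - (q j - q i) / 2" if "\<beta> < k" for \<beta> i j
        proof -
          have "(snd (z (2*p+2)) - snd (z (2*p+1))) * (g j (fst (z (2*p+2))) - g i (fst (z (2*p+2))))
              = (r (\<omega> (2*p+2)) - r (\<omega> (2*p+1))) * (g j (fst (\<omega> (2*p+2))) - g i (fst (\<omega> (2*p+2))))"
            if "p \<in> {\<beta>*b..<\<beta>*b+b}" for p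
            using pin[OF \<open>\<beta> < k\<close> that] by (simp add: z_def data_def r_def f0_def)
          then show ?thesis unfolding st_def S_def by (metis (mono_tags, lifting) sum.cong)
        qed
        have maj: "k < 2 * card {\<beta>\<in>{..<k}. \<bar>st \<beta> i j z - ((d i)\<^sup>2 - (d j)\<^sup>2) / 2\<bar> \<le> \<tau> * E i j}"
          if "i < m" "j < m" for i j
        proof -
          have "\<omega> \<notin> Bij i j" using \<omega> that by (auto simp: B_def)
          then have "2 * card {\<beta>\<in>{..<k}. bad i j \<beta> \<omega>} < k" using \<omega> by (simp add: Bij_def)
          moreover have "{\<beta>\<in>{..<k}. \<bar>st \<beta> i j z - ((d i)\<^sup>2 - (d j)\<^sup>2) / 2\<bar> \<le> \<tau> * E i j} = {..<k} - {\<beta>\<in>{..<k}. bad i j \<beta> \<omega>}"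
          proof -
            have "st \<beta> i j z - ((d i)\<^sup>2 - (d j)\<^sup>2) / 2 = S i j \<beta> \<omega> - (\<integral>x. f0 x * (g j x - g i x) \<partial>D)"
              if "\<beta> < k" for \<beta>
              unfolding stS[OF that] polar[of j i, symmetric] by linarith
            then show ?thesis by (auto simp: bad_def not_less)
          qed
          moreover have "card ({..<k} - {\<beta>\<in>{..<k}. bad i j \<beta> \<omega>}) = k - card {\<beta>\<in>{..<k}. bad i j \<beta> \<omega>}"
            by (subst card_Diff_subset) auto
          ultimately show ?thesis by simp
        qed
        have "acc i0 z" unfolding acc_def
          by (rule tournament_selection(1)[where st="\<lambda>\<beta> i j. st \<beta> i j z" and D=d and E=E and k=k and m=m, OF _ tri d0 \<tau>0 i0(1) di0]) (rule maj)
        then have s: "sel z < m" "acc (sel z) z" using sel i0 by auto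
        have "d (sel z) \<le> 3 * (\<epsilon> + \<tau>)" 
          by (rule tournament_selection(2)[where st="\<lambda>\<beta> i j. st \<beta> i j z" and D=d and E=E and k=k and m=m, OF _ tri d0 \<tau>0 i0(1) di0])
             (rule maj s(1) s(2)[unfolded acc_def] | assumption)+
        then have "(d (sel z))\<^sup>2 \<le> (3 * (\<epsilon> + \<tau>))\<^sup>2" using d0 by (intro power_mono) auto
        moreover have "(d (sel z))\<^sup>2 = (\<integral>x. (g (sel z) x - f0 x)\<^sup>2 \<partial>D)" unfolding d_def by simp
        moreover have "(3 * (\<epsilon> + \<tau>))\<^sup>2 = 9 * (\<epsilon> + \<tau>)\<^sup>2" unfolding power_mult_distrib by simp
        ultimately show ?thesis by (simp add: z_def)
      qed
      have any: "(\<integral>x. (g i x - f0 x)\<^sup>2 \<partial>D) \<le> 4 * A\<^sup>2" for i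
      proof -
        have sqb: "(g i x - f0 x)\<^sup>2 \<le> 4 * A\<^sup>2" if "x \<in> space D" for x
        proof -
          have "(g i x - f0 x)\<^sup>2 \<le> (2 * A)\<^sup>2" using gfb[OF that, of i] by (intro power2_le_iff_abs_le[THEN iffD2]) auto
          then show ?thesis by (simp add: power_mult_distrib)
        qed
        have "(\<integral>x. (g i x - f0 x)\<^sup>2 \<partial>D) \<le> (\<integral>x. 4 * A\<^sup>2 \<partial>D)"
          using sqb by (intro integral_mono D.bounded_integrable[where C="4*A\<^sup>2"]) auto
        then show ?thesis by (simp add: D.prob_space)
      qed
      have "(\<integral>\<^sup>+\<omega>. (\<integral>\<^sup>+x. ennreal ((T (data n f \<omega>) x - f x)\<^sup>2) \<partial>D) \<partial>N)
        \<le> ennreal (9 * (\<epsilon> + \<tau>)\<^sup>2 + 4 * A\<^sup>2 * (1 / real n) + 2 * (A\<^sup>2 + \<sigma>2) / real n)"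
        unfolding T_def
      proof (rule selection_risk[OF g gb g0 Bs pB])
        fix \<omega> assume "\<omega> \<in> space N"
        then show "(\<integral>x. (g (sel (data n f \<omega>)) x - f0 x)\<^sup>2 \<partial>D) \<le> 9 * (\<epsilon> + \<tau>)\<^sup>2 + 4 * A\<^sup>2 * indicator B \<omega>"
          using good[of \<omega>] any[of "sel (data n f \<omega>)"]
          by (cases "\<omega> \<in> B") (auto intro: add_increasing)
      qed auto
      also have "\<dots> \<le> ennreal (18 * \<epsilon>\<^sup>2 + 40000 * (A\<^sup>2 + \<sigma>2) * real k / real n)"
      \<comment> \<open>The constants: 2048 = 512 * 4 since 1/b is at most 4k/n; expanding 9 *
        (\<epsilon> + \<tau>)^2 gives 18 * \<epsilon>^2 and 18 * 2048 = 36864 for the noise term;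
        failure and mean response add 4 + 2, and 40000 rounds the total.\<close>
      proof (rule ennreal_leI)
        have 1: "(\<epsilon> + \<tau>)\<^sup>2 \<le> 2 * \<epsilon>\<^sup>2 + 2 * \<tau>\<^sup>2"
          using sum_squares_bound[of \<epsilon> \<tau>] by (simp add: power2_sum)
        have "1 / real b \<le> 4 * real k / real n" using nb b0 n1 by (simp add: field_simps)
        then have "512 * (A\<^sup>2 + \<sigma>2) * (1 / real b) \<le> 512 * (A\<^sup>2 + \<sigma>2) * (4 * real k / real n)"
          using A2 by (intro mult_left_mono) auto
        then have 2: "\<tau>\<^sup>2 \<le> 2048 * ((A\<^sup>2 + \<sigma>2) * real k / real n)"
          by (simp add: \<tau>sq algebra_simps add_divide_distrib)
        have 3: "4 * A\<^sup>2 * (1 / real n) \<le> 4 * ((A\<^sup>2 + \<sigma>2) * real k / real n)"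
        proof -
          have "A\<^sup>2 * 1 \<le> (A\<^sup>2 + \<sigma>2) * real k" using s2 k1 by (intro mult_mono) auto
          then show ?thesis using n1 by (simp add: divide_right_mono)
        qed
        have 4: "2 * (A\<^sup>2 + \<sigma>2) / real n \<le> 2 * ((A\<^sup>2 + \<sigma>2) * real k / real n)"
        proof -
          have "(A\<^sup>2 + \<sigma>2) * 1 \<le> (A\<^sup>2 + \<sigma>2) * real k" using A2 k1 by (intro mult_left_mono) auto
          then show ?thesis using n1 by (simp add: divide_right_mono)
        qed
        have "0 \<le> (A\<^sup>2 + \<sigma>2) * real k / real n" using A2 by simp
        then have "9 * (\<epsilon> + \<tau>)\<^sup>2 + 4 * A\<^sup>2 * (1 / real n) + 2 * (A\<^sup>2 + \<sigma>2) / real n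
            \<le> 18 * \<epsilon>\<^sup>2 + 40000 * ((A\<^sup>2 + \<sigma>2) * real k / real n)"
          using 1 2 3 4 by linarith
        then show "9 * (\<epsilon> + \<tau>)\<^sup>2 + 4 * A\<^sup>2 * (1 / real n) + 2 * (A\<^sup>2 + \<sigma>2) / real n
            \<le> 18 * \<epsilon>\<^sup>2 + 40000 * (A\<^sup>2 + \<sigma>2) * real k / real n"
          by (simp only: mult.assoc times_divide_eq_right)
      qed
      finally show ?thesis .
    qed
    moreover have "case_prod T \<in> borel_measurable (?Z \<Otimes>\<^sub>M D)"
      unfolding T_def by (rule Tmeas[OF selm])
    ultimately show ?thesis by (intro exI[of _ T]) auto
  qed
qed

section \<open>Counting integer vectors and multilevels\<close>

text \<open>The exact remainder is carried along to make the induction close; dropping it gives the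
  factor (1 + x)/(1 - x) contributed by one coordinate to the generating function.\<close>

lemma sum_int_geometric:
  fixes x :: real
  assumes "0 < x" "x < 1"
  shows "(\<Sum>c\<in>{- int M..int M}. x ^ nat \<bar>c\<bar>) = (1 + x) / (1 - x) - 2 * x ^ Suc M / (1 - x)"
proof (induction M)
  case 0
  show ?case using assms by (simp flip: diff_divide_distrib)
next
  case (Suc M)
  have "{- int (Suc M)..int (Suc M)} = insert (int (Suc M)) (insert (- int (Suc M)) {- int M..int M})"
    by auto
  then have "(\<Sum>c\<in>{- int (Suc M)..int (Suc M)}. x ^ nat \<bar>c\<bar>)
      = 2 * x ^ Suc M + (\<Sum>c\<in>{- int M..int M}. x ^ nat \<bar>c\<bar>)"
    by (simp add: nat_add_distrib)
  also have "\<dots> = 2 * x ^ Suc M + ((1 + x) / (1 - x) - 2 * x ^ Suc M / (1 - x))"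
    unfolding Suc.IH ..
  also have "\<dots> = (1 + x) / (1 - x) - 2 * x ^ Suc (Suc M) / (1 - x)"
  proof -
    have "2 * x ^ Suc M = (2 * x ^ Suc M - 2 * x ^ Suc (Suc M)) / (1 - x)"
      using assms by (simp add: eq_divide_eq algebra_simps)
    then show ?thesis by (simp only: diff_divide_distrib)
  qed
  finally show ?case .
qed

definition lattice_ball :: "'k set \<Rightarrow> nat \<Rightarrow> ('k \<Rightarrow> int) set" where
  "lattice_ball K M = {z \<in> K \<rightarrow>\<^sub>E UNIV. (\<Sum>k\<in>K. nat \<bar>z k\<bar>) \<le> M}"

text \<open>The bound is the generating function \<open>(\<Sum>c. x ^ \<bar>c\<bar>) ^ card K\<close> divided by \<open>x ^ M\<close>.\<close>

lemma card_lattice_ball: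
  fixes x :: real and K :: "'k set"
  assumes "finite K" and x: "0 < x" "x < 1"
  shows "finite (lattice_ball K M) \<and>
    real (card (lattice_ball K M)) \<le> (1 / x) ^ M * ((1 + x) / (1 - x)) ^ card K"
  using assms(1)
proof (induction K arbitrary: M)
  case empty
  have "lattice_ball ({} :: 'k set) M = {\<lambda>_. undefined}" by (auto simp: lattice_ball_def)
  moreover have "1 \<le> (1 / x) ^ M" by (rule one_le_power) (use x in simp)
  ultimately show ?case by simp
next
  case (insert a K)
  let ?C = "(1 + x) / (1 - x)"
  let ?I = "{- int M..int M}"
  \<comment> \<open>Splitting off coordinate a: if its value is c, the others lie in the ball of
    radius M - |c|. The truncated subtraction is genuine because |c| is at most M on
    \<open>?I\<close>.\<close>
  have sub: "lattice_ball (insert a K) M \<subseteq> (\<Union>c\<in>?I. (\<lambda>y. y(a := c)) ` lattice_ball K (M - nat \<bar>c\<bar>))"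
  proof
    fix z assume z: "z \<in> lattice_ball (insert a K) M"
    define y where "y = z(a := undefined)"
    have s: "nat \<bar>z a\<bar> + (\<Sum>k\<in>K. nat \<bar>z k\<bar>) \<le> M"
      using z insert.hyps by (simp add: lattice_ball_def)
    have "(\<Sum>k\<in>K. nat \<bar>y k\<bar>) = (\<Sum>k\<in>K. nat \<bar>z k\<bar>)"
      using insert.hyps by (intro sum.cong) (auto simp: y_def)
    then have "(\<Sum>k\<in>K. nat \<bar>y k\<bar>) \<le> M - nat \<bar>z a\<bar>" using s by simp
    moreover have "y \<in> K \<rightarrow>\<^sub>E UNIV"
      using z insert.hyps by (auto simp: lattice_ball_def y_def PiE_def extensional_def)
    ultimately have "y \<in> lattice_ball K (M - nat \<bar>z a\<bar>)" by (simp add: lattice_ball_def)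
    moreover have "z = y(a := z a)" by (simp add: y_def)
    moreover have "z a \<in> ?I" using s by auto
    ultimately show "z \<in> (\<Union>c\<in>?I. (\<lambda>y. y(a := c)) ` lattice_ball K (M - nat \<bar>c\<bar>))" by blast
  qed
  have fin: "finite (\<Union>c\<in>?I. (\<lambda>y. y(a := c)) ` lattice_ball K (M - nat \<bar>c\<bar>))"
    using insert.IH by (intro finite_UN_I finite_imageI) auto
  have "card (lattice_ball (insert a K) M) \<le> card (\<Union>c\<in>?I. (\<lambda>y. y(a := c)) ` lattice_ball K (M - nat \<bar>c\<bar>))"
    by (rule card_mono[OF fin sub])
  also have "\<dots> \<le> (\<Sum>c\<in>?I. card ((\<lambda>y. y(a := c)) ` lattice_ball K (M - nat \<bar>c\<bar>)))"
    by (rule card_UN_le) simp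
  also have "\<dots> \<le> (\<Sum>c\<in>?I. card (lattice_ball K (M - nat \<bar>c\<bar>)))"
    using insert.IH by (intro sum_mono card_image_le) blast
  finally have "real (card (lattice_ball (insert a K) M)) \<le> (\<Sum>c\<in>?I. real (card (lattice_ball K (M - nat \<bar>c\<bar>))))"
    by (simp flip: of_nat_sum)
  also have "\<dots> \<le> (\<Sum>c\<in>?I. (1 / x) ^ (M - nat \<bar>c\<bar>) * ?C ^ card K)"
    using insert.IH by (intro sum_mono) blast
  also have "\<dots> = (\<Sum>c\<in>?I. (1 / x) ^ M * ?C ^ card K * x ^ nat \<bar>c\<bar>)"
  proof (rule sum.cong[OF refl])
    fix c assume "c \<in> ?I"
    then have "nat \<bar>c\<bar> \<le> M" by auto
    then have "(1 / x) ^ M = (1 / x) ^ (M - nat \<bar>c\<bar>) * (1 / x) ^ nat \<bar>c\<bar>"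
      by (simp flip: power_add)
    then show "(1 / x) ^ (M - nat \<bar>c\<bar>) * ?C ^ card K = (1 / x) ^ M * ?C ^ card K * x ^ nat \<bar>c\<bar>"
      using x by (simp add: power_divide)
  qed
  also have "\<dots> = (1 / x) ^ M * ?C ^ card K * (\<Sum>c\<in>?I. x ^ nat \<bar>c\<bar>)"
    by (simp add: sum_distrib_left)
  also have "\<dots> \<le> (1 / x) ^ M * ?C ^ card K * ?C"
  proof (rule mult_left_mono)
    show "(\<Sum>c\<in>?I. x ^ nat \<bar>c\<bar>) \<le> ?C" unfolding sum_int_geometric[OF x] using x by simp
  qed (use x in simp)
  also have "\<dots> = (1 / x) ^ M * ?C ^ card (insert a K)" using insert.hyps by simp
  finally show ?case using finite_subset[OF sub fin] by blast
qed

text \<open>\<open>level_mass q0 Q\<close> is the number of quantization steps allotted to a multilevel of total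
  resolution \<open>Q\<close>. It is chosen so that both the squared error \<open>2 powr (- Q) / level_mass q0 Q\<close> and the
  entropy decay geometrically in the distance of \<open>Q\<close> to the critical resolution \<open>q0\<close>.\<close>

definition level_gap :: "nat \<Rightarrow> nat \<Rightarrow> real" where
  "level_gap q0 Q = \<bar>real Q - real q0\<bar>"

definition level_mass :: "nat \<Rightarrow> nat \<Rightarrow> real" where
  "level_mass q0 Q = 2 powr (2 * real q0 - real Q + level_gap q0 Q / 2)"

text \<open>The generating function bound holds for every x in (0, 1), and x is adapted to the
  level. Writing a for the gap, above q0 there are far more cells than quantization steps, and a
  small x makes the cell factor negligible; below q0 the steps dominate, and x close to 1 makes the
  step factor negligible. The exponent r absorbs the excess of the number of cells over 2^Q.\<close>

lemma card_lattice_ball_level: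
  fixes K :: "'k set"
  assumes K: "finite K" "card K \<le> 2 ^ (Q + r)"
  shows "real (card (lattice_ball K (nat \<lfloor>level_mass q0 Q\<rfloor>)))
    \<le> exp (2 ^ q0 * 2 ^ r * ((3 * level_gap q0 Q + 4) * 2 powr (- level_gap q0 Q / 2)))"
proof -
  define a where "a = level_gap q0 Q"
  define M where "M = level_mass q0 Q"
  have a0: "a \<ge> 0" by (simp add: a_def level_gap_def)
  have ln2: "0 < ln (2::real)" "ln (2::real) \<le> 1" using ln_le_minus_one[of "2::real"] by auto
  have M0: "M > 0" by (simp add: M_def level_mass_def)
  have Mf: "real (nat \<lfloor>M\<rfloor>) \<le> M" using M0 by simp
  have m: "real (card K) \<le> 2 powr (real Q + real r)"
    using K(2) by (metis numeral_power_le_of_nat_cancel_iff of_nat_add of_nat_le_iff of_nat_numeral of_nat_power powr_realpow zero_less_numeral)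
  have r1: "1 \<le> (2::real) ^ r" by simp
  have p0: "(2::real) ^ q0 = 2 powr real q0" "(2::real) ^ r = 2 powr real r" by (simp_all add: powr_realpow)
  have main: "(1 / x) ^ nat \<lfloor>M\<rfloor> * ((1 + x) / (1 - x)) ^ card K \<le> exp (u + v)"
    if x: "0 < x" "x < 1" and u: "M * (- ln x) \<le> u" and v: "2 powr (real Q + real r) * ln ((1 + x) / (1 - x)) \<le> v" for x u v
  proof -
    have l1: "0 \<le> - ln x" and l2: "0 \<le> ln ((1 + x) / (1 - x))" using x by (auto simp: field_simps)
    have "(1 / x) ^ nat \<lfloor>M\<rfloor> = exp (real (nat \<lfloor>M\<rfloor>) * (- ln x))"
      using x by (simp add: exp_of_nat_mult exp_minus power_divide inverse_eq_divide)
    also have "\<dots> \<le> exp u" using mult_right_mono[OF Mf l1] u by simp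
    finally have 1: "(1 / x) ^ nat \<lfloor>M\<rfloor> \<le> exp u" .
    have pos: "(1 + x) / (1 - x) > 0" using x by simp
    have "((1 + x) / (1 - x)) ^ card K = exp (real (card K) * ln ((1 + x) / (1 - x)))"
      using pos by (simp add: exp_of_nat_mult)
    also have "\<dots> \<le> exp v" using mult_right_mono[OF m l2] v by simp
    finally have 2: "((1 + x) / (1 - x)) ^ card K \<le> exp v" .
    have "(1 / x) ^ nat \<lfloor>M\<rfloor> * ((1 + x) / (1 - x)) ^ card K \<le> exp u * exp v"
      using pos x by (intro mult_mono 1 2) auto
    then show ?thesis by (simp add: exp_add)
  qed
  have "\<exists>x u v. 0 < x \<and> x < 1 \<and> M * (- ln x) \<le> u \<and> 2 powr (real Q + real r) * ln ((1 + x) / (1 - x)) \<le> v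
      \<and> u + v \<le> 2 ^ q0 * 2 ^ r * ((3 * a + 4) * 2 powr (- a / 2))"
  proof (cases "q0 \<le> Q")
    case True
    have Q: "real Q = real q0 + a" using True by (simp add: a_def level_gap_def)
    \<comment> \<open>With at most 2^(q0 + a + r) cells, each contributing at most 4x = 2^(-2a), the
      cells cost 2^(q0 + r - a). The 2^(q0 - a/2) steps cost at most 2a + 2 each.\<close>
    define x where "x = 2 powr (- 2 * a - 2)"
    have x: "0 < x" "x \<le> 1/4"
    proof -
      have "x \<le> 2 powr (-2)" unfolding x_def using a0 by (intro powr_mono) auto
      then show "x \<le> 1/4" by (simp add: powr_minus_divide)
    qed (simp add: x_def)
    have Mq: "M = 2 powr real q0 * 2 powr (- a / 2)"
      unfolding M_def level_mass_def a_def[symmetric] Q by (simp add: powr_add[symmetric] algebra_simps)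
    have lx: "- ln x = (2 * a + 2) * ln 2" by (simp add: x_def ln_powr algebra_simps)
    have u: "M * (- ln x) \<le> 2 powr real q0 * ((2 * a + 2) * 2 powr (- a / 2))"
    proof -
      have "(2 * a + 2) * ln 2 \<le> (2 * a + 2) * 1" using ln2 a0 by (intro mult_left_mono) auto
      then have "M * (- ln x) \<le> M * (2 * a + 2)" unfolding lx using M0 by (intro mult_left_mono) auto
      then show ?thesis by (simp add: Mq mult_ac)
    qed
    have l: "ln ((1 + x) / (1 - x)) \<le> 4 * x"
    proof -
      have "ln ((1 + x) / (1 - x)) \<le> (1 + x) / (1 - x) - 1" using x by (intro ln_le_minus_one) auto
      also have "\<dots> \<le> 4 * x"
      proof -
        have "2 * x * 1 \<le> 2 * x * (2 * (1 - x))" using x by (intro mult_left_mono) auto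
        then show ?thesis using x by (simp add: field_simps)
      qed
      finally show ?thesis .
    qed
    have v: "2 powr (real Q + real r) * ln ((1 + x) / (1 - x)) \<le> 2 powr real q0 * 2 powr real r * 2 powr (- a / 2)"
    proof -
      have "2 powr (real Q + real r) * ln ((1 + x) / (1 - x)) \<le> 2 powr (real Q + real r) * (4 * x)"
        using l by (intro mult_left_mono) auto
      also have "4 * x = 2 powr (- 2 * a)"
        by (simp add: x_def powr_diff)
      also have "2 powr (real Q + real r) * 2 powr (- 2 * a) = 2 powr real q0 * 2 powr real r * 2 powr (- a)"
        unfolding Q by (simp add: powr_add[symmetric] algebra_simps)
      also have "\<dots> \<le> 2 powr real q0 * 2 powr real r * 2 powr (- a / 2)"
        using a0 by (intro mult_left_mono powr_mono) auto
      finally show ?thesis .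
    qed
    have fin: "2 powr real q0 * ((2 * a + 2) * 2 powr (- a / 2)) + 2 powr real q0 * 2 powr real r * 2 powr (- a / 2)
        \<le> 2 ^ q0 * 2 ^ r * ((3 * a + 4) * 2 powr (- a / 2))"
    proof -
      have "(2 * a + 2) * 1 \<le> (2 * a + 2) * 2 ^ r" using r1 a0 by (intro mult_left_mono) auto
      moreover have "(2 * a + 3) * 2 ^ r \<le> (3 * a + 4) * 2 ^ r" using a0 by (intro mult_right_mono) auto
      ultimately have "(2 * a + 2) + 2 ^ r \<le> (3 * a + 4) * 2 ^ r" by (simp add: algebra_simps)
      then have "2 powr real q0 * 2 powr (- a / 2) * ((2 * a + 2) + 2 ^ r) \<le> 2 powr real q0 * 2 powr (- a / 2) * ((3 * a + 4) * 2 ^ r)"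
        by (intro mult_left_mono) auto
      then show ?thesis unfolding p0 by (simp add: algebra_simps)
    qed
    have "x < 1" using x by simp
    then show ?thesis using x(1) u v fin by blast
  next
    case False
    have Q: "real Q = real q0 - a" using False by (simp add: a_def level_gap_def)
    \<comment> \<open>Here there are 2^(q0 + 3a/2) steps; -ln (1 - y) is at most 2y = 2^(-3a), so
      they cost 2^(q0 - 3a/2). Each of at most 2^(q0 - a + r) cells costs at most ln (2/y), which is
      at most 3a + 2.\<close>
    define y where "y = 2 powr (- 3 * a - 1)"
    have y: "0 < y" "y \<le> 1/2"
    proof -
      have "y \<le> 2 powr (-1)" unfolding y_def using a0 by (intro powr_mono) auto
      then show "y \<le> 1/2" by (simp add: powr_minus_divide)
    qed (simp add: y_def)
    define x where "x = 1 - y"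
    have Mq: "M = 2 powr real q0 * 2 powr (3 * a / 2)"
      unfolding M_def level_mass_def a_def[symmetric] Q by (simp add: powr_add[symmetric] algebra_simps)
    have lx: "- ln x \<le> 2 * y"
    proof -
      have "- ln x = ln (1 / x)" using y by (simp add: x_def ln_div)
      also have "\<dots> \<le> 1 / x - 1" using y by (intro ln_le_minus_one) (simp add: x_def)
      also have "\<dots> \<le> 2 * y"
      proof -
        have "y * 1 \<le> y * (2 * x)" using y by (intro mult_left_mono) (auto simp: x_def)
        then show ?thesis using y by (simp add: x_def field_simps)
      qed
      finally show ?thesis .
    qed
    have u: "M * (- ln x) \<le> 2 powr real q0 * 2 powr (- a / 2)"
    proof -
      have "M * (- ln x) \<le> M * (2 * y)" using lx M0 by (intro mult_left_mono) auto
      also have "2 * y = 2 powr (- 3 * a)" by (simp add: y_def powr_diff)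
      also have "M * 2 powr (- 3 * a) = 2 powr real q0 * 2 powr (- 3 * a / 2)"
        unfolding Mq by (simp add: powr_add[symmetric] algebra_simps)
      also have "\<dots> \<le> 2 powr real q0 * 2 powr (- a / 2)"
        using a0 by (intro mult_left_mono powr_mono) auto
      finally show ?thesis .
    qed
    have l: "ln ((1 + x) / (1 - x)) \<le> 3 * a + 2"
    proof -
      have "(1 + x) / (1 - x) \<le> 2 / y" using y by (simp add: x_def divide_right_mono)
      also have "2 / y = 2 powr (3 * a + 2)"
      proof -
        have "2 / y = 2 powr 1 * 2 powr (3 * a + 1)"
          by (simp add: y_def powr_minus_divide[symmetric] divide_powr_uminus add.commute)
        then show ?thesis by (simp only: powr_add[symmetric]) (simp add: add.commute)
      qed
      finally have "(1 + x) / (1 - x) \<le> 2 powr (3 * a + 2)" .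
      moreover have "(1 + x) / (1 - x) > 0" using y by (simp add: x_def)
      ultimately have "ln ((1 + x) / (1 - x)) \<le> ln (2 powr (3 * a + 2))" by (subst ln_le_cancel_iff) auto
      also have "\<dots> = (3 * a + 2) * ln 2" by (rule ln_powr)
      also have "\<dots> \<le> (3 * a + 2) * 1" using ln2 a0 by (intro mult_left_mono) auto
      finally show ?thesis by simp
    qed
    have v: "2 powr (real Q + real r) * ln ((1 + x) / (1 - x)) \<le> 2 powr real q0 * 2 powr real r * ((3 * a + 2) * 2 powr (- a / 2))"
    proof -
      have "2 powr (real Q + real r) * ln ((1 + x) / (1 - x)) \<le> 2 powr (real Q + real r) * (3 * a + 2)"
        using l by (intro mult_left_mono) auto
      also have "\<dots> = 2 powr real q0 * 2 powr real r * ((3 * a + 2) * 2 powr (- a))"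
      proof -
        have "2 powr (real Q + real r) = 2 powr real q0 * 2 powr real r * 2 powr (- a)"
          unfolding Q by (simp add: powr_add[symmetric] algebra_simps)
        then show ?thesis by (simp only: mult_ac)
      qed
      also have "\<dots> \<le> 2 powr real q0 * 2 powr real r * ((3 * a + 2) * 2 powr (- a / 2))"
        using a0 by (intro mult_left_mono powr_mono) auto
      finally show ?thesis .
    qed
    have fin: "2 powr real q0 * 2 powr (- a / 2) + 2 powr real q0 * 2 powr real r * ((3 * a + 2) * 2 powr (- a / 2))
        \<le> 2 ^ q0 * 2 ^ r * ((3 * a + 4) * 2 powr (- a / 2))"
    proof -
      have "1 + 2 ^ r * (3 * a + 2) \<le> (3 * a + 4) * 2 ^ r"
      proof -
        have "1 \<le> 2 * (2::real) ^ r" using r1 by linarith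
        then show ?thesis by (simp add: algebra_simps)
      qed
      then have "2 powr real q0 * 2 powr (- a / 2) * (1 + 2 ^ r * (3 * a + 2)) \<le> 2 powr real q0 * 2 powr (- a / 2) * ((3 * a + 4) * 2 ^ r)"
        by (rule mult_left_mono) simp
      then show ?thesis unfolding p0 by (simp add: algebra_simps)
    qed
    have "0 < x" "x < 1" using y by (auto simp: x_def)
    then show ?thesis using u v fin by blast
  qed
  then obtain x u v where x: "0 < x" "x < 1" and uv: "M * (- ln x) \<le> u"
      "2 powr (real Q + real r) * ln ((1 + x) / (1 - x)) \<le> v"
      "u + v \<le> 2 ^ q0 * 2 ^ r * ((3 * a + 4) * 2 powr (- a / 2))" by blast
  have "real (card (lattice_ball K (nat \<lfloor>M\<rfloor>))) \<le> (1 / x) ^ nat \<lfloor>M\<rfloor> * ((1 + x) / (1 - x)) ^ card K"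
    using card_lattice_ball[OF K(1) x] by blast
  also have "\<dots> \<le> exp (u + v)" by (rule main[OF x uv(1,2)])
  also have "\<dots> \<le> exp (2 ^ q0 * 2 ^ r * ((3 * a + 4) * 2 powr (- a / 2)))" using uv(3) by simp
  finally show ?thesis by (simp add: a_def M_def)
qed

lemma power_div_fact_le_exp:
  fixes x :: real
  assumes "x \<ge> 0"
  shows "x ^ n / fact n \<le> exp x"
proof -
  have "(\<Sum>i\<in>{n}. inverse (fact i) * x ^ i) \<le> (\<Sum>i. inverse (fact i) * x ^ i)"
    using assms summable_exp[of x] by (intro sum_le_suminf) auto
  then show ?thesis by (simp add: exp_def scaleR_conv_of_real divide_inverse mult.commute)
qed

text \<open>Bounds one side of all sums over levels at distance a from the critical one. The error
  decays like 2^(-a/4), the square root of the decay of the squared error; the entropy decays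
  faster. The power of a + 1 pays for the number of multilevels and for a linear factor in the
  entropy.\<close>

definition level_const :: "nat \<Rightarrow> real" where
  "level_const s = (\<Sum>a. (real a + 1) ^ s * 2 powr (- real a / 4))"

text \<open>Half of the exponential decay is spent on the polynomial: (a + 1)^s is at most a
  constant times 2^((a + 1)/8) by the exponential series, which leaves a geometric series of ratio
  2^(-1/8).\<close>

lemma summable_level_const: "summable (\<lambda>a. (real a + 1) ^ s * 2 powr (- real a / 4))"
proof (rule summable_comparison_test')
  define C :: real where "C = fact s * (8 / ln 2) ^ s * 2 powr (1/8)"
  show "summable (\<lambda>a. C * (2 powr (-1/8)) ^ a)"
    by (intro summable_mult summable_geometric) (simp add: powr_less_one)
  fix a :: nat assume "0 \<le> a"
  have ln2: "ln (2::real) > 0" by simp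
  define t where "t = (real a + 1) * ln 2 / 8"
  have "t ^ s / fact s \<le> exp t" unfolding t_def using ln2 by (intro power_div_fact_le_exp) auto
  also have "exp t = 2 powr ((real a + 1) / 8)" by (simp add: t_def powr_def mult.commute)
  finally have "t ^ s \<le> fact s * 2 powr ((real a + 1) / 8)" by (simp add: field_simps)
  then have "(8 / ln 2) ^ s * t ^ s \<le> (8 / ln 2) ^ s * (fact s * 2 powr ((real a + 1) / 8))"
    using ln2 by (intro mult_left_mono) auto
  moreover have "8 / ln 2 * t = real a + 1" using ln2 by (simp add: t_def)
  then have "(8 / ln 2) ^ s * t ^ s = (real a + 1) ^ s" by (simp only: power_mult_distrib[symmetric])
  ultimately have "(real a + 1) ^ s * 2 powr (- real a / 4) \<le> (8 / ln 2) ^ s * (fact s * 2 powr ((real a + 1) / 8)) * 2 powr (- real a / 4)"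
    by (intro mult_right_mono) auto
  also have "\<dots> = (8 / ln 2) ^ s * fact s * (2 powr ((real a + 1) / 8) * 2 powr (- real a / 4))"
    by simp
  also have "2 powr ((real a + 1) / 8) * 2 powr (- real a / 4) = 2 powr (1/8) * (2 powr (-1/8)) ^ a"
  proof -
    have "(real a + 1) / 8 + - real a / 4 = 1/8 + (-1/8) * real a" by (simp add: field_simps)
    then have "2 powr ((real a + 1) / 8) * 2 powr (- real a / 4) = 2 powr (1/8 + (-1/8) * real a)"
      by (simp only: powr_add[symmetric])
    also have "\<dots> = 2 powr (1/8) * (2 powr (-1/8)) powr real a"
      by (simp only: powr_add powr_powr)
    also have "(2 powr (-1/8)) powr real a = (2 powr (-1/8 :: real)) ^ a"
      by (rule powr_realpow) simp
    finally show ?thesis .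
  qed
  finally show "norm ((real a + 1) ^ s * 2 powr (- real a / 4)) \<le> C * (2 powr (-1/8)) ^ a"
    by (simp add: C_def mult_ac)
qed

lemma level_const_ge_1: "level_const s \<ge> 1"
proof -
  have "(\<Sum>a\<in>{0::nat}. (real a + 1) ^ s * 2 powr (- real a / 4)) \<le> level_const s"
    unfolding level_const_def by (rule sum_le_suminf[OF summable_level_const]) auto
  then show ?thesis by simp
qed

text \<open>The total Q determines one coordinate from the others, each of which is at most Q. This
  lost degree of freedom is the reason why the logarithm appears with sb - 1 and not sb.\<close>

lemma card_multilevels:
  assumes S: "finite S" "S \<noteq> {}"
  shows "card {q \<in> S \<rightarrow>\<^sub>E {..N}. (\<Sum>j\<in>S. q j) = Q} \<le> (Q + 1) ^ (card S - 1)"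
proof -
  obtain j0 where j0: "j0 \<in> S" using S by blast
  let ?A = "{q \<in> S \<rightarrow>\<^sub>E {..N}. (\<Sum>j\<in>S. q j) = Q}"
  let ?r = "\<lambda>q. restrict q (S - {j0})"
  have sum: "(\<Sum>j\<in>S. q j) = q j0 + (\<Sum>j\<in>S - {j0}. q j)" for q :: "'a \<Rightarrow> nat"
    by (rule sum.remove[OF S(1) j0])
  have inj: "inj_on ?r ?A"
  proof (rule inj_onI)
    fix p q assume p: "p \<in> ?A" and q: "q \<in> ?A" and eq: "?r p = ?r q"
    have e: "p j = q j" if "j \<in> S - {j0}" for j using fun_cong[OF eq, of j] that by simp
    have "(\<Sum>j\<in>S - {j0}. p j) = (\<Sum>j\<in>S - {j0}. q j)" using e by (intro sum.cong) auto
    then have "p j0 = q j0" using p q sum[of p] sum[of q] by auto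
    then have "p j = q j" if "j \<in> S" for j using e[of j] that by (cases "j = j0") auto
    then show "p = q" using p q by (intro PiE_ext[of p S _ q]) auto
  qed
  have "?r ` ?A \<subseteq> (S - {j0}) \<rightarrow>\<^sub>E {..Q}"
  proof
    fix y assume "y \<in> ?r ` ?A"
    then obtain q where q: "q \<in> ?A" and y: "y = ?r q" by blast
    have "q j \<le> Q" if "j \<in> S - {j0}" for j
      using member_le_sum[of j S q] S(1) that q by auto
    then show "y \<in> (S - {j0}) \<rightarrow>\<^sub>E {..Q}" by (auto simp: y)
  qed
  then have "card (?r ` ?A) \<le> card ((S - {j0}) \<rightarrow>\<^sub>E {..Q})"
    using S(1) by (intro card_mono finite_PiE) auto
  then have "card ?A \<le> card ((S - {j0}) \<rightarrow>\<^sub>E {..Q})"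
    unfolding card_image[OF inj] .
  also have "\<dots> = (Q + 1) ^ (card S - 1)"
    using S(1) j0 by (simp add: card_PiE card_Diff_singleton)
  finally show ?thesis .
qed

text \<open>Multilevels are grouped by their total Q, whose count is separated by Q + 1 \<le> (q0 +
  1) * (gap + 1). Each value of the gap occurs at most twice, below and above q0, hence the factor
  2. The bound is independent of N, so refining the grid costs nothing.\<close>

lemma sum_multilevels:
  assumes S: "finite S" "S \<noteq> {}" and s: "card S \<le> s"
  shows "(\<Sum>q\<in>S \<rightarrow>\<^sub>E {..N}. (level_gap q0 (\<Sum>j\<in>S. q j) + 1) * 2 powr (- level_gap q0 (\<Sum>j\<in>S. q j) / 4))
    \<le> 2 * level_const s * (real q0 + 1) ^ (card S - 1)"
proof -
  define F where "F = (\<lambda>Q. (level_gap q0 Q + 1) * 2 powr (- level_gap q0 Q / 4))"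
  define G where "G = (\<lambda>a. (a + 1) ^ s * 2 powr (- a / 4) :: real)"
  let ?A = "S \<rightarrow>\<^sub>E {..N}"
  let ?m = "\<lambda>q. \<Sum>j\<in>S. q j :: nat"
  have finA: "finite ?A" using S by (intro finite_PiE) auto
  have F0: "F Q \<ge> 0" for Q by (simp add: F_def level_gap_def)
  have G0: "G a \<ge> 0" if "a \<ge> 0" for a using that by (simp add: G_def)
  have r1: "card S \<ge> 1" using S by (simp add: card_gt_0_iff Suc_le_eq)
  have "(\<Sum>q\<in>?A. F (?m q)) = (\<Sum>Q\<in>?m ` ?A. \<Sum>q\<in>{q\<in>?A. ?m q = Q}. F (?m q))"
    by (rule sum.image_gen[OF finA])
  also have "\<dots> = (\<Sum>Q\<in>?m ` ?A. real (card {q\<in>?A. ?m q = Q}) * F Q)"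
    by (intro sum.cong refl) simp
  also have "\<dots> \<le> (\<Sum>Q\<in>?m ` ?A. (real q0 + 1) ^ (card S - 1) * G (level_gap q0 Q))"
  proof (rule sum_mono)
    fix Q
    have "real (card {q\<in>?A. ?m q = Q}) \<le> (real Q + 1) ^ (card S - 1)"
      using card_multilevels[OF S, of N Q] by (metis of_nat_1 of_nat_add of_nat_le_iff of_nat_power)
    also have "\<dots> \<le> ((real q0 + 1) * (level_gap q0 Q + 1)) ^ (card S - 1)"
    proof (rule power_mono)
      have "0 \<le> real q0 * level_gap q0 Q" by (simp add: level_gap_def)
      moreover have "real Q \<le> real q0 + level_gap q0 Q" by (simp add: level_gap_def)
      ultimately show "real Q + 1 \<le> (real q0 + 1) * (level_gap q0 Q + 1)" by (simp add: algebra_simps)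
    qed simp
    finally have "real (card {q\<in>?A. ?m q = Q}) * F Q \<le> ((real q0 + 1) * (level_gap q0 Q + 1)) ^ (card S - 1) * F Q"
      using F0 by (intro mult_right_mono) auto
    also have "\<dots> = (real q0 + 1) ^ (card S - 1) * ((level_gap q0 Q + 1) ^ (card S - 1) * (level_gap q0 Q + 1)) * 2 powr (- level_gap q0 Q / 4)"
      by (simp add: F_def power_mult_distrib mult_ac)
    also have "(level_gap q0 Q + 1) ^ (card S - 1) * (level_gap q0 Q + 1) = (level_gap q0 Q + 1) ^ card S"
      using r1 by (metis One_nat_def Suc_pred less_le_trans mult.commute power_Suc zero_less_one)
    also have "(real q0 + 1) ^ (card S - 1) * (level_gap q0 Q + 1) ^ card S * 2 powr (- level_gap q0 Q / 4)
        \<le> (real q0 + 1) ^ (card S - 1) * (level_gap q0 Q + 1) ^ s * 2 powr (- level_gap q0 Q / 4)"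
      using s by (intro mult_right_mono mult_left_mono power_increasing) (auto simp: level_gap_def)
    finally show "real (card {q\<in>?A. ?m q = Q}) * F Q \<le> (real q0 + 1) ^ (card S - 1) * G (level_gap q0 Q)"
      by (simp add: G_def mult_ac)
  qed
  also have "\<dots> = (real q0 + 1) ^ (card S - 1) * (\<Sum>Q\<in>?m ` ?A. G (level_gap q0 Q))"
    by (simp add: sum_distrib_left)
  also have "\<dots> \<le> (real q0 + 1) ^ (card S - 1) * (2 * level_const s)"
  proof (rule mult_left_mono)
    have part: "(\<Sum>Q\<in>X. G (level_gap q0 Q)) \<le> level_const s"
      if X: "finite X" "inj_on h X" "\<And>Q. Q \<in> X \<Longrightarrow> level_gap q0 Q = real (h Q)" for X and h :: "nat \<Rightarrow> nat"
    proof -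
      have "(\<Sum>Q\<in>X. G (level_gap q0 Q)) = (\<Sum>a\<in>h ` X. G (real a))"
        using X by (simp add: sum.reindex)
      also have "\<dots> \<le> level_const s"
        unfolding level_const_def G_def using X(1) by (intro sum_le_suminf[OF summable_level_const]) auto
      finally show ?thesis .
    qed
    let ?X = "?m ` ?A"
    have fX: "finite ?X" using finA by simp
    have "(\<Sum>Q\<in>?X. G (level_gap q0 Q)) = (\<Sum>Q\<in>?X \<inter> {..q0}. G (level_gap q0 Q)) + (\<Sum>Q\<in>?X - {..q0}. G (level_gap q0 Q))"
      by (rule sum.Int_Diff[OF fX])
    also have "\<dots> \<le> level_const s + level_const s"
    proof (rule add_mono)
      show "(\<Sum>Q\<in>?X \<inter> {..q0}. G (level_gap q0 Q)) \<le> level_const s"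
        using fX by (intro part[where h="\<lambda>Q. q0 - Q"]) (auto simp: inj_on_def level_gap_def of_nat_diff)
      show "(\<Sum>Q\<in>?X - {..q0}. G (level_gap q0 Q)) \<le> level_const s"
        using fX by (intro part[where h="\<lambda>Q. Q - q0"]) (auto simp: inj_on_def level_gap_def of_nat_diff)
    qed
    finally show "(\<Sum>Q\<in>?X. G (level_gap q0 Q)) \<le> 2 * level_const s" by simp
  qed simp
  finally show ?thesis by (simp add: F_def mult_ac)
qed

section \<open>Dyadic telescoping of interval indicators\<close>

text \<open>The point z = 1 receives its own index 2^q, so a level has 2^q + 1 cells. The minimum
  and \<open>nat\<close> keep the index in this range for every real z, which is convenient because
  the design lies in the cube only almost surely.\<close>

definition dyadic_cell :: "nat \<Rightarrow> real \<Rightarrow> nat" where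
  "dyadic_cell q z = min (2 ^ q) (nat \<lfloor>2 ^ q * z\<rfloor>)"

definition cell_end :: "nat \<Rightarrow> nat \<Rightarrow> real" where
  "cell_end q k = (real k + 1) / 2 ^ q"

text \<open>Detail of g between consecutive grids when g on a cell is represented by its value at
  the right end; \<open>k div 2\<close> is the parent cell. At level 0 the value itself is taken, so
  that the increments telescope.\<close>

definition increment :: "(real \<Rightarrow> real) \<Rightarrow> nat \<Rightarrow> nat \<Rightarrow> real" where
  "increment g q k = g (cell_end q k) - (if q = 0 then 0 else g (cell_end (q - 1) (k div 2)))"

definition interval_indicator :: "bool \<Rightarrow> real \<Rightarrow> bool \<Rightarrow> real \<Rightarrow> real \<Rightarrow> real" where
  "interval_indicator P l Q u y = of_bool ((P \<longrightarrow> l \<le> y) \<and> (Q \<longrightarrow> y < u))"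

text \<open>Nestedness of the grids, including the clipped indices: the cap 2 * 2^q is halved to the
  cap 2^q of the parent level.\<close>

lemma dyadic_cell_Suc: "dyadic_cell (Suc q) z div 2 = dyadic_cell q z"
proof -
  have 1: "\<lfloor>2 ^ q * z\<rfloor> = \<lfloor>2 ^ Suc q * z\<rfloor> div 2"
    using floor_divide_real_eq_div[of 2 "2 ^ Suc q * z"] by simp
  have 2: "nat (i div 2) = nat i div 2" for i :: int by (simp add: nat_div_distrib')
  have "min (2 * p) a div 2 = min p (a div 2)" for a p :: nat by (auto simp: min_def)
  then have 3: "min (2 ^ Suc q) a div 2 = min (2 ^ q) (a div 2)" for a :: nat by simp
  show ?thesis unfolding dyadic_cell_def 1 2 3 ..
qed

lemma dyadic_cell_le: "dyadic_cell q z \<le> 2 ^ q"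
  by (simp add: dyadic_cell_def)

lemma sum_increment: "(\<Sum>q\<le>N. increment g q (dyadic_cell q z)) = g (cell_end N (dyadic_cell N z))"
  by (induction N) (simp_all add: increment_def dyadic_cell_Suc)

text \<open>The right end of the parent cell is the right end of the cell or one cell width further.
  The indicator can change between these two points only if a threshold lies in that half-open
  interval, which is what the ceiling k + 2 expresses.\<close>

lemma increment_bound:
  fixes l u :: real and P Q :: bool
  defines "g \<equiv> interval_indicator P l Q u"
  shows "\<bar>increment g (Suc p) k\<bar> \<le> of_bool (\<lceil>2 ^ Suc p * l\<rceil> = int k + 2) + of_bool (\<lceil>2 ^ Suc p * u\<rceil> = int k + 2)"
proof -
  define e where "e = cell_end (Suc p) k"
  define e' where "e' = cell_end p (k div 2)"
  have e: "2 ^ Suc p * e = real k + 1" by (simp add: e_def cell_end_def)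
  have e'eq: "2 ^ Suc p * e' = 2 * real (k div 2) + 2" by (simp add: e'_def cell_end_def)
  have "2 * real (k div 2) \<le> real k" "real k - 1 \<le> 2 * real (k div 2)" by linarith+
  then have e': "2 ^ Suc p * e \<le> 2 ^ Suc p * e'" "2 ^ Suc p * e' \<le> real k + 2" unfolding e e'eq by auto
  have le: "e \<le> e'" using e'(1) by (simp del: power_Suc)
  have c: "\<lceil>2 ^ Suc p * w\<rceil> = int k + 2" if "e < w" "w \<le> e'" for w
  proof -
    have "real k + 1 < 2 ^ Suc p * w" unfolding e[symmetric] using that(1) by (simp del: power_Suc)
    moreover have "2 ^ Suc p * w \<le> 2 ^ Suc p * e'" using that(2) by (simp del: power_Suc)
    then have "2 ^ Suc p * w \<le> real k + 2" using e'(2) by linarith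
    ultimately show ?thesis by (intro ceiling_unique) auto
  qed
  have inc: "increment g (Suc p) k = g e - g e'" by (simp add: increment_def e_def e'_def)
  have "g e \<noteq> g e' \<Longrightarrow> (e < l \<and> l \<le> e') \<or> (e < u \<and> u \<le> e')"
    using le by (auto simp: g_def interval_indicator_def of_bool_eq_iff)
  moreover have "\<bar>g e - g e'\<bar> \<le> 1" by (auto simp: g_def interval_indicator_def)
  ultimately show ?thesis unfolding inc using c[of l] c[of u] by (cases "g e = g e'") auto
qed

lemma sum_of_bool_unique_le: "(\<Sum>k\<le>m::nat. of_bool (c = int k + i)) \<le> (1::real)"
proof -
  have "(\<Sum>k\<le>m::nat. of_bool (c = int k + i)) = (\<Sum>k\<in>{..m}. if k = nat (c - i) \<and> c \<ge> i then 1 else (0::real))"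
    by (intro sum.cong) auto
  also have "\<dots> \<le> (\<Sum>k\<in>{..m}. if k = nat (c - i) then 1 else (0::real))"
    by (intro sum_mono) auto
  also have "\<dots> \<le> 1" by simp
  finally show ?thesis .
qed

text \<open>Each of the two thresholds is met by at most one cell of a level, so the l1 norm of the
  increments does not grow with the level. At level 0 there are two cells with increment at most 1,
  which gives 2 as well.\<close>

lemma sum_abs_increment_le:
  fixes l u :: real and P Q :: bool
  defines "g \<equiv> interval_indicator P l Q u"
  shows "(\<Sum>k\<le>2 ^ q. \<bar>increment g q k\<bar>) \<le> 2"
proof (cases q)
  case 0
  have "(\<Sum>k\<le>2 ^ q. \<bar>increment g q k\<bar>) \<le> (\<Sum>k\<le>(2::nat) ^ q. 1)"
    by (intro sum_mono) (auto simp: 0 increment_def g_def interval_indicator_def)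
  then show ?thesis by (simp add: 0)
next
  case (Suc p)
  have "(\<Sum>k\<le>2 ^ q. \<bar>increment g q k\<bar>) \<le> (\<Sum>k\<le>2 ^ q. of_bool (\<lceil>2 ^ Suc p * l\<rceil> = int k + 2) + of_bool (\<lceil>2 ^ Suc p * u\<rceil> = int k + 2))"
    unfolding Suc g_def by (intro sum_mono increment_bound)
  also have "\<dots> \<le> 1 + 1"
    unfolding sum.distrib by (intro add_mono sum_of_bool_unique_le)
  finally show ?thesis by simp
qed

text \<open>The indicator differs between z and the right end of its cell only if a threshold lies
  between them, hence in the cell itself. The ceiling is therefore k + 1, one less than for
  increments, where the threshold lies beyond the cell.\<close>

lemma indicator_change_in_cell:
  fixes l u :: real and P Q :: bool
  defines "g \<equiv> interval_indicator P l Q u"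
  assumes z: "0 \<le> z" "z \<le> 1" and ne: "g z \<noteq> g (cell_end q (dyadic_cell q z))"
  shows "(P \<and> \<lceil>2 ^ q * l\<rceil> = int (dyadic_cell q z) + 1) \<or> (Q \<and> \<lceil>2 ^ q * u\<rceil> = int (dyadic_cell q z) + 1)"
proof -
  define k where "k = dyadic_cell q z"
  have "2 ^ q * z \<le> 2 ^ q * 1" using z by (intro mult_left_mono) auto
  then have "\<lfloor>2 ^ q * z\<rfloor> \<le> \<lfloor>(2::real) ^ q\<rfloor>" by (intro floor_mono) simp
  then have "\<lfloor>2 ^ q * z\<rfloor> \<le> 2 ^ q" by (metis floor_of_int of_int_numeral of_int_power)
  moreover have "\<lfloor>2 ^ q * z\<rfloor> \<ge> 0" using z by simp
  ultimately have k: "int k = \<lfloor>2 ^ q * z\<rfloor>" by (simp add: k_def dyadic_cell_def nat_le_iff min_absorb2)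
  then have kz: "real k \<le> 2 ^ q * z" "2 ^ q * z < real k + 1"
    by (metis of_int_floor_le of_int_of_nat_eq, metis floor_correct of_int_of_nat_eq of_int_add of_int_1)
  define e where "e = cell_end q k"
  have e: "2 ^ q * e = real k + 1" by (simp add: e_def cell_end_def)
  have "2 ^ q * z < 2 ^ q * e" using kz e by simp
  then have ze: "z < e" by simp
  have c: "\<lceil>2 ^ q * w\<rceil> = int k + 1" if "z < w" "w \<le> e" for w
  proof -
    have "2 ^ q * z < 2 ^ q * w" "2 ^ q * w \<le> 2 ^ q * e" using that by auto
    then have "real k < 2 ^ q * w" "2 ^ q * w \<le> real k + 1" using kz e by linarith+
    then show ?thesis by (intro ceiling_unique) auto
  qed
  have "(P \<and> z < l \<and> l \<le> e) \<or> (Q \<and> z < u \<and> u \<le> e)"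
    using ne ze unfolding g_def interval_indicator_def k_def[symmetric] e_def[symmetric] of_bool_eq_iff by auto
  then show ?thesis using c[of l] c[of u] by (auto simp: k_def)
qed

section \<open>Entropy of the function class\<close>

lemma prod_of_bool_eq: "finite A \<Longrightarrow> (\<Prod>j\<in>A. of_bool (P j) :: real) = of_bool (\<forall>j\<in>A. P j)"
  by (induction A rule: finite_induct) auto

text \<open>Minkowski's inequality in L2, stated for nonnegative integrals so that square
  integrability need not be discussed. It follows from the Cauchy-Schwarz inequality with weights
  proportional to the norm bounds w i, whence their positivity.\<close>

lemma nn_integral_sq_sum_le:
  fixes h :: "'i \<Rightarrow> 'x \<Rightarrow> real"
  assumes J: "finite J" and h [measurable]: "\<And>i. i \<in> J \<Longrightarrow> h i \<in> borel_measurable M"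
    and w: "\<And>i. i \<in> J \<Longrightarrow> w i > 0"
    and le: "\<And>i. i \<in> J \<Longrightarrow> (\<integral>\<^sup>+x. ennreal ((h i x)\<^sup>2) \<partial>M) \<le> ennreal ((w i)\<^sup>2)"
  shows "(\<integral>\<^sup>+x. ennreal ((\<Sum>i\<in>J. h i x)\<^sup>2) \<partial>M) \<le> ennreal ((\<Sum>i\<in>J. w i)\<^sup>2)"
proof -
  define W where "W = (\<Sum>i\<in>J. w i)"
  have W0: "W \<ge> 0" unfolding W_def using w by (intro sum_nonneg) (auto intro: less_imp_le)
  have pt: "(\<Sum>i\<in>J. h i x)\<^sup>2 \<le> (\<Sum>i\<in>J. W / w i * (h i x)\<^sup>2)" for x
  proof -
    have "(\<Sum>i\<in>J. h i x)\<^sup>2 = (\<Sum>i\<in>J. sqrt (w i) * (h i x / sqrt (w i)))\<^sup>2"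
    proof (intro arg_cong[where f="\<lambda>t. t\<^sup>2"] sum.cong refl)
      fix i assume "i \<in> J"
      then show "h i x = sqrt (w i) * (h i x / sqrt (w i))" using w[of i] by simp
    qed
    also have "\<dots> \<le> (\<Sum>i\<in>J. (sqrt (w i))\<^sup>2) * (\<Sum>i\<in>J. (h i x / sqrt (w i))\<^sup>2)"
      by (rule Cauchy_Schwarz_ineq_sum)
    also have "\<dots> = (\<Sum>i\<in>J. W / w i * (h i x)\<^sup>2)"
    proof -
      have "(\<Sum>i\<in>J. (sqrt (w i))\<^sup>2) = W" unfolding W_def using w by (intro sum.cong) (auto intro: less_imp_le)
      moreover have "(\<Sum>i\<in>J. (h i x / sqrt (w i))\<^sup>2) = (\<Sum>i\<in>J. (h i x)\<^sup>2 / w i)"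
        using w by (intro sum.cong) (auto simp: power_divide intro: less_imp_le)
      ultimately show ?thesis by (simp add: sum_distrib_left)
    qed
    finally show ?thesis .
  qed
  have nn: "0 \<le> W / w i * (h i x)\<^sup>2" if "i \<in> J" for i x
    using W0 w[OF that] by simp
  have "(\<integral>\<^sup>+x. ennreal ((\<Sum>i\<in>J. h i x)\<^sup>2) \<partial>M) \<le> (\<integral>\<^sup>+x. (\<Sum>i\<in>J. ennreal (W / w i * (h i x)\<^sup>2)) \<partial>M)"
    using pt nn by (intro nn_integral_mono) (simp add: sum_ennreal ennreal_leI)
  also have "\<dots> = (\<Sum>i\<in>J. \<integral>\<^sup>+x. ennreal (W / w i * (h i x)\<^sup>2) \<partial>M)"
    by (rule nn_integral_sum) simp
  also have "\<dots> = (\<Sum>i\<in>J. ennreal (W / w i) * (\<integral>\<^sup>+x. ennreal ((h i x)\<^sup>2) \<partial>M))"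
  proof (rule sum.cong[OF refl])
    fix i assume i: "i \<in> J"
    have "W / w i \<ge> 0" using W0 w[OF i] by simp
    then show "(\<integral>\<^sup>+x. ennreal (W / w i * (h i x)\<^sup>2) \<partial>M) = ennreal (W / w i) * (\<integral>\<^sup>+x. ennreal ((h i x)\<^sup>2) \<partial>M)"
      using i by (simp only: ennreal_mult[OF _ zero_le_power2]) (simp add: nn_integral_cmult)
  qed
  also have "\<dots> \<le> (\<Sum>i\<in>J. ennreal (W / w i) * ennreal ((w i)\<^sup>2))"
    using le by (intro sum_mono mult_left_mono) auto
  also have "\<dots> = (\<Sum>i\<in>J. ennreal (W * w i))"
  proof (rule sum.cong[OF refl])
    fix i assume i: "i \<in> J"
    have "W / w i \<ge> 0" using W0 w[OF i] by simp
    then show "ennreal (W / w i) * ennreal ((w i)\<^sup>2) = ennreal (W * w i)"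
      using w[OF i] by (simp add: ennreal_mult[symmetric] power2_eq_square)
  qed
  also have "\<dots> = ennreal (W * W)"
  proof -
    have "0 \<le> W * w i" if "i \<in> J" for i using W0 w[OF that] by simp
    then have "(\<Sum>i\<in>J. ennreal (W * w i)) = ennreal (\<Sum>i\<in>J. W * w i)" by (rule sum_ennreal)
    then show ?thesis by (simp add: W_def sum_distrib_left)
  qed
  finally show ?thesis by (simp add: W_def power2_eq_square)
qed

lemma nn_integral_sq_add_le:
  fixes g h :: "'x \<Rightarrow> real"
  assumes "g \<in> borel_measurable M" "h \<in> borel_measurable M" "u > 0" "v > 0"
    "(\<integral>\<^sup>+x. ennreal ((g x)\<^sup>2) \<partial>M) \<le> ennreal (u\<^sup>2)" "(\<integral>\<^sup>+x. ennreal ((h x)\<^sup>2) \<partial>M) \<le> ennreal (v\<^sup>2)"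
  shows "(\<integral>\<^sup>+x. ennreal ((g x + h x)\<^sup>2) \<partial>M) \<le> ennreal ((u + v)\<^sup>2)"
  using nn_integral_sq_sum_le[of UNIV "case_bool g h" M "case_bool u v"] assms
  by (simp add: UNIV_bool add.commute split: bool.split)

lemma finite_index_pairs: "finite (index_pairs d s)"
  by (rule finite_subset[of _ "Pow {1..d} \<times> Pow {1..d}"]) (auto simp: index_pairs_def)

section \<open>Grid cells under a design law dominated by volume\<close>

locale grid_design =
  fixes d :: nat and M :: "nat \<Rightarrow> real" and D :: "(nat \<Rightarrow> real) measure" and B :: real
  assumes D: "prob_space D" and sets_D [measurable_cong]: "sets D = sets (Rd d)"
    and M: "\<And>j. j \<in> {1..d} \<Longrightarrow> M j > 0"
    and cube: "AE x in D. \<forall>j\<in>{1..d}. 0 \<le> x j / M j + 1/2 \<and> x j / M j + 1/2 \<le> 1"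
    and B: "B > 0"
    and cell: "\<And>S q k. S \<subseteq> {1..d} \<Longrightarrow>
      measure D {x\<in>space D. \<forall>j\<in>S. dyadic_cell (q j) (x j / M j + 1/2) = k j} \<le> B * (\<Prod>j\<in>S. 1 / 2 ^ q j)"
begin

sublocale D: prob_space D by (rule D)

definition nc :: "nat \<Rightarrow> (nat \<Rightarrow> real) \<Rightarrow> real" where
  "nc j x = x j / M j + 1/2"

lemma nc_measurable: "j \<in> {1..d} \<Longrightarrow> nc j \<in> borel_measurable D"
proof -
  assume j: "j \<in> {1..d}"
  have "(\<lambda>x. x j) \<in> borel_measurable (Rd d)"
    unfolding Rd_def using measurable_component_singleton[OF j, of "\<lambda>_. lborel"] by simp
  then show ?thesis unfolding nc_def by simp
qed

lemma dyadic_cell_measurable: "j \<in> {1..d} \<Longrightarrow> (\<lambda>x. dyadic_cell q (nc j x)) \<in> measurable D (count_space UNIV)"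
proof -
  assume j: "j \<in> {1..d}"
  have "(\<lambda>z::real. \<lfloor>2 ^ q * z\<rfloor>) \<in> measurable borel (count_space UNIV)" by measurable
  then have "dyadic_cell q \<in> measurable borel (count_space UNIV)"
    unfolding dyadic_cell_def by (rule measurable_compose) simp
  then show ?thesis by (rule measurable_compose[OF nc_measurable[OF j]])
qed

lemma cell_sets:
  assumes "finite S" "S \<subseteq> {1..d}"
  shows "{x\<in>space D. \<forall>j\<in>S. dyadic_cell (q j) (nc j x) = k j} \<in> sets D"
proof (rule sets.sets_Collect_finite_All[OF _ assms(1)])
  fix j assume "j \<in> S"
  then have "j \<in> {1..d}" using assms by auto
  from measurable_sets[OF dyadic_cell_measurable[OF this], of "{k j}" "q j"]
  show "{x\<in>space D. dyadic_cell (q j) (nc j x) = k j} \<in> sets D"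
    by (simp add: vimage_def Int_def conj_commute)
qed

definition cell_of :: "nat set \<Rightarrow> (nat \<Rightarrow> nat) \<Rightarrow> (nat \<Rightarrow> real) \<Rightarrow> nat \<Rightarrow> nat" where
  "cell_of S q x = (\<lambda>j\<in>S. dyadic_cell (q j) (nc j x))"

definition cells :: "nat set \<Rightarrow> (nat \<Rightarrow> nat) \<Rightarrow> (nat \<Rightarrow> nat) set" where
  "cells S q = Pi\<^sub>E S (\<lambda>j. {..2 ^ q j})"

lemma finite_cells: "finite S \<Longrightarrow> finite (cells S q)"
  unfolding cells_def by (intro finite_PiE) auto

text \<open>Bounding 2^q + 1 by 2^(q + 1) in each coordinate puts the extra boundary cells into the
  exponent; this is the r of the lattice point count.\<close>

lemma card_cells:
  assumes "finite S" shows "card (cells S q) \<le> 2 ^ ((\<Sum>j\<in>S. q j) + card S)"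
proof -
  have "card (cells S q) = (\<Prod>j\<in>S. 2 ^ q j + 1)" unfolding cells_def using assms by (simp add: card_PiE)
  also have "\<dots> \<le> (\<Prod>j\<in>S. 2 ^ (q j + 1))" by (intro prod_mono) auto
  also have "\<dots> = 2 ^ ((\<Sum>j\<in>S. q j) + card S)" by (simp only: power_sum[symmetric] sum.distrib) simp
  finally show ?thesis .
qed

lemma cell_of_in_cells: "cell_of S q x \<in> cells S q"
  by (auto simp: cell_of_def cells_def dyadic_cell_le)

lemma cell_of_eq_iff:
  assumes "k \<in> cells S q"
  shows "cell_of S q x = k \<longleftrightarrow> (\<forall>j\<in>S. dyadic_cell (q j) (nc j x) = k j)"
  using assms by (auto simp: cell_of_def cells_def fun_eq_iff PiE_def extensional_def)

text \<open>A function of the cell index is a finite combination of indicators of disjoint boxes, so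
  its integral is a sum of values times box probabilities. Applied to squares, it turns a sum of
  squared coefficients into an L2 bound.\<close>

lemma cell_function:
  fixes \<Phi> :: "(nat \<Rightarrow> nat) \<Rightarrow> real"
  assumes S: "finite S" "S \<subseteq> {1..d}"
  shows "(\<lambda>x. \<Phi> (cell_of S q x)) \<in> borel_measurable D"
    and "(\<And>k. \<Phi> k \<ge> 0) \<Longrightarrow> (\<integral>\<^sup>+x. ennreal (\<Phi> (cell_of S q x)) \<partial>D)
      \<le> ennreal (B * (\<Prod>j\<in>S. 1 / 2 ^ q j) * (\<Sum>k\<in>cells S q. \<Phi> k))"
proof -
  define C where "C = (\<lambda>k. {x\<in>space D. \<forall>j\<in>S. dyadic_cell (q j) (nc j x) = k j})"
  have Cs: "C k \<in> sets D" for k unfolding C_def by (rule cell_sets[OF S])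
  have eq: "\<Phi> (cell_of S q x) = (\<Sum>k\<in>cells S q. \<Phi> k * indicator (C k) x)" if x: "x \<in> space D" for x
  proof -
    have "(\<Sum>k\<in>cells S q. \<Phi> k * indicator (C k) x) = (\<Sum>k\<in>cells S q. if k = cell_of S q x then \<Phi> k else 0)"
      by (rule sum.cong[OF refl]) (use x in \<open>auto simp: C_def cell_of_eq_iff[symmetric]\<close>)
    also have "\<dots> = \<Phi> (cell_of S q x)"
      using finite_cells[OF S(1)] cell_of_in_cells by simp
    finally show ?thesis by simp
  qed
  have "(\<lambda>x. \<Sum>k\<in>cells S q. \<Phi> k * indicator (C k) x) \<in> borel_measurable D"
    using Cs by (intro borel_measurable_sum borel_measurable_times borel_measurable_const borel_measurable_indicator)
  then show "(\<lambda>x. \<Phi> (cell_of S q x)) \<in> borel_measurable D"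
    by (rule measurable_cong[THEN iffD2, rotated]) (rule eq)
  assume pos: "\<And>k. \<Phi> k \<ge> 0"
  have "(\<integral>\<^sup>+x. ennreal (\<Phi> (cell_of S q x)) \<partial>D) = (\<integral>\<^sup>+x. (\<Sum>k\<in>cells S q. ennreal (\<Phi> k) * indicator (C k) x) \<partial>D)"
  proof (rule nn_integral_cong)
    fix x assume "x \<in> space D"
    then have "ennreal (\<Phi> (cell_of S q x)) = ennreal (\<Sum>k\<in>cells S q. \<Phi> k * indicator (C k) x)" by (simp only: eq)
    also have "\<dots> = (\<Sum>k\<in>cells S q. ennreal (\<Phi> k * indicator (C k) x))"
      using pos by (intro sum_ennreal[symmetric]) auto
    also have "\<dots> = (\<Sum>k\<in>cells S q. ennreal (\<Phi> k) * indicator (C k) x)"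
      by (intro sum.cong refl) (auto simp: indicator_def)
    finally show "ennreal (\<Phi> (cell_of S q x)) = (\<Sum>k\<in>cells S q. ennreal (\<Phi> k) * indicator (C k) x)" .
  qed
  also have "\<dots> = (\<Sum>k\<in>cells S q. ennreal (\<Phi> k) * emeasure D (C k))"
    using Cs by (subst nn_integral_sum) (auto simp: nn_integral_cmult_indicator intro!: borel_measurable_times)
  also have "\<dots> \<le> (\<Sum>k\<in>cells S q. ennreal (\<Phi> k) * ennreal (B * (\<Prod>j\<in>S. 1 / 2 ^ q j)))"
  proof (intro sum_mono mult_left_mono)
    fix k
    have "measure D (C k) \<le> B * (\<Prod>j\<in>S. 1 / 2 ^ q j)"
      using cell[OF S(2), of q k] by (simp add: C_def nc_def)
    then show "emeasure D (C k) \<le> ennreal (B * (\<Prod>j\<in>S. 1 / 2 ^ q j))"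
      unfolding D.emeasure_eq_measure by (rule ennreal_leI)
  qed simp
  also have "\<dots> = ennreal (B * (\<Prod>j\<in>S. 1 / 2 ^ q j) * (\<Sum>k\<in>cells S q. \<Phi> k))"
  proof -
    have "0 \<le> B * (\<Prod>j\<in>S. 1 / 2 ^ q j :: real)" using B by (intro mult_nonneg_nonneg prod_nonneg) auto
    then show ?thesis using pos
      by (simp add: ennreal_mult[symmetric] sum_ennreal sum_distrib_right mult.commute del: prod_dividef)
  qed
  finally show "(\<integral>\<^sup>+x. ennreal (\<Phi> (cell_of S q x)) \<partial>D)
      \<le> ennreal (B * (\<Prod>j\<in>S. 1 / 2 ^ q j) * (\<Sum>k\<in>cells S q. \<Phi> k))" .
qed

end

section \<open>One pair (L, U): reduction to one-variable interval indicators\<close>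

locale threshold_pair = grid_design +
  fixes L U :: "nat set" and s :: nat
  assumes LU: "(L, U) \<in> index_pairs d s"
begin

definition S where "S = L \<union> U"

lemma S_facts: "finite S" "S \<subseteq> {1..d}" "S \<noteq> {}" "card S \<le> s" "card S \<le> d" "finite L" "finite U"
  "card L + card U \<le> s"
proof -
  have LU': "L \<subseteq> {1..d}" "U \<subseteq> {1..d}" "0 < card L + card U" "card L + card U \<le> s"
    using LU by (auto simp: index_pairs_def)
  then show f: "finite L" "finite U" by (auto intro: finite_subset)
  show "finite S" "S \<subseteq> {1..d}" using LU' f by (auto simp: S_def)
  show "S \<noteq> {}" using LU' by (auto simp: S_def)
  show "card S \<le> s" using card_Un_le[of L U] LU' by (simp add: S_def)
  show "card S \<le> d" using card_mono[of "{1..d}" S] LU' by (simp add: S_def)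
  show "card L + card U \<le> s" by fact
qed

text \<open>For j in both L and U the two conditions form one interval indicator of the single
  variable x j. The basis function becomes a product over \<open>S = L \<union> U\<close>, so
  multilevels have card S coordinates, at most min s d, even if card L + card U is larger.
  Components of t outside L or U are unspecified and masked by the two flags.\<close>

definition ind :: "(nat \<Rightarrow> real) \<times> (nat \<Rightarrow> real) \<Rightarrow> nat \<Rightarrow> real \<Rightarrow> real" where
  "ind t j = interval_indicator (j \<in> L) (fst t j / M j + 1/2) (j \<in> U) (snd t j / M j + 1/2)"

lemma ind_01: "ind t j y = 0 \<or> ind t j y = 1"
  by (simp add: ind_def interval_indicator_def of_bool_def)

lemma ind_bounds: "0 \<le> ind t j y" "ind t j y \<le> 1" "\<bar>ind t j y\<bar> \<le> 1"
  using ind_01[of t j y] by auto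

lemma basis_fun_eq: "basis_fun L U l u x = (\<Prod>j\<in>S. ind (l, u) j (nc j x))"
proof -
  have M0: "M j > 0" if "j \<in> S" for j using M S_facts(2) that by auto
  have 1: "l j \<le> x j \<longleftrightarrow> l j / M j + 1/2 \<le> nc j x" "x j < u j \<longleftrightarrow> nc j x < u j / M j + 1/2" if "j \<in> S" for j
    using M0[OF that] by (auto simp: nc_def divide_le_cancel divide_less_cancel)
  have "basis_fun L U l u x = of_bool ((\<forall>j\<in>L. l j \<le> x j) \<and> (\<forall>j\<in>U. x j < u j))"
    using S_facts by (simp add: basis_fun_def prod_of_bool_eq)
  also have "\<dots> = of_bool (\<forall>j\<in>S. (j \<in> L \<longrightarrow> l j / M j + 1/2 \<le> nc j x) \<and> (j \<in> U \<longrightarrow> nc j x < u j / M j + 1/2))"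
    using 1 by (auto simp: S_def)
  also have "\<dots> = (\<Prod>j\<in>S. ind (l, u) j (nc j x))"
    using S_facts(1) by (simp add: prod_of_bool_eq ind_def interval_indicator_def)
  finally show ?thesis .
qed

lemma threshold_measurable:
  "j \<in> L \<Longrightarrow> (\<lambda>t. fst t j) \<in> borel_measurable (threshold_space L U)"
  "j \<in> U \<Longrightarrow> (\<lambda>t. snd t j) \<in> borel_measurable (threshold_space L U)"
  unfolding threshold_space_def
  by (auto intro!: measurable_compose[OF measurable_fst] measurable_compose[OF measurable_snd]
      measurable_component_singleton)

lemma ind_measurable: "(\<lambda>t. ind t j y) \<in> borel_measurable (threshold_space L U)"
proof -
  note [measurable] = threshold_measurable
  show ?thesis
    unfolding ind_def interval_indicator_def of_bool_def
    by (cases "j \<in> L"; cases "j \<in> U"; simp; measurable)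
qed

definition inc :: "nat \<Rightarrow> nat \<Rightarrow> nat \<Rightarrow> (nat \<Rightarrow> real) \<times> (nat \<Rightarrow> real) \<Rightarrow> real" where
  "inc j q k t = increment (ind t j) q k"

lemma inc_bound: "\<bar>inc j q k t\<bar> \<le> 1"
  using ind_01[of t j "cell_end q k"] ind_01[of t j "cell_end (q - 1) (k div 2)"]
  by (auto simp: inc_def increment_def)

lemma inc_measurable: "inc j q k \<in> borel_measurable (threshold_space L U)"
  unfolding inc_def increment_def using ind_measurable by simp

lemma sum_abs_inc_le: "(\<Sum>k\<le>2 ^ q. \<bar>inc j q k t\<bar>) \<le> 2"
  unfolding inc_def ind_def by (rule sum_abs_increment_le)

end

section \<open>Integrals against a positive finite measure of thresholds\<close>

locale threshold_measure = threshold_pair +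
  fixes \<rho> :: "((nat \<Rightarrow> real) \<times> (nat \<Rightarrow> real)) measure"
  assumes \<rho>: "finite_measure \<rho>" and sets_\<rho>: "sets \<rho> = sets (threshold_space L U)"
begin

sublocale \<rho>: finite_measure \<rho> by (rule \<rho>)

lemma \<rho>_measurable: "g \<in> borel_measurable (threshold_space L U) \<Longrightarrow> g \<in> borel_measurable \<rho>"
  using measurable_cong_sets[OF sets_\<rho> refl] by auto

lemma \<rho>_integrable:
  fixes g :: "_ \<Rightarrow> real"
  assumes "g \<in> borel_measurable (threshold_space L U)" "\<And>t. \<bar>g t\<bar> \<le> c"
  shows "integrable \<rho> g"
  using assms \<rho>_measurable by (intro \<rho>.integrable_const_bound[where B=c]) auto

definition F where "F x = (\<integral>t. (\<Prod>j\<in>S. ind t j (nc j x)) \<partial>\<rho>)"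

definition FN where "FN N x = (\<integral>t. (\<Prod>j\<in>S. ind t j (cell_end N (dyadic_cell N (nc j x)))) \<partial>\<rho>)"

definition \<theta> where "\<theta> q k = (\<integral>t. (\<Prod>j\<in>S. inc j (q j) (k j) t) \<partial>\<rho>)"

definition mass where "mass = measure \<rho> (space \<rho>)"

lemma mass_nonneg: "mass \<ge> 0" by (simp add: mass_def)

lemma prod_abs_le_1: "(\<And>j. j \<in> S \<Longrightarrow> \<bar>g j :: real\<bar> \<le> 1) \<Longrightarrow> \<bar>\<Prod>j\<in>S. g j\<bar> \<le> 1"
  unfolding abs_prod by (intro prod_le_1) auto

lemma inc_prod_integrable: "integrable \<rho> (\<lambda>t. \<Prod>j\<in>S. inc j (q j) (k j) t)"
  by (rule \<rho>_integrable[where c=1]) (auto intro!: borel_measurable_prod inc_measurable prod_abs_le_1 inc_bound)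

lemma ind_prod_integrable: "integrable \<rho> (\<lambda>t. \<Prod>j\<in>S. ind t j (y j))"
  by (rule \<rho>_integrable[where c=1]) (auto intro!: borel_measurable_prod ind_measurable prod_abs_le_1 ind_bounds)

text \<open>Each coordinate telescopes separately. Distributing the product of these sums produces
  one level per coordinate, and only the thresholds are integrated out, so \<theta> depends on x
  solely through its cell.\<close>

lemma grid_expansion: "FN N x = (\<Sum>q\<in>S \<rightarrow>\<^sub>E {..N}. \<theta> q (cell_of S q x))"
proof -
  have "(\<Prod>j\<in>S. ind t j (cell_end N (dyadic_cell N (nc j x))))
      = (\<Sum>q\<in>S \<rightarrow>\<^sub>E {..N}. \<Prod>j\<in>S. inc j (q j) (cell_of S q x j) t)" for t
  proof -
    have "(\<Prod>j\<in>S. ind t j (cell_end N (dyadic_cell N (nc j x)))) = (\<Prod>j\<in>S. \<Sum>q\<le>N. inc j q (dyadic_cell q (nc j x)) t)"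
      unfolding inc_def sum_increment ..
    also have "\<dots> = (\<Sum>q\<in>S \<rightarrow>\<^sub>E {..N}. \<Prod>j\<in>S. inc j (q j) (dyadic_cell (q j) (nc j x)) t)"
      using S_facts(1) by (rule prod_sum_PiE) simp
    also have "\<dots> = (\<Sum>q\<in>S \<rightarrow>\<^sub>E {..N}. \<Prod>j\<in>S. inc j (q j) (cell_of S q x j) t)"
      by (intro sum.cong prod.cong refl) (simp add: cell_of_def)
    finally show ?thesis .
  qed
  then show ?thesis
    unfolding FN_def \<theta>_def by (simp add: Bochner_Integration.integral_sum inc_prod_integrable)
qed

text \<open>After the sum over cells is moved under the integral, it factorizes over the
  coordinates, and every factor is at most 2 for every threshold pair t.\<close>

lemma sum_abs_\<theta>_le: "(\<Sum>k\<in>cells S q. \<bar>\<theta> q k\<bar>) \<le> 2 ^ card S * mass"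
proof -
  have i: "integrable \<rho> (\<lambda>t. \<Prod>j\<in>S. \<bar>inc j (q j) (k j) t\<bar>)" for k
    using integrable_abs[OF inc_prod_integrable[of q k]] by (simp add: abs_prod)
  have "(\<Sum>k\<in>cells S q. \<bar>\<theta> q k\<bar>) \<le> (\<Sum>k\<in>cells S q. \<integral>t. (\<Prod>j\<in>S. \<bar>inc j (q j) (k j) t\<bar>) \<partial>\<rho>)"
  proof (rule sum_mono)
    fix k
    show "\<bar>\<theta> q k\<bar> \<le> (\<integral>t. (\<Prod>j\<in>S. \<bar>inc j (q j) (k j) t\<bar>) \<partial>\<rho>)"
      using integral_abs_bound[of \<rho> "\<lambda>t. \<Prod>j\<in>S. inc j (q j) (k j) t"] by (simp add: \<theta>_def abs_prod)
  qed
  also have "\<dots> = (\<integral>t. (\<Sum>k\<in>cells S q. \<Prod>j\<in>S. \<bar>inc j (q j) (k j) t\<bar>) \<partial>\<rho>)"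
    using i by (simp add: Bochner_Integration.integral_sum)
  also have "\<dots> = (\<integral>t. (\<Prod>j\<in>S. \<Sum>k\<le>2 ^ q j. \<bar>inc j (q j) k t\<bar>) \<partial>\<rho>)"
    unfolding cells_def by (subst prod_sum_PiE[OF S_facts(1)]) auto
  also have "\<dots> \<le> (\<integral>t. 2 ^ card S \<partial>\<rho>)"
  proof (rule integral_mono)
    have b: "(\<Prod>j\<in>S. \<Sum>k\<le>2 ^ q j. \<bar>inc j (q j) k t\<bar>) \<le> 2 ^ card S" for t
    proof -
      have "(\<Prod>j\<in>S. \<Sum>k\<le>2 ^ q j. \<bar>inc j (q j) k t\<bar>) \<le> (\<Prod>j\<in>S. 2)"
        by (intro prod_mono) (auto intro: sum_nonneg sum_abs_inc_le)
      then show ?thesis by simp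
    qed
    then show "(\<Prod>j\<in>S. \<Sum>k\<le>2 ^ q j. \<bar>inc j (q j) k t\<bar>) \<le> 2 ^ card S" for t .
    show "integrable \<rho> (\<lambda>t. \<Prod>j\<in>S. \<Sum>k\<le>2 ^ q j. \<bar>inc j (q j) k t\<bar>)"
    proof (rule \<rho>_integrable[where c="2 ^ card S"])
      show "\<bar>\<Prod>j\<in>S. \<Sum>k\<le>2 ^ q j. \<bar>inc j (q j) k t\<bar>\<bar> \<le> 2 ^ card S" for t
        using b[of t] by (simp add: abs_of_nonneg prod_nonneg sum_nonneg)
      show "(\<lambda>t. \<Prod>j\<in>S. \<Sum>k\<le>2 ^ q j. \<bar>inc j (q j) k t\<bar>) \<in> borel_measurable (threshold_space L U)"
        by (intro borel_measurable_prod borel_measurable_sum borel_measurable_abs inc_measurable)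
    qed
  qed simp
  also have "\<dots> = 2 ^ card S * mass" by (simp add: mass_def)
  finally show ?thesis .
qed

lemma FN_measurable: "FN N \<in> borel_measurable D"
proof -
  have "(\<lambda>x. \<Sum>q\<in>S \<rightarrow>\<^sub>E {..N}. \<theta> q (cell_of S q x)) \<in> borel_measurable D"
    by (intro borel_measurable_sum cell_function(1) S_facts)
  then show ?thesis by (simp add: grid_expansion[abs_def])
qed

lemma F_measurable: "F \<in> borel_measurable D"
proof -
  have x: "(\<lambda>w. nc j (fst w)) \<in> borel_measurable (D \<Otimes>\<^sub>M threshold_space L U)" if "j \<in> S" for j
    using nc_measurable[of j] S_facts(2) that by (auto intro: measurable_compose[OF measurable_fst])
  have t: "(\<lambda>w. fst (snd w) j) \<in> borel_measurable (D \<Otimes>\<^sub>M threshold_space L U)" if "j \<in> L" for j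
    using measurable_compose[OF measurable_snd threshold_measurable(1)[OF that]] .
  have t': "(\<lambda>w. snd (snd w) j) \<in> borel_measurable (D \<Otimes>\<^sub>M threshold_space L U)" if "j \<in> U" for j
    using measurable_compose[OF measurable_snd threshold_measurable(2)[OF that]] .
  have ind: "(\<lambda>w. ind (snd w) j (nc j (fst w))) \<in> borel_measurable (D \<Otimes>\<^sub>M threshold_space L U)" if "j \<in> S" for j
  proof -
    note [measurable] = x[OF that] t t'
    show ?thesis
      unfolding ind_def interval_indicator_def of_bool_def
      by (cases "j \<in> L"; cases "j \<in> U"; simp; measurable)
  qed
  have "(\<lambda>w. \<Prod>j\<in>S. ind (snd w) j (nc j (fst w))) \<in> borel_measurable (D \<Otimes>\<^sub>M threshold_space L U)"
    by (intro borel_measurable_prod ind)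
  then have "(\<lambda>w. \<Prod>j\<in>S. ind (snd w) j (nc j (fst w))) \<in> borel_measurable (D \<Otimes>\<^sub>M \<rho>)"
    using measurable_cong_sets[OF sets_pair_measure_cong[OF refl sets_\<rho>] refl] by auto
  then have "(\<lambda>x. \<integral>t. (\<Prod>j\<in>S. ind t j (nc j x)) \<partial>\<rho>) \<in> borel_measurable D"
    by (intro \<rho>.borel_measurable_lebesgue_integral) (simp add: case_prod_beta)
  then show ?thesis by (simp add: F_def[abs_def])
qed

lemma F_bounds: "0 \<le> F x" "F x \<le> mass" and FN_bounds: "0 \<le> FN N x" "FN N x \<le> mass"
proof -
  have b: "0 \<le> (\<integral>t. (\<Prod>j\<in>S. ind t j (y j)) \<partial>\<rho>)" "(\<integral>t. (\<Prod>j\<in>S. ind t j (y j)) \<partial>\<rho>) \<le> mass" for y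
  proof -
    show "0 \<le> (\<integral>t. (\<Prod>j\<in>S. ind t j (y j)) \<partial>\<rho>)"
      by (intro integral_nonneg_AE AE_I2 prod_nonneg) (auto simp: ind_bounds)
    have "(\<integral>t. (\<Prod>j\<in>S. ind t j (y j)) \<partial>\<rho>) \<le> (\<integral>t. 1 \<partial>\<rho>)"
      using ind_prod_integrable by (intro integral_mono) (auto intro!: prod_le_1 simp: ind_bounds)
    then show "(\<integral>t. (\<Prod>j\<in>S. ind t j (y j)) \<partial>\<rho>) \<le> mass" by (simp add: mass_def)
  qed
  show "0 \<le> F x" "F x \<le> mass" "0 \<le> FN N x" "FN N x \<le> mass"
    unfolding F_def FN_def by (rule b)+
qed

text \<open>The mass of the thresholds whose coordinate j falls into cell c of level N; T is
  \<open>fst\<close> for lower and \<open>snd\<close> for upper thresholds.\<close>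

definition \<phi> :: "((nat \<Rightarrow> real) \<times> (nat \<Rightarrow> real) \<Rightarrow> nat \<Rightarrow> real) \<Rightarrow> nat \<Rightarrow> nat \<Rightarrow> nat \<Rightarrow> real" where
  "\<phi> T N j c = (\<integral>t. of_bool (\<lceil>2 ^ N * (T t j / M j + 1/2)\<rceil> = int c + 1) \<partial>\<rho>)"

lemma \<phi>_facts:
  assumes T: "(\<lambda>t. T t j) \<in> borel_measurable (threshold_space L U)"
  shows "integrable \<rho> (\<lambda>t. of_bool (\<lceil>2 ^ N * (T t j / M j + 1/2)\<rceil> = int c + 1) :: real)"
    and "\<phi> T N j c \<ge> 0" and "(\<Sum>c\<le>m. \<phi> T N j c) \<le> mass"
proof -
  note [measurable] = T
  have i: "integrable \<rho> (\<lambda>t. of_bool (\<lceil>2 ^ N * (T t j / M j + 1/2)\<rceil> = int c + 1) :: real)" for c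
  proof (rule \<rho>_integrable[where c=1])
    have [measurable]: "(\<lambda>t. \<lceil>2 ^ N * (T t j / M j + 1/2)\<rceil>) \<in> measurable (threshold_space L U) (count_space UNIV)"
      by measurable
    show "(\<lambda>t. of_bool (\<lceil>2 ^ N * (T t j / M j + 1/2)\<rceil> = int c + 1) :: real) \<in> borel_measurable (threshold_space L U)"
      by measurable
  qed simp
  then show "integrable \<rho> (\<lambda>t. of_bool (\<lceil>2 ^ N * (T t j / M j + 1/2)\<rceil> = int c + 1) :: real)" .
  show "\<phi> T N j c \<ge> 0" unfolding \<phi>_def by (intro integral_nonneg_AE) auto
  have "(\<Sum>c\<le>m. \<phi> T N j c) = (\<integral>t. (\<Sum>c\<le>m. of_bool (\<lceil>2 ^ N * (T t j / M j + 1/2)\<rceil> = int c + 1)) \<partial>\<rho>)"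
    unfolding \<phi>_def by (rule Bochner_Integration.integral_sum[symmetric]) (rule i)
  also have "\<dots> \<le> (\<integral>t. 1 \<partial>\<rho>)"
    using i by (intro integral_mono sum_of_bool_unique_le Bochner_Integration.integrable_sum) auto
  finally show "(\<Sum>c\<le>m. \<phi> T N j c) \<le> mass" by (simp add: mass_def)
qed

text \<open>A difference of two products of indicators is at most 1 in absolute value, and nonzero
  only if some factor changes, that is, if a threshold lies in the cell of x in that coordinate.
  Integrating over the thresholds gives the masses \<phi>.\<close>

lemma discretization_pointwise:
  assumes x: "\<forall>j\<in>{1..d}. 0 \<le> nc j x \<and> nc j x \<le> 1"
  shows "\<bar>F x - FN N x\<bar> \<le> (\<Sum>j\<in>L. \<phi> fst N j (dyadic_cell N (nc j x))) + (\<Sum>j\<in>U. \<phi> snd N j (dyadic_cell N (nc j x)))"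
proof -
  define hit where "hit = (\<lambda>(T :: (nat \<Rightarrow> real) \<times> (nat \<Rightarrow> real) \<Rightarrow> nat \<Rightarrow> real) t j. of_bool (\<lceil>2 ^ N * (T t j / M j + 1/2)\<rceil> = int (dyadic_cell N (nc j x)) + 1) :: real)"
  define e where "e = (\<lambda>j. cell_end N (dyadic_cell N (nc j x)))"
  have pt: "\<bar>(\<Prod>j\<in>S. ind t j (nc j x)) - (\<Prod>j\<in>S. ind t j (e j))\<bar> \<le> (\<Sum>j\<in>L. hit fst t j) + (\<Sum>j\<in>U. hit snd t j)" for t
  proof (cases "\<forall>j\<in>S. ind t j (nc j x) = ind t j (e j)")
    case True
    then have "(\<Prod>j\<in>S. ind t j (nc j x)) = (\<Prod>j\<in>S. ind t j (e j))" by (intro prod.cong) auto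
    then show ?thesis by (simp add: hit_def sum_nonneg)
  next
    case False
    then obtain j where j: "j \<in> S" "ind t j (nc j x) \<noteq> ind t j (e j)" by blast
    have "j \<in> {1..d}" using j S_facts by auto
    then have "0 \<le> nc j x" "nc j x \<le> 1" using x by auto
    from indicator_change_in_cell[OF this j(2)[unfolded ind_def e_def]]
    have h: "(j \<in> L \<and> hit fst t j = 1) \<or> (j \<in> U \<and> hit snd t j = 1)" by (auto simp: hit_def)
    have hL: "hit fst t j \<le> (\<Sum>j\<in>L. hit fst t j)" if "j \<in> L"
      by (rule member_le_sum[OF that]) (auto simp: hit_def S_facts)
    have hU: "hit snd t j \<le> (\<Sum>j\<in>U. hit snd t j)" if "j \<in> U"
      by (rule member_le_sum[OF that]) (auto simp: hit_def S_facts)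
    have nn: "0 \<le> (\<Sum>j\<in>L. hit fst t j)" "0 \<le> (\<Sum>j\<in>U. hit snd t j)" by (auto simp: hit_def sum_nonneg)
    have "1 \<le> (\<Sum>j\<in>L. hit fst t j) + (\<Sum>j\<in>U. hit snd t j)"
      using h hL hU nn by force
    moreover have "0 \<le> (\<Prod>j\<in>S. ind t j (y j))" "(\<Prod>j\<in>S. ind t j (y j)) \<le> 1" for y
      by (auto intro!: prod_nonneg prod_le_1 simp: ind_bounds)
    from this[of "\<lambda>j. nc j x"] this[of e]
    have "\<bar>(\<Prod>j\<in>S. ind t j (nc j x)) - (\<Prod>j\<in>S. ind t j (e j))\<bar> \<le> 1" by linarith
    ultimately show ?thesis by linarith
  qed
  have iL: "integrable \<rho> (\<lambda>t. hit fst t j)" if "j \<in> L" for j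
    unfolding hit_def by (rule \<phi>_facts(1)[where T=fst, OF threshold_measurable(1)[OF that]])
  have iU: "integrable \<rho> (\<lambda>t. hit snd t j)" if "j \<in> U" for j
    unfolding hit_def by (rule \<phi>_facts(1)[where T=snd, OF threshold_measurable(2)[OF that]])
  have sL: "integrable \<rho> (\<lambda>t. \<Sum>j\<in>L. hit fst t j)" by (rule Bochner_Integration.integrable_sum[OF iL])
  have sU: "integrable \<rho> (\<lambda>t. \<Sum>j\<in>U. hit snd t j)" by (rule Bochner_Integration.integrable_sum[OF iU])
  have "F x - FN N x = (\<integral>t. (\<Prod>j\<in>S. ind t j (nc j x)) - (\<Prod>j\<in>S. ind t j (e j)) \<partial>\<rho>)"
    unfolding F_def FN_def e_def by (simp add: ind_prod_integrable)
  also have "\<bar>\<dots>\<bar> \<le> (\<integral>t. \<bar>(\<Prod>j\<in>S. ind t j (nc j x)) - (\<Prod>j\<in>S. ind t j (e j))\<bar> \<partial>\<rho>)"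
    by (rule integral_abs_bound)
  also have "\<dots> \<le> (\<integral>t. (\<Sum>j\<in>L. hit fst t j) + (\<Sum>j\<in>U. hit snd t j) \<partial>\<rho>)"
  proof (rule integral_mono)
    show "integrable \<rho> (\<lambda>t. \<bar>(\<Prod>j\<in>S. ind t j (nc j x)) - (\<Prod>j\<in>S. ind t j (e j))\<bar>)"
      by (intro integrable_abs Bochner_Integration.integrable_diff ind_prod_integrable)
    show "integrable \<rho> (\<lambda>t. (\<Sum>j\<in>L. hit fst t j) + (\<Sum>j\<in>U. hit snd t j))"
      by (rule Bochner_Integration.integrable_add[OF sL sU])
  qed (rule pt)
  also have "\<dots> = (\<Sum>j\<in>L. \<phi> fst N j (dyadic_cell N (nc j x))) + (\<Sum>j\<in>U. \<phi> snd N j (dyadic_cell N (nc j x)))"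
  proof -
    have "(\<integral>t. (\<Sum>j\<in>L. hit fst t j) \<partial>\<rho>) = (\<Sum>j\<in>L. \<integral>t. hit fst t j \<partial>\<rho>)"
      by (rule Bochner_Integration.integral_sum[OF iL])
    moreover have "(\<integral>t. (\<Sum>j\<in>U. hit snd t j) \<partial>\<rho>) = (\<Sum>j\<in>U. \<integral>t. hit snd t j \<partial>\<rho>)"
      by (rule Bochner_Integration.integral_sum[OF iU])
    ultimately show ?thesis
      unfolding Bochner_Integration.integral_add[OF sL sU] by (simp only: hit_def \<phi>_def)
  qed
  finally show ?thesis .
qed

text \<open>A cell of level N in one coordinate has probability at most B/2^N, and the masses of the
  cells add up to at most the total mass, so averaging over x needs no regularity of the threshold
  measure.\<close>

lemma average_\<phi>:
  assumes j: "j \<in> {1..d}" and T: "(\<lambda>t. T t j) \<in> borel_measurable (threshold_space L U)"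
  shows "(\<lambda>x. \<phi> T N j (dyadic_cell N (nc j x))) \<in> borel_measurable D"
    and "(\<integral>\<^sup>+x. ennreal (\<phi> T N j (dyadic_cell N (nc j x))) \<partial>D) \<le> ennreal (B / 2 ^ N * mass)"
proof -
  have c: "cell_of {j} (\<lambda>_. N) x j = dyadic_cell N (nc j x)" for x by (simp add: cell_of_def)
  have S: "finite {j}" "{j} \<subseteq> {1..d}" using j by auto
  show "(\<lambda>x. \<phi> T N j (dyadic_cell N (nc j x))) \<in> borel_measurable D"
    using cell_function(1)[OF S, of "\<lambda>k. \<phi> T N j (k j)" "\<lambda>_. N"] by (simp add: c)
  have "(\<Sum>k\<in>cells {j} (\<lambda>_. N). \<phi> T N j (k j)) = (\<Sum>c\<le>2 ^ N. \<phi> T N j c)"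
    using prod_sum_PiE[of "{j}" "\<lambda>_. {..2 ^ N}" "\<lambda>j c. \<phi> T N j c"] by (simp add: cells_def)
  also have "\<dots> \<le> mass" by (rule \<phi>_facts(3)[where T=T, OF T])
  finally have "B * (\<Prod>j\<in>{j}. 1 / 2 ^ N) * (\<Sum>k\<in>cells {j} (\<lambda>_. N). \<phi> T N j (k j)) \<le> B / 2 ^ N * mass"
    using B by (simp add: divide_right_mono)
  then show "(\<integral>\<^sup>+x. ennreal (\<phi> T N j (dyadic_cell N (nc j x))) \<partial>D) \<le> ennreal (B / 2 ^ N * mass)"
    using cell_function(2)[OF S, of "\<lambda>k. \<phi> T N j (k j)" "\<lambda>_. N"] \<phi>_facts(2)[where T=T, OF T]
    by (simp add: c) (meson ennreal_leI order_trans)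
qed

text \<open>The difference is bounded both by the mass and by the pointwise sum of the \<phi>;
  multiplying the bounds gives a squared error of order 2^(-N). Depth N = 2 * q0 is thus required
  for an error of order 2^(-q0).\<close>

lemma discretization_error:
  "(\<integral>\<^sup>+x. ennreal ((F x - FN N x)\<^sup>2) \<partial>D) \<le> ennreal (mass\<^sup>2 * real s * B / 2 ^ N)"
proof -
  have jL: "j \<in> {1..d}" if "j \<in> L" for j using that S_facts(2) by (auto simp: S_def)
  have jU: "j \<in> {1..d}" if "j \<in> U" for j using that S_facts(2) by (auto simp: S_def)
  note aL = average_\<phi>[where T=fst, OF jL threshold_measurable(1)]
  note aU = average_\<phi>[where T=snd, OF jU threshold_measurable(2)]
  note pL = \<phi>_facts(2)[where T=fst, OF threshold_measurable(1)]
  note pU = \<phi>_facts(2)[where T=snd, OF threshold_measurable(2)]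
  define w where "w = (\<lambda>x. (\<Sum>j\<in>L. \<phi> fst N j (dyadic_cell N (nc j x))) + (\<Sum>j\<in>U. \<phi> snd N j (dyadic_cell N (nc j x))))"
  have "AE x in D. (F x - FN N x)\<^sup>2 \<le> mass * w x"
    using cube
  proof eventually_elim
    fix x assume "\<forall>j\<in>{1..d}. 0 \<le> x j / M j + 1/2 \<and> x j / M j + 1/2 \<le> 1"
    then have "\<bar>F x - FN N x\<bar> \<le> w x"
      unfolding w_def by (intro discretization_pointwise) (simp add: nc_def)
    moreover have "\<bar>F x - FN N x\<bar> \<le> mass" using F_bounds[of x] FN_bounds[of N x] by linarith
    ultimately have "\<bar>F x - FN N x\<bar> * \<bar>F x - FN N x\<bar> \<le> mass * w x"
      by (intro mult_mono) auto
    then show "(F x - FN N x)\<^sup>2 \<le> mass * w x" by (simp add: power2_eq_square)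
  qed
  then have "(\<integral>\<^sup>+x. ennreal ((F x - FN N x)\<^sup>2) \<partial>D) \<le> (\<integral>\<^sup>+x. ennreal (mass * w x) \<partial>D)"
    by (intro nn_integral_mono_AE) (auto intro: ennreal_leI)
  also have "\<dots> = (\<integral>\<^sup>+x. ennreal mass * ((\<Sum>j\<in>L. ennreal (\<phi> fst N j (dyadic_cell N (nc j x)))) + (\<Sum>j\<in>U. ennreal (\<phi> snd N j (dyadic_cell N (nc j x))))) \<partial>D)"
    unfolding w_def using pL pU mass_nonneg
    by (intro nn_integral_cong) (simp add: ennreal_mult sum_nonneg sum_ennreal)
  also have "\<dots> = ennreal mass * ((\<Sum>j\<in>L. \<integral>\<^sup>+x. ennreal (\<phi> fst N j (dyadic_cell N (nc j x))) \<partial>D) + (\<Sum>j\<in>U. \<integral>\<^sup>+x. ennreal (\<phi> snd N j (dyadic_cell N (nc j x))) \<partial>D))"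
  proof -
    have mL: "(\<lambda>x. ennreal (\<phi> fst N j (dyadic_cell N (nc j x)))) \<in> borel_measurable D" if "j \<in> L" for j
      using aL(1)[OF that that] by simp
    have mU: "(\<lambda>x. ennreal (\<phi> snd N j (dyadic_cell N (nc j x)))) \<in> borel_measurable D" if "j \<in> U" for j
      using aU(1)[OF that that] by simp
    show ?thesis
      using mL mU by (subst nn_integral_cmult; (subst nn_integral_add)?; (subst nn_integral_sum)?; simp add: nn_integral_sum)
  qed
  also have "\<dots> \<le> ennreal mass * ((\<Sum>j\<in>L. ennreal (B / 2 ^ N * mass)) + (\<Sum>j\<in>U. ennreal (B / 2 ^ N * mass)))"
    using aL(2) aU(2) by (intro mult_left_mono add_mono sum_mono) auto
  also have "\<dots> = ennreal (mass * (real (card L + card U) * (B / 2 ^ N * mass)))"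
    using B mass_nonneg
    by (simp add: ennreal_of_nat_eq_real_of_nat ennreal_mult[symmetric] ennreal_plus[symmetric] field_simps del: ennreal_plus)
  also have "\<dots> \<le> ennreal (mass\<^sup>2 * real s * B / 2 ^ N)"
  proof (rule ennreal_leI)
    have "mass * (real (card L + card U) * (B / 2 ^ N * mass)) \<le> mass * (real s * (B / 2 ^ N * mass))"
      using S_facts(8) B mass_nonneg by (intro mult_left_mono mult_right_mono) (auto simp del: of_nat_add)
    then show "mass * (real (card L + card U) * (B / 2 ^ N * mass)) \<le> mass\<^sup>2 * real s * B / 2 ^ N"
      by (simp add: power2_eq_square mult_ac)
  qed
  finally show ?thesis .
qed

end

text \<open>Asks for one representation with strictly smaller total variation, since the infimum in
  \<open>V_XGB\<close> need not be attained.\<close>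

definition bounded_class :: "nat \<Rightarrow> nat \<Rightarrow> real \<Rightarrow> ((nat \<Rightarrow> real) \<Rightarrow> real) set" where
  "bounded_class d s V = {f. \<exists>c \<nu>. represents d s c \<nu> f \<and>
     (\<Sum>(L, U)\<in>index_pairs d s. tv_norm (threshold_space L U) (\<nu> L U)) < ennreal V}"

text \<open>Rounding toward zero never increases the absolute value, so quantized coefficients keep
  the l1 bound and lie in a lattice ball.\<close>

definition trunc :: "real \<Rightarrow> int" where
  "trunc t = (if t \<ge> 0 then \<lfloor>t\<rfloor> else \<lceil>t\<rceil>)"

lemma trunc_cases:
  "(0 \<le> t \<and> 0 \<le> real_of_int (trunc t) \<and> real_of_int (trunc t) \<le> t \<and> t < real_of_int (trunc t) + 1) \<or>
   (t < 0 \<and> real_of_int (trunc t) \<le> 0 \<and> t \<le> real_of_int (trunc t) \<and> real_of_int (trunc t) - 1 < t)"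
proof (cases "t \<ge> 0")
  case True
  then have "0 \<le> \<lfloor>t\<rfloor>" by simp
  then have "0 \<le> real_of_int \<lfloor>t\<rfloor>" by simp
  then show ?thesis using True floor_correct[of t] by (simp add: trunc_def)
next
  case False
  then have "\<lceil>t\<rceil> \<le> 0" by simp
  then have "real_of_int \<lceil>t\<rceil> \<le> 0" by simp
  then show ?thesis using False ceiling_correct[of t] by (simp add: trunc_def)
qed

lemma trunc_abs_le: "real (nat \<bar>trunc t\<bar>) \<le> \<bar>t\<bar>"
proof -
  have "\<bar>real_of_int (trunc t)\<bar> \<le> \<bar>t\<bar>" using trunc_cases[of t] by linarith
  then show ?thesis by simp
qed

text \<open>Numbers with the same truncation are at most 2 apart, the extreme case being truncation
  0. One factor of the square is bounded by 2 and the other by the sizes of a and b, so a sum of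
  squared errors is controlled by l1 norms and not by the number of terms.\<close>

lemma trunc_eq_sq_le:
  assumes "trunc a = trunc b"
  shows "(a - b)\<^sup>2 \<le> 2 * (\<bar>a\<bar> + \<bar>b\<bar>)"
proof -
  have "\<bar>a - b\<bar> \<le> 2"
    using assms trunc_cases[of a] trunc_cases[of b] by linarith
  then have "\<bar>a - b\<bar> * \<bar>a - b\<bar> \<le> 2 * \<bar>a - b\<bar>" by (rule mult_right_mono) simp
  moreover have "\<bar>a - b\<bar> \<le> \<bar>a\<bar> + \<bar>b\<bar>" by simp
  ultimately show ?thesis by (simp add: power2_eq_square)
qed

context threshold_pair
begin

lemma threshold_measures:
  assumes \<nu>: "signed_measure (threshold_space L U) \<nu>" and fin: "tv_norm (threshold_space L U) \<nu> < \<infinity>"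
  shows "threshold_measure d M D B L U s (pos_variation (threshold_space L U) \<nu>)"
    and "threshold_measure d M D B L U s (neg_variation (threshold_space L U) \<nu>)"
  by (intro threshold_measure.intro threshold_measure_axioms.intro threshold_pair_axioms
      finite_measure_pos_variation[OF \<nu> fin] finite_measure_neg_variation[OF \<nu> fin]
      sets_pos_variation sets_neg_variation)+

text \<open>The results for positive measures are applied to both parts of the Jordan decomposition.
  In the coefficient bound the two masses add up to the variation norm; in the error each mass is
  bounded by V separately, hence the factor 2.\<close>

lemma grid_representation:
  assumes \<nu>: "signed_measure (threshold_space L U) \<nu>" and tv: "tv_norm (threshold_space L U) \<nu> < ennreal V"
    and V: "V > 0" and B0: "0 < real s * B"
  shows "\<exists>\<theta> err. (\<forall>x. signed_integral (threshold_space L U) \<nu> (\<lambda>(l, u). basis_fun L U l u x)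
        = (\<Sum>q\<in>S \<rightarrow>\<^sub>E {..N}. \<theta> q (cell_of S q x)) + err x) \<and>
      (\<forall>q. (\<Sum>k\<in>cells S q. \<bar>\<theta> q k\<bar>) \<le> 2 ^ s * V) \<and> err \<in> borel_measurable D \<and>
      (\<integral>\<^sup>+x. ennreal ((err x)\<^sup>2) \<partial>D) \<le> ennreal ((2 * V * sqrt (real s * B / 2 ^ N))\<^sup>2)"
    and "(\<lambda>x. signed_integral (threshold_space L U) \<nu> (\<lambda>(l, u). basis_fun L U l u x)) \<in> borel_measurable D"
    and "\<bar>signed_integral (threshold_space L U) \<nu> (\<lambda>(l, u). basis_fun L U l u x)\<bar> \<le> enn2real (tv_norm (threshold_space L U) \<nu>)"
proof -
  let ?T = "threshold_space L U"
  have fin: "tv_norm ?T \<nu> < \<infinity>" using tv by (auto intro: less_trans)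
  interpret p: threshold_measure d M D B L U s "pos_variation ?T \<nu>"
    by (rule threshold_measures(1)[OF \<nu> fin])
  interpret n: threshold_measure d M D B L U s "neg_variation ?T \<nu>"
    by (rule threshold_measures(2)[OF \<nu> fin])
  have mass: "p.mass + n.mass = enn2real (tv_norm ?T \<nu>)"
    using measure_pos_neg_variation_space[OF \<nu> fin] by (simp add: p.mass_def n.mass_def)
  have tvV: "enn2real (tv_norm ?T \<nu>) \<le> V"
    using tv V by (metis enn2real_leI less_imp_le)
  have eq: "signed_integral ?T \<nu> (\<lambda>(l, u). basis_fun L U l u x) = p.F x - n.F x" for x
    by (simp add: signed_integral_def p.F_def n.F_def basis_fun_eq case_prod_beta)
  show "(\<lambda>x. signed_integral ?T \<nu> (\<lambda>(l, u). basis_fun L U l u x)) \<in> borel_measurable D"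
    unfolding eq using p.F_measurable n.F_measurable by simp
  show "\<bar>signed_integral ?T \<nu> (\<lambda>(l, u). basis_fun L U l u x)\<bar> \<le> enn2real (tv_norm ?T \<nu>)"
    unfolding eq mass[symmetric] using p.F_bounds[of x] n.F_bounds[of x] by linarith
  define \<theta> where "\<theta> = (\<lambda>q k. p.\<theta> q k - n.\<theta> q k)"
  define err where "err = (\<lambda>x. (p.F x - p.FN N x) + (n.FN N x - n.F x))"
  define w where "w = V * sqrt (real s * B / 2 ^ N)"
  have "signed_integral ?T \<nu> (\<lambda>(l, u). basis_fun L U l u x) = (\<Sum>q\<in>S \<rightarrow>\<^sub>E {..N}. \<theta> q (cell_of S q x)) + err x" for x
    unfolding eq err_def \<theta>_def by (simp add: sum_subtractf p.grid_expansion n.grid_expansion)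
  moreover have "(\<Sum>k\<in>cells S q. \<bar>\<theta> q k\<bar>) \<le> 2 ^ s * V" for q
  proof -
    have "(\<Sum>k\<in>cells S q. \<bar>\<theta> q k\<bar>) \<le> (\<Sum>k\<in>cells S q. \<bar>p.\<theta> q k\<bar>) + (\<Sum>k\<in>cells S q. \<bar>n.\<theta> q k\<bar>)"
      unfolding \<theta>_def sum.distrib[symmetric] by (intro sum_mono abs_triangle_ineq4)
    also have "\<dots> \<le> 2 ^ card S * p.mass + 2 ^ card S * n.mass"
      by (intro add_mono p.sum_abs_\<theta>_le n.sum_abs_\<theta>_le)
    also have "\<dots> = 2 ^ card S * enn2real (tv_norm ?T \<nu>)" by (simp add: mass[symmetric] distrib_left)
    also have "\<dots> \<le> 2 ^ s * V"
      using tvV V S_facts(4) by (intro mult_mono power_increasing) auto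
    finally show ?thesis .
  qed
  moreover have "err \<in> borel_measurable D"
    unfolding err_def using p.F_measurable p.FN_measurable n.F_measurable n.FN_measurable by simp
  moreover have "(\<integral>\<^sup>+x. ennreal ((err x)\<^sup>2) \<partial>D) \<le> ennreal ((w + w)\<^sup>2)"
    unfolding err_def
  proof (rule nn_integral_sq_add_le)
    have w2: "w\<^sup>2 = V\<^sup>2 * (real s * B / 2 ^ N)" using B0 by (simp add: w_def power_mult_distrib)
    show "w > 0" using V B0 by (simp add: w_def)
    then show "w > 0" .
    have le: "m\<^sup>2 * real s * B / 2 ^ N \<le> w\<^sup>2" if "0 \<le> m" "m \<le> V" for m
    proof -
      have "m\<^sup>2 * (real s * B / 2 ^ N) \<le> V\<^sup>2 * (real s * B / 2 ^ N)"
        using that B0 by (intro mult_right_mono power_mono) auto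
      then show ?thesis unfolding w2 by (simp add: mult.assoc)
    qed
    show "(\<integral>\<^sup>+x. ennreal ((p.F x - p.FN N x)\<^sup>2) \<partial>D) \<le> ennreal (w\<^sup>2)"
      using mass tvV p.mass_nonneg n.mass_nonneg
      by (intro order_trans[OF p.discretization_error] ennreal_leI le) auto
    show "(\<integral>\<^sup>+x. ennreal ((n.FN N x - n.F x)\<^sup>2) \<partial>D) \<le> ennreal (w\<^sup>2)"
      unfolding power2_commute[of "n.FN N _"] using mass tvV p.mass_nonneg n.mass_nonneg
      by (intro order_trans[OF n.discretization_error] ennreal_leI le) auto
  qed (use p.F_measurable p.FN_measurable n.F_measurable n.FN_measurable in auto)
  moreover have "w + w = 2 * V * sqrt (real s * B / 2 ^ N)" by (simp add: w_def)
  ultimately show "\<exists>\<theta> err. (\<forall>x. signed_integral (threshold_space L U) \<nu> (\<lambda>(l, u). basis_fun L U l u x)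
        = (\<Sum>q\<in>S \<rightarrow>\<^sub>E {..N}. \<theta> q (cell_of S q x)) + err x) \<and>
      (\<forall>q. (\<Sum>k\<in>cells S q. \<bar>\<theta> q k\<bar>) \<le> 2 ^ s * V) \<and> err \<in> borel_measurable D \<and>
      (\<integral>\<^sup>+x. ennreal ((err x)\<^sup>2) \<partial>D) \<le> ennreal ((2 * V * sqrt (real s * B / 2 ^ N))\<^sup>2)"
    by (intro exI[of _ \<theta>] exI[of _ err]) simp
qed

end

abbreviation pair_tv :: "measure_family \<Rightarrow> nat set \<times> nat set \<Rightarrow> ennreal" where
  "pair_tv \<nu> p \<equiv> tv_norm (threshold_space (fst p) (snd p)) (\<nu> (fst p) (snd p))"

abbreviation pair_integral :: "measure_family \<Rightarrow> nat set \<times> nat set \<Rightarrow> (nat \<Rightarrow> real) \<Rightarrow> real" where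
  "pair_integral \<nu> p x \<equiv> signed_integral (threshold_space (fst p) (snd p)) (\<nu> (fst p) (snd p))
     (\<lambda>(l, u). basis_fun (fst p) (snd p) l u x)"

abbreviation entropy_bound :: "nat \<Rightarrow> nat \<Rightarrow> nat \<Rightarrow> real" where
  "entropy_bound d s q0 \<equiv> 8 * 2 ^ s * 2 ^ q0 * real (card (index_pairs d s)) * level_const s * (real q0 + 1) ^ (min s d - 1)"

section \<open>Joining all pairs (L, U)\<close>

context grid_design
begin

abbreviation supp :: "nat set \<times> nat set \<Rightarrow> nat set" where
  "supp p \<equiv> fst p \<union> snd p"

lemma threshold_pairI: "p \<in> index_pairs d s \<Longrightarrow> threshold_pair d M D B (fst p) (snd p) s"
  by unfold_locales simp

lemma supp_facts:
  assumes "p \<in> index_pairs d s"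
  shows "finite (supp p)" "supp p \<subseteq> {1..d}" "supp p \<noteq> {}" "card (supp p) \<le> s" "card (supp p) \<le> d"
proof -
  interpret threshold_pair d M D B "fst p" "snd p" s by (rule threshold_pairI[OF assms])
  show "finite (supp p)" "supp p \<subseteq> {1..d}" "supp p \<noteq> {}" "card (supp p) \<le> s" "card (supp p) \<le> d"
    using S_facts unfolding S_def by blast+
qed

lemma bounded_class_pairs:
  assumes "f \<in> bounded_class d s V"
  obtains c \<nu> where "\<And>p. p \<in> index_pairs d s \<Longrightarrow> signed_measure (threshold_space (fst p) (snd p)) (\<nu> (fst p) (snd p))"
    and "\<And>p. p \<in> index_pairs d s \<Longrightarrow> pair_tv \<nu> p < ennreal V"
    and "\<And>x. x \<in> space D \<Longrightarrow> f x = c + (\<Sum>p\<in>index_pairs d s. pair_integral \<nu> p x)"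
    and "(\<Sum>p\<in>index_pairs d s. pair_tv \<nu> p) < ennreal V"
proof -
  obtain c \<nu> where rep: "represents d s c \<nu> f"
    and tv: "(\<Sum>(L, U)\<in>index_pairs d s. tv_norm (threshold_space L U) (\<nu> L U)) < ennreal V"
    using assms unfolding bounded_class_def by blast
  have sp: "space D = space (Rd d)" by (rule sets_eq_imp_space_eq[OF sets_D])
  have tv': "(\<Sum>p\<in>index_pairs d s. pair_tv \<nu> p) < ennreal V"
    using tv by (simp add: case_prod_beta)
  show ?thesis
  proof (rule that[of \<nu> c])
    show "signed_measure (threshold_space (fst p) (snd p)) (\<nu> (fst p) (snd p))" if "p \<in> index_pairs d s" for p
      using bspec[OF conjunct1[OF rep[unfolded represents_def]] that] by (simp add: case_prod_beta)
    show "pair_tv \<nu> p < ennreal V" if "p \<in> index_pairs d s" for p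
      by (rule le_less_trans[OF member_le_sum[OF that, of "\<lambda>p. pair_tv \<nu> p"] tv'])
         (auto simp: finite_index_pairs)
    show "f x = c + (\<Sum>p\<in>index_pairs d s. pair_integral \<nu> p x)" if "x \<in> space D" for x
      using bspec[OF conjunct2[OF rep[unfolded represents_def]], of x] that
      by (simp add: sp xgb_fun_def case_prod_beta)
  qed (rule tv')
qed

text \<open>Basis functions have values 0 and 1, so the integrals together are at most the sum of
  the variation norms and f stays within V of its constant c. As c is arbitrary, only the
  oscillation is bounded.\<close>

lemma bounded_class_facts:
  assumes f: "f \<in> bounded_class d s V" and V: "V > 0" and s: "s \<ge> 1"
  shows "f \<in> borel_measurable D"
    and "\<And>x x'. x \<in> space D \<Longrightarrow> x' \<in> space D \<Longrightarrow> \<bar>f x - f x'\<bar> \<le> 2 * V"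
proof -
  obtain c \<nu> where sm: "\<And>p. p \<in> index_pairs d s \<Longrightarrow> signed_measure (threshold_space (fst p) (snd p)) (\<nu> (fst p) (snd p))"
    and tv: "\<And>p. p \<in> index_pairs d s \<Longrightarrow> pair_tv \<nu> p < ennreal V"
    and eq: "\<And>x. x \<in> space D \<Longrightarrow> f x = c + (\<Sum>p\<in>index_pairs d s. pair_integral \<nu> p x)"
    and tvs: "(\<Sum>p\<in>index_pairs d s. pair_tv \<nu> p) < ennreal V"
    by (rule bounded_class_pairs[OF f], rule that)
  define J where "J = (\<lambda>p x. pair_integral \<nu> p x)"
  have sB: "0 < real s * B" using s B by simp
  have Jm: "J p \<in> borel_measurable D" if p: "p \<in> index_pairs d s" for p
    unfolding J_def using threshold_pair.grid_representation(2)[OF threshold_pairI[OF p] sm[OF p] tv[OF p] V sB] .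
  have Jb: "\<bar>J p x\<bar> \<le> enn2real (pair_tv \<nu> p)" if p: "p \<in> index_pairs d s" for p x
    unfolding J_def using threshold_pair.grid_representation(3)[OF threshold_pairI[OF p] sm[OF p] tv[OF p] V sB] .
  have "(\<lambda>x. c + (\<Sum>p\<in>index_pairs d s. J p x)) \<in> borel_measurable D"
    using Jm by (intro borel_measurable_add borel_measurable_sum borel_measurable_const)
  then show "f \<in> borel_measurable D"
    by (rule measurable_cong[THEN iffD2, rotated]) (simp add: eq J_def)
  have "\<bar>f x - c\<bar> \<le> V" if x: "x \<in> space D" for x
  proof -
    have "\<bar>f x - c\<bar> = \<bar>\<Sum>p\<in>index_pairs d s. J p x\<bar>" by (simp add: eq[OF x] J_def)
    also have "\<dots> \<le> (\<Sum>p\<in>index_pairs d s. enn2real (pair_tv \<nu> p))"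
      by (rule order_trans[OF sum_abs sum_mono[OF Jb]])
    also have "\<dots> = enn2real (\<Sum>p\<in>index_pairs d s. pair_tv \<nu> p)"
    proof -
      have "pair_tv \<nu> p < top" if "p \<in> index_pairs d s" for p
        by (rule less_trans[OF tv[OF that]]) simp
      from enn2real_sum[of "index_pairs d s" "\<lambda>p. pair_tv \<nu> p", OF this] show ?thesis by (simp add: o_def)
    qed
    also have "\<dots> \<le> V" by (rule enn2real_leI) (use tvs V in \<open>simp_all add: less_imp_le\<close>)
    finally show ?thesis .
  qed
  then show "\<bar>f x - f x'\<bar> \<le> 2 * V" if "x \<in> space D" "x' \<in> space D" for x x'
    using \<open>\<And>x. x \<in> space D \<Longrightarrow> \<bar>f x - c\<bar> \<le> V\<close>[OF that(1)] \<open>\<And>x. x \<in> space D \<Longrightarrow> \<bar>f x - c\<bar> \<le> V\<close>[OF that(2)] by linarith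
qed

abbreviation expansion where
  "expansion s V N f c \<theta> err \<equiv> (\<forall>x\<in>space D. f x = c + (\<Sum>p\<in>index_pairs d s.
        (\<Sum>q\<in>supp p \<rightarrow>\<^sub>E {..N}. \<theta> p q (cell_of (supp p) q x)) + err p x)) \<and>
      (\<forall>p\<in>index_pairs d s. (\<forall>q. (\<Sum>k\<in>cells (supp p) q. \<bar>\<theta> p q k\<bar>) \<le> 2 ^ s * V) \<and> err p \<in> borel_measurable D \<and>
        (\<integral>\<^sup>+x. ennreal ((err p x)\<^sup>2) \<partial>D) \<le> ennreal ((2 * V * sqrt (real s * B / 2 ^ N))\<^sup>2))"

text \<open>Every pair is granted the full budget V, which later makes the radius of the net
  proportional to the number of pairs.\<close>

lemma class_expansion:
  assumes f: "f \<in> bounded_class d s V" and V: "V > 0" and s: "s \<ge> 1"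
  shows "\<exists>c \<theta> err. expansion s V N f c \<theta> err"
proof -
  obtain c \<nu> where sm: "\<And>p. p \<in> index_pairs d s \<Longrightarrow> signed_measure (threshold_space (fst p) (snd p)) (\<nu> (fst p) (snd p))"
    and tv: "\<And>p. p \<in> index_pairs d s \<Longrightarrow> pair_tv \<nu> p < ennreal V"
    and eq: "\<And>x. x \<in> space D \<Longrightarrow> f x = c + (\<Sum>p\<in>index_pairs d s. pair_integral \<nu> p x)"
    and tvs: "(\<Sum>p\<in>index_pairs d s. pair_tv \<nu> p) < ennreal V"
    by (rule bounded_class_pairs[OF f], rule that)
  have sB: "0 < real s * B" using s B by simp
  have "\<forall>p\<in>index_pairs d s. \<exists>\<theta>e. (\<forall>x. pair_integral \<nu> p x
        = (\<Sum>q\<in>supp p \<rightarrow>\<^sub>E {..N}. fst \<theta>e q (cell_of (supp p) q x)) + snd \<theta>e x) \<and>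
      (\<forall>q. (\<Sum>k\<in>cells (supp p) q. \<bar>fst \<theta>e q k\<bar>) \<le> 2 ^ s * V) \<and> snd \<theta>e \<in> borel_measurable D \<and>
      (\<integral>\<^sup>+x. ennreal ((snd \<theta>e x)\<^sup>2) \<partial>D) \<le> ennreal ((2 * V * sqrt (real s * B / 2 ^ N))\<^sup>2)"
  proof
    fix p assume p: "p \<in> index_pairs d s"
    interpret tp: threshold_pair d M D B "fst p" "snd p" s by (rule threshold_pairI[OF p])
    show "\<exists>\<theta>e. (\<forall>x. pair_integral \<nu> p x
        = (\<Sum>q\<in>supp p \<rightarrow>\<^sub>E {..N}. fst \<theta>e q (cell_of (supp p) q x)) + snd \<theta>e x) \<and>
      (\<forall>q. (\<Sum>k\<in>cells (supp p) q. \<bar>fst \<theta>e q k\<bar>) \<le> 2 ^ s * V) \<and> snd \<theta>e \<in> borel_measurable D \<and>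
      (\<integral>\<^sup>+x. ennreal ((snd \<theta>e x)\<^sup>2) \<partial>D) \<le> ennreal ((2 * V * sqrt (real s * B / 2 ^ N))\<^sup>2)"
    proof -
      obtain \<theta> err where "(\<forall>x. pair_integral \<nu> p x
          = (\<Sum>q\<in>supp p \<rightarrow>\<^sub>E {..N}. \<theta> q (cell_of (supp p) q x)) + err x) \<and>
        (\<forall>q. (\<Sum>k\<in>cells (supp p) q. \<bar>\<theta> q k\<bar>) \<le> 2 ^ s * V) \<and> err \<in> borel_measurable D \<and>
        (\<integral>\<^sup>+x. ennreal ((err x)\<^sup>2) \<partial>D) \<le> ennreal ((2 * V * sqrt (real s * B / 2 ^ N))\<^sup>2)"
        using tp.grid_representation(1)[OF sm[OF p] tv[OF p] V sB, of N] unfolding tp.S_def by blast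
      then show ?thesis by (intro exI[of _ "(\<theta>, err)"]) (simp only: fst_conv snd_conv simp_thms)
    qed
  qed
  from bchoice[OF this] obtain \<Theta> where \<Theta>: "\<forall>p\<in>index_pairs d s. (\<forall>x. pair_integral \<nu> p x
        = (\<Sum>q\<in>supp p \<rightarrow>\<^sub>E {..N}. fst (\<Theta> p) q (cell_of (supp p) q x)) + snd (\<Theta> p) x) \<and>
      (\<forall>q. (\<Sum>k\<in>cells (supp p) q. \<bar>fst (\<Theta> p) q k\<bar>) \<le> 2 ^ s * V) \<and> snd (\<Theta> p) \<in> borel_measurable D \<and>
      (\<integral>\<^sup>+x. ennreal ((snd (\<Theta> p) x)\<^sup>2) \<partial>D) \<le> ennreal ((2 * V * sqrt (real s * B / 2 ^ N))\<^sup>2)" ..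
  have "f x = c + (\<Sum>p\<in>index_pairs d s. (\<Sum>q\<in>supp p \<rightarrow>\<^sub>E {..N}. fst (\<Theta> p) q (cell_of (supp p) q x)) + snd (\<Theta> p) x)"
    if "x \<in> space D" for x
    unfolding eq[OF that]
    by (rule arg_cong[where f="\<lambda>t. c + t"], rule sum.cong[OF refl]) (use \<Theta> in blast)
  then show ?thesis using \<Theta>
    by (intro exI[of _ c] exI[of _ "\<lambda>p. fst (\<Theta> p)"] exI[of _ "\<lambda>p. snd (\<Theta> p)"]) blast
qed

text \<open>The summand with \<open>sqrt (real s)\<close> is the discretization error of two
  functions, 2 * V * sqrt (s * B) / 2^q0 each. The other is the quantization error: 2 * sqrt B * 2^s
  * V from a single multilevel and 2 * \<open>level_const s\<close> from their summation.\<close>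

definition pair_error :: "nat \<Rightarrow> real \<Rightarrow> nat \<Rightarrow> real" where
  "pair_error s V q0 = V * sqrt B / 2 ^ q0 * (real q0 + 1) ^ (min s d - 1) *
     (4 * sqrt (real s) + 4 * 2 ^ s * level_const s)"

text \<open>A multilevel of total Q has squared norm at most B * 2^(-Q) * 4 * (2^s * V)^2 /
  \<open>level_mass q0 Q\<close>, and by the choice of the mass this is a multiple of 2^(-2 q0 -
  gap/2). Its square root 2^(-q0 - gap/4) is summable over the multilevels. At depth 2 * q0 the
  discretization errors are of the same order 2^(-q0).\<close>

lemma pair_error_bound:
  assumes p: "p \<in> index_pairs d s" and V: "V > 0" and s: "s \<ge> 1"
    and e: "\<And>x. x \<in> space D \<Longrightarrow> h x = (\<Sum>q\<in>supp p \<rightarrow>\<^sub>E {..2 * q0}. \<Phi> q (cell_of (supp p) q x)) + (e1 x - e2 x)"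
    and em: "e1 \<in> borel_measurable D" "e2 \<in> borel_measurable D"
    and eb: "(\<integral>\<^sup>+x. ennreal ((e1 x)\<^sup>2) \<partial>D) \<le> ennreal ((2 * V * sqrt (real s * B / 2 ^ (2 * q0)))\<^sup>2)"
      "(\<integral>\<^sup>+x. ennreal ((e2 x)\<^sup>2) \<partial>D) \<le> ennreal ((2 * V * sqrt (real s * B / 2 ^ (2 * q0)))\<^sup>2)"
    and \<Phi>: "\<And>q. q \<in> supp p \<rightarrow>\<^sub>E {..2 * q0} \<Longrightarrow> (\<Sum>k\<in>cells (supp p) q. (\<Phi> q k)\<^sup>2) \<le>
      4 * (2 ^ s * V)\<^sup>2 / level_mass q0 (\<Sum>j\<in>supp p. q j)"
  shows "(\<lambda>x. (\<Sum>q\<in>supp p \<rightarrow>\<^sub>E {..2 * q0}. \<Phi> q (cell_of (supp p) q x)) + (e1 x - e2 x)) \<in> borel_measurable D"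
    and "(\<integral>\<^sup>+x. ennreal ((h x)\<^sup>2) \<partial>D) \<le> ennreal ((pair_error s V q0)\<^sup>2)"
    and "pair_error s V q0 > 0"
proof -
  note sf = supp_facts[OF p]
  let ?S = "supp p"
  let ?A = "?S \<rightarrow>\<^sub>E {..2 * q0}"
  let ?gap = "\<lambda>q. level_gap q0 (\<Sum>j\<in>?S. q j)"
  define w where "w = (\<lambda>q. sqrt (4 * B) * (2 ^ s * V) * (2 powr (- real q0) * 2 powr (- ?gap q / 4)))"
  define w1 where "w1 = 2 * V * sqrt (real s * B / 2 ^ (2 * q0))"
  have w0: "w q > 0" for q using B V by (simp add: w_def)
  have w10: "w1 > 0" using B V s by (simp add: w1_def)
  have \<Phi>m: "(\<lambda>x. \<Phi> q (cell_of ?S q x)) \<in> borel_measurable D" for q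
    by (rule cell_function(1)[OF sf(1,2)])
  have \<Phi>b: "(\<integral>\<^sup>+x. ennreal ((\<Phi> q (cell_of ?S q x))\<^sup>2) \<partial>D) \<le> ennreal ((w q)\<^sup>2)" if q: "q \<in> ?A" for q
  proof -
    define Q where "Q = (\<Sum>j\<in>?S. q j)"
    have "(\<Prod>j\<in>?S. 1 / 2 ^ q j) = (1 / 2 ^ Q :: real)" by (simp only: prod_dividef power_sum Q_def) simp
    also have "\<dots> = 2 powr (- real Q)" by (simp add: powr_minus_divide powr_realpow)
    finally have P: "(\<Prod>j\<in>?S. 1 / 2 ^ q j) = 2 powr (- real Q)" .
    have "(\<integral>\<^sup>+x. ennreal ((\<Phi> q (cell_of ?S q x))\<^sup>2) \<partial>D) \<le> ennreal (B * (\<Prod>j\<in>?S. 1 / 2 ^ q j) * (\<Sum>k\<in>cells ?S q. (\<Phi> q k)\<^sup>2))"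
      by (rule cell_function(2)[OF sf(1,2), of "\<lambda>k. (\<Phi> q k)\<^sup>2"]) simp
    also have "\<dots> \<le> ennreal ((w q)\<^sup>2)"
    proof (rule ennreal_leI)
      have "B * (\<Prod>j\<in>?S. 1 / 2 ^ q j) * (\<Sum>k\<in>cells ?S q. (\<Phi> q k)\<^sup>2) \<le> B * 2 powr (- real Q) * (4 * (2 ^ s * V)\<^sup>2 / level_mass q0 Q)"
        unfolding P using \<Phi>[OF q] B by (intro mult_left_mono) (auto simp: Q_def)
      also have "\<dots> = 4 * B * (2 ^ s * V)\<^sup>2 * (2 powr (- real Q) / level_mass q0 Q)" by simp
      also have "2 powr (- real Q) / level_mass q0 Q = 2 powr (- 2 * real q0 - level_gap q0 Q / 2)"
        by (simp add: level_mass_def powr_diff[symmetric] algebra_simps)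
      also have "\<dots> = (2 powr (- real q0) * 2 powr (- level_gap q0 Q / 4))\<^sup>2"
        by (simp add: power2_eq_square powr_add[symmetric] algebra_simps)
      also have "4 * B * (2 ^ s * V)\<^sup>2 * (2 powr (- real q0) * 2 powr (- level_gap q0 Q / 4))\<^sup>2 = (w q)\<^sup>2"
        using B by (simp add: w_def Q_def power_mult_distrib)
      finally show "B * (\<Prod>j\<in>?S. 1 / 2 ^ q j) * (\<Sum>k\<in>cells ?S q. (\<Phi> q k)\<^sup>2) \<le> (w q)\<^sup>2" .
    qed
    finally show ?thesis .
  qed
  have fA: "finite ?A" using sf by (intro finite_PiE) auto
  have neA: "?A \<noteq> {}" by (simp add: PiE_eq_empty_iff)
  have sum\<Phi>: "(\<integral>\<^sup>+x. ennreal ((\<Sum>q\<in>?A. \<Phi> q (cell_of ?S q x))\<^sup>2) \<partial>D) \<le> ennreal ((\<Sum>q\<in>?A. w q)\<^sup>2)"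
    by (rule nn_integral_sq_sum_le[OF fA \<Phi>m w0 \<Phi>b])
  have "(\<integral>\<^sup>+x. ennreal ((e1 x + - e2 x)\<^sup>2) \<partial>D) \<le> ennreal ((w1 + w1)\<^sup>2)"
    using em eb w10 by (intro nn_integral_sq_add_le) (auto simp: w1_def)
  then have ee: "(\<integral>\<^sup>+x. ennreal ((e1 x - e2 x)\<^sup>2) \<partial>D) \<le> ennreal ((w1 + w1)\<^sup>2)" by simp
  have sw0: "(\<Sum>q\<in>?A. w q) > 0" using fA neA w0 by (intro sum_pos) auto
  have sm: "(\<lambda>x. \<Sum>q\<in>?A. \<Phi> q (cell_of ?S q x)) \<in> borel_measurable D"
    using \<Phi>m by (intro borel_measurable_sum)
  have dm: "(\<lambda>x. e1 x - e2 x) \<in> borel_measurable D" using em by simp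
  show "(\<lambda>x. (\<Sum>q\<in>?A. \<Phi> q (cell_of ?S q x)) + (e1 x - e2 x)) \<in> borel_measurable D"
    using sm dm by simp
  have "(\<integral>\<^sup>+x. ennreal ((h x)\<^sup>2) \<partial>D) = (\<integral>\<^sup>+x. ennreal (((\<Sum>q\<in>?A. \<Phi> q (cell_of ?S q x)) + (e1 x - e2 x))\<^sup>2) \<partial>D)"
    by (intro nn_integral_cong) (simp only: e)
  also have "\<dots> \<le> ennreal (((\<Sum>q\<in>?A. w q) + (w1 + w1))\<^sup>2)"
    by (rule nn_integral_sq_add_le[OF sm dm sw0 _ sum\<Phi> ee]) (use w10 in simp)
  also have "\<dots> \<le> ennreal ((pair_error s V q0)\<^sup>2)"
  proof (intro ennreal_leI power_mono)
    have q1: "1 \<le> (real q0 + 1) ^ (min s d - 1)" by (rule one_le_power) simp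
    have "(\<Sum>q\<in>?A. w q) = sqrt (4 * B) * (2 ^ s * V) * 2 powr (- real q0) * (\<Sum>q\<in>?A. 2 powr (- ?gap q / 4))"
      by (simp add: w_def sum_distrib_left mult.assoc)
    also have "\<dots> \<le> sqrt (4 * B) * (2 ^ s * V) * 2 powr (- real q0) * (\<Sum>q\<in>?A. (?gap q + 1) * 2 powr (- ?gap q / 4))"
      using B V by (intro mult_left_mono sum_mono) (auto simp: level_gap_def)
    also have "\<dots> \<le> sqrt (4 * B) * (2 ^ s * V) * 2 powr (- real q0) * (2 * level_const s * (real q0 + 1) ^ (card ?S - 1))"
      using B V by (intro mult_left_mono sum_multilevels sf) auto
    also have "\<dots> \<le> sqrt (4 * B) * (2 ^ s * V) * 2 powr (- real q0) * (2 * level_const s * (real q0 + 1) ^ (min s d - 1))"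
      using B V sf(4,5) level_const_ge_1[of s] by (intro mult_left_mono power_increasing) auto
    finally have 1: "(\<Sum>q\<in>?A. w q) \<le> V * sqrt B / 2 ^ q0 * (real q0 + 1) ^ (min s d - 1) * (4 * 2 ^ s * level_const s)"
      by (simp add: real_sqrt_mult powr_minus_divide powr_realpow mult_ac)
    have "w1 = 2 * V * sqrt B / 2 ^ q0 * sqrt (real s)"
    proof -
      have "(2::real) ^ (2 * q0) = (2 ^ q0)\<^sup>2" by (simp add: power_mult[symmetric] mult.commute)
      then have "sqrt (2 ^ (2 * q0)) = (2::real) ^ q0" by simp
      then show ?thesis by (simp add: w1_def real_sqrt_divide real_sqrt_mult)
    qed
    also have "\<dots> \<le> 2 * V * sqrt B / 2 ^ q0 * sqrt (real s) * (real q0 + 1) ^ (min s d - 1)"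
    proof -
      have "0 \<le> 2 * V * sqrt B / 2 ^ q0 * sqrt (real s)" using B V by simp
      from mult_left_mono[OF q1 this] show ?thesis by (simp only: mult_1_right)
    qed
    finally have w1le: "w1 \<le> 2 * V * sqrt B / 2 ^ q0 * sqrt (real s) * (real q0 + 1) ^ (min s d - 1)" .
    have 2: "w1 + w1 \<le> V * sqrt B / 2 ^ q0 * (real q0 + 1) ^ (min s d - 1) * (4 * sqrt (real s))"
    proof -
      have "V * sqrt B / 2 ^ q0 * (real q0 + 1) ^ (min s d - 1) * (4 * sqrt (real s))
          = 2 * (2 * V * sqrt B / 2 ^ q0 * sqrt (real s) * (real q0 + 1) ^ (min s d - 1))" by simp
      then show ?thesis using w1le by linarith
    qed
    show "(\<Sum>q\<in>?A. w q) + (w1 + w1) \<le> pair_error s V q0"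
      using add_mono[OF 1 2] by (simp add: pair_error_def distrib_left add.commute)
    show "0 \<le> (\<Sum>q\<in>?A. w q) + (w1 + w1)" using sw0 w10 by simp
  qed
  finally show "(\<integral>\<^sup>+x. ennreal ((h x)\<^sup>2) \<partial>D) \<le> ennreal ((pair_error s V q0)\<^sup>2)" .
  have "0 < 4 * sqrt (real s) + 4 * 2 ^ s * level_const s"
    using s level_const_ge_1[of s] by (intro add_pos_pos mult_pos_pos) auto
  then show "pair_error s V q0 > 0" using B V by (simp add: pair_error_def)
qed

text \<open>The code of a function is the family of its truncated coefficients, over all pairs,
  multilevels and cells. The additive constants are not coded: functions with equal codes are close
  up to a constant c, which suffices because the mean is estimated separately.\<close>

lemma finite_cover:
  assumes V: "V > 0" and s: "s \<ge> 1"
  shows "\<exists>Z (code :: ((nat \<Rightarrow> real) \<Rightarrow> real) \<Rightarrow> (nat set \<times> nat set) \<times> (nat \<Rightarrow> nat) \<Rightarrow> (nat \<Rightarrow> nat) \<Rightarrow> int). finite Z \<and>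
    real (card Z) \<le> exp (entropy_bound d s q0) \<and>
    (\<forall>f\<in>bounded_class d s V. code f \<in> Z) \<and>
    (\<forall>f\<in>bounded_class d s V. \<forall>g\<in>bounded_class d s V. code f = code g \<longrightarrow>
      (\<exists>c. (\<integral>\<^sup>+x. ennreal ((f x - g x - c)\<^sup>2) \<partial>D) \<le> ennreal ((real (card (index_pairs d s)) * pair_error s V q0)\<^sup>2)))"
proof -
  let ?P = "index_pairs d s"
  let ?A = "\<lambda>p. supp p \<rightarrow>\<^sub>E {..2 * q0}"
  let ?R = "2 ^ s * V"
  have "\<forall>f\<in>bounded_class d s V. \<exists>cte. expansion s V (2 * q0) f (fst cte) (fst (snd cte)) (snd (snd cte))"
  proof
    fix f assume "f \<in> bounded_class d s V"
    from class_expansion[OF this V s, of "2 * q0"]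
    obtain c \<theta> err where "expansion s V (2 * q0) f c \<theta> err" by blast
    then show "\<exists>cte. expansion s V (2 * q0) f (fst cte) (fst (snd cte)) (snd (snd cte))"
      by (intro exI[of _ "(c, \<theta>, err)"]) simp
  qed
  from bchoice[OF this] obtain X where X: "\<forall>f\<in>bounded_class d s V.
      expansion s V (2 * q0) f (fst (X f)) (fst (snd (X f))) (snd (snd (X f)))" ..
  define C where "C = (\<lambda>f. fst (X f))"
  define \<theta> where "\<theta> = (\<lambda>f. fst (snd (X f)))"
  define err where "err = (\<lambda>f. snd (snd (X f)))"
  have ex: "f x = C f + (\<Sum>p\<in>?P. (\<Sum>q\<in>?A p. \<theta> f p q (cell_of (supp p) q x)) + err f p x)"
    if "f \<in> bounded_class d s V" "x \<in> space D" for f x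
    using X that by (simp add: C_def \<theta>_def err_def)
  have th: "(\<Sum>k\<in>cells (supp p) q. \<bar>\<theta> f p q k\<bar>) \<le> ?R" if "f \<in> bounded_class d s V" "p \<in> ?P" for f p q
    using X that by (simp add: \<theta>_def)
  have er: "err f p \<in> borel_measurable D"
      "(\<integral>\<^sup>+x. ennreal ((err f p x)\<^sup>2) \<partial>D) \<le> ennreal ((2 * V * sqrt (real s * B / 2 ^ (2 * q0)))\<^sup>2)"
    if "f \<in> bounded_class d s V" "p \<in> ?P" for f p
    using X that by (simp_all add: err_def)
  define m where "m = (\<lambda>p q. level_mass q0 (\<Sum>j\<in>supp p. q j))"
  have m0: "m p q > 0" for p q by (simp add: m_def level_mass_def)
  have R0: "?R > 0" using V by simp
  \<comment> \<open>With this step the rescaled coefficients have l1 norm at most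
    \<open>m p q\<close>, so their truncations lie in the lattice ball of that radius.\<close>
  define \<delta> where "\<delta> = (\<lambda>p q. ?R / m p q)"
  have \<delta>0: "\<delta> p q > 0" for p q using R0 m0 by (simp add: \<delta>_def)
  define I where "I = Sigma ?P ?A"
  have fI: "finite I" unfolding I_def
    using finite_index_pairs supp_facts by (intro finite_SigmaI finite_PiE) auto
  define code where "code = (\<lambda>f. \<lambda>i\<in>I. \<lambda>k\<in>cells (supp (fst i)) (snd i). trunc (\<theta> f (fst i) (snd i) k / \<delta> (fst i) (snd i)))"
  define Zi where "Zi = (\<lambda>i. lattice_ball (cells (supp (fst i)) (snd i)) (nat \<lfloor>m (fst i) (snd i)\<rfloor>))"
  define Z where "Z = Pi\<^sub>E I Zi"
  have fcells: "finite (cells (supp p) q)" if "p \<in> ?P" for p q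
    by (rule finite_cells[OF supp_facts(1)[OF that]])
  have fZi: "finite (Zi i)" if "i \<in> I" for i
    using card_lattice_ball[OF fcells, of "fst i" "1/2"] that by (auto simp: Zi_def I_def)
  have "finite Z" unfolding Z_def using fI fZi by (rule finite_PiE)
  moreover have "code f \<in> Z" if f: "f \<in> bounded_class d s V" for f
  proof -
    have "(\<lambda>k\<in>cells (supp p) q. trunc (\<theta> f p q k / \<delta> p q)) \<in> Zi (p, q)" if p: "p \<in> ?P" for p q
    proof -
      have "real (\<Sum>k\<in>cells (supp p) q. nat \<bar>trunc (\<theta> f p q k / \<delta> p q)\<bar>) \<le> (\<Sum>k\<in>cells (supp p) q. \<bar>\<theta> f p q k / \<delta> p q\<bar>)"
        unfolding of_nat_sum by (intro sum_mono trunc_abs_le)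
      also have "\<dots> = (\<Sum>k\<in>cells (supp p) q. \<bar>\<theta> f p q k\<bar>) / \<delta> p q"
        using \<delta>0[of p q] by (simp add: sum_divide_distrib)
      also have "\<dots> \<le> ?R / \<delta> p q" using \<delta>0[of p q] th[OF f p] by (intro divide_right_mono) auto
      also have "\<dots> = m p q" using V m0[of p q] by (simp add: \<delta>_def)
      finally have "(\<Sum>k\<in>cells (supp p) q. nat \<bar>trunc (\<theta> f p q k / \<delta> p q)\<bar>) \<le> nat \<lfloor>m p q\<rfloor>"
        by (rule le_nat_floor)
      moreover have "(\<Sum>k\<in>cells (supp p) q. nat \<bar>(\<lambda>k\<in>cells (supp p) q. trunc (\<theta> f p q k / \<delta> p q)) k\<bar>)
          = (\<Sum>k\<in>cells (supp p) q. nat \<bar>trunc (\<theta> f p q k / \<delta> p q)\<bar>)"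
        by (intro sum.cong refl) simp
      ultimately show ?thesis by (simp add: Zi_def lattice_ball_def)
    qed
    then show ?thesis unfolding code_def Z_def by (auto simp: I_def)
  qed
  moreover have "real (card Z) \<le> exp (entropy_bound d s q0)"
  proof -
    let ?gap = "\<lambda>p q. level_gap q0 (\<Sum>j\<in>supp p. q j)"
    define E where "E = (\<lambda>p q. 2 ^ q0 * 2 ^ s * ((3 * ?gap p q + 4) * 2 powr (- ?gap p q / 2)) :: real)"
    have cZi: "real (card (Zi (p, q))) \<le> exp (E p q)" if p: "p \<in> ?P" for p q
    proof -
      have "card (cells (supp p) q) \<le> 2 ^ ((\<Sum>j\<in>supp p. q j) + card (supp p))"
        by (rule card_cells[OF supp_facts(1)[OF p]])
      also have "\<dots> \<le> 2 ^ ((\<Sum>j\<in>supp p. q j) + s)"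
        using supp_facts(4)[OF p] by (intro power_increasing) auto
      finally show ?thesis
        using card_lattice_ball_level[OF fcells[OF p], of q "\<Sum>j\<in>supp p. q j" s q0] by (simp add: Zi_def m_def E_def)
    qed
    have sumE: "(\<Sum>q\<in>?A p. E p q) \<le> 8 * 2 ^ s * 2 ^ q0 * level_const s * (real q0 + 1) ^ (min s d - 1)" if p: "p \<in> ?P" for p
    proof -
      note sf = supp_facts[OF p]
      have "(\<Sum>q\<in>?A p. E p q) \<le> (\<Sum>q\<in>?A p. 2 ^ q0 * 2 ^ s * (4 * ((?gap p q + 1) * 2 powr (- ?gap p q / 4))))"
      proof (rule sum_mono)
        fix q
        have g: "?gap p q \<ge> 0" by (simp add: level_gap_def)
        \<comment> \<open>Half of the exponential decay is given up to reach the form summed over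
          multilevels. The factor 4 here and the 2 of that summation give the 8 in
          \<open>entropy_bound\<close>.\<close>
        have "(3 * ?gap p q + 4) * 2 powr (- ?gap p q / 2) \<le> 4 * ((?gap p q + 1) * 2 powr (- ?gap p q / 4))"
          unfolding mult.assoc[symmetric] using g by (intro mult_mono powr_mono) auto
        then show "E p q \<le> 2 ^ q0 * 2 ^ s * (4 * ((?gap p q + 1) * 2 powr (- ?gap p q / 4)))"
          unfolding E_def by (rule mult_left_mono) simp
      qed
      also have "\<dots> = 2 ^ q0 * 2 ^ s * 4 * (\<Sum>q\<in>?A p. (?gap p q + 1) * 2 powr (- ?gap p q / 4))"
        by (simp add: sum_distrib_left mult.assoc)
      also have "\<dots> \<le> 2 ^ q0 * 2 ^ s * 4 * (2 * level_const s * (real q0 + 1) ^ (card (supp p) - 1))"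
        by (intro mult_left_mono sum_multilevels sf) auto
      also have "\<dots> \<le> 2 ^ q0 * 2 ^ s * 4 * (2 * level_const s * (real q0 + 1) ^ (min s d - 1))"
        using sf(4,5) level_const_ge_1[of s] by (intro mult_left_mono power_increasing) auto
      finally show ?thesis by (simp add: mult_ac)
    qed
    have "real (card Z) = (\<Prod>i\<in>I. real (card (Zi i)))"
      unfolding Z_def using fI by (simp add: card_PiE)
    also have "\<dots> \<le> (\<Prod>i\<in>I. exp (E (fst i) (snd i)))"
      by (intro prod_mono) (auto simp: I_def intro!: cZi)
    also have "\<dots> = exp (\<Sum>i\<in>I. E (fst i) (snd i))" by (rule exp_sum[OF fI, symmetric])
    also have "(\<Sum>i\<in>I. E (fst i) (snd i)) = (\<Sum>p\<in>?P. \<Sum>q\<in>?A p. E p q)"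
      unfolding I_def using finite_index_pairs supp_facts
      by (subst sum.Sigma) (auto intro!: finite_PiE simp: case_prod_beta)
    also have "exp \<dots> \<le> exp (real (card ?P) * (8 * 2 ^ s * 2 ^ q0 * level_const s * (real q0 + 1) ^ (min s d - 1)))"
      using sumE by (subst exp_le_cancel_iff) (rule sum_bounded_above)
    finally show ?thesis by (simp add: mult_ac)
  qed
  moreover have "\<exists>c. (\<integral>\<^sup>+x. ennreal ((f x - g x - c)\<^sup>2) \<partial>D) \<le> ennreal ((real (card ?P) * pair_error s V q0)\<^sup>2)"
    if f: "f \<in> bounded_class d s V" and g: "g \<in> bounded_class d s V" and eq: "code f = code g" for f g
  proof -
    define \<Phi> where "\<Phi> = (\<lambda>p q k. \<theta> f p q k - \<theta> g p q k)"
    define h where "h = (\<lambda>p x. (\<Sum>q\<in>?A p. \<Phi> p q (cell_of (supp p) q x)) + (err f p x - err g p x))"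
    have \<Phi>b: "(\<Sum>k\<in>cells (supp p) q. (\<Phi> p q k)\<^sup>2) \<le> 4 * ?R\<^sup>2 / level_mass q0 (\<Sum>j\<in>supp p. q j)"
      if p: "p \<in> ?P" and q: "q \<in> ?A p" for p q
    proof -
      have "(\<Phi> p q k)\<^sup>2 \<le> 2 * \<delta> p q * (\<bar>\<theta> f p q k\<bar> + \<bar>\<theta> g p q k\<bar>)" if k: "k \<in> cells (supp p) q" for k
      proof -
        have "(p, q) \<in> I" using p q by (simp add: I_def)
        then have "trunc (\<theta> f p q k / \<delta> p q) = trunc (\<theta> g p q k / \<delta> p q)"
          using fun_cong[OF fun_cong[OF eq, of "(p, q)"], of k] k by (simp add: code_def)
        from trunc_eq_sq_le[OF this]
        have "(\<Phi> p q k / \<delta> p q)\<^sup>2 \<le> 2 * (\<bar>\<theta> f p q k\<bar> + \<bar>\<theta> g p q k\<bar>) / \<delta> p q"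
          using \<delta>0[of p q] by (simp add: \<Phi>_def diff_divide_distrib add_divide_distrib)
        then have "(\<delta> p q)\<^sup>2 * (\<Phi> p q k / \<delta> p q)\<^sup>2 \<le> (\<delta> p q)\<^sup>2 * (2 * (\<bar>\<theta> f p q k\<bar> + \<bar>\<theta> g p q k\<bar>) / \<delta> p q)"
          by (intro mult_left_mono) auto
        moreover have "(\<delta> p q)\<^sup>2 * (\<Phi> p q k / \<delta> p q)\<^sup>2 = (\<Phi> p q k)\<^sup>2"
          using \<delta>0[of p q] by (simp add: power_divide)
        moreover have "(\<delta> p q)\<^sup>2 * (2 * (\<bar>\<theta> f p q k\<bar> + \<bar>\<theta> g p q k\<bar>) / \<delta> p q) = 2 * \<delta> p q * (\<bar>\<theta> f p q k\<bar> + \<bar>\<theta> g p q k\<bar>)"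
          using \<delta>0[of p q] by (simp add: power2_eq_square)
        ultimately show ?thesis by (simp only:)
      qed
      then have "(\<Sum>k\<in>cells (supp p) q. (\<Phi> p q k)\<^sup>2) \<le> (\<Sum>k\<in>cells (supp p) q. 2 * \<delta> p q * (\<bar>\<theta> f p q k\<bar> + \<bar>\<theta> g p q k\<bar>))"
        by (rule sum_mono)
      also have "\<dots> = 2 * \<delta> p q * ((\<Sum>k\<in>cells (supp p) q. \<bar>\<theta> f p q k\<bar>) + (\<Sum>k\<in>cells (supp p) q. \<bar>\<theta> g p q k\<bar>))"
        by (simp add: sum_distrib_left sum.distrib distrib_left)
      also have "\<dots> \<le> 2 * \<delta> p q * (?R + ?R)"
        using \<delta>0[of p q] th[OF f p] th[OF g p] by (intro mult_left_mono add_mono) auto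
      also have "\<dots> = 4 * ?R\<^sup>2 / level_mass q0 (\<Sum>j\<in>supp p. q j)"
        by (simp add: \<delta>_def m_def power2_eq_square)
      finally show ?thesis .
    qed
    note pe = pair_error_bound[OF _ V s refl er(1)[OF f] er(1)[OF g] er(2)[OF f] er(2)[OF g] \<Phi>b]
    have hm: "h p \<in> borel_measurable D" if "p \<in> ?P" for p
      unfolding h_def by (rule pe(1)[OF that that that that that that])
    have hb: "(\<integral>\<^sup>+x. ennreal ((h p x)\<^sup>2) \<partial>D) \<le> ennreal ((pair_error s V q0)\<^sup>2)" if "p \<in> ?P" for p
      unfolding h_def by (rule pe(2)[OF that that that that that that])
    have h0: "pair_error s V q0 > 0" if "p \<in> ?P" for p
      by (rule pe(3)[OF that that that that that that])
    have "(\<integral>\<^sup>+x. ennreal ((f x - g x - (C f - C g))\<^sup>2) \<partial>D) = (\<integral>\<^sup>+x. ennreal ((\<Sum>p\<in>?P. h p x)\<^sup>2) \<partial>D)"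
    proof (rule nn_integral_cong)
      fix x assume x: "x \<in> space D"
      have "f x - g x - (C f - C g) = (\<Sum>p\<in>?P. h p x)"
        unfolding ex[OF f x] ex[OF g x] h_def \<Phi>_def by (simp add: sum_subtractf sum.distrib)
      then show "ennreal ((f x - g x - (C f - C g))\<^sup>2) = ennreal ((\<Sum>p\<in>?P. h p x)\<^sup>2)" by simp
    qed
    also have "\<dots> \<le> ennreal ((\<Sum>p\<in>?P. pair_error s V q0)\<^sup>2)"
      by (rule nn_integral_sq_sum_le[OF finite_index_pairs hm h0 hb])
    finally show ?thesis by auto
  qed
  ultimately show ?thesis by blast
qed

end

section \<open>The regression model\<close>

text \<open>A closed interval is enough because only its length M/2^q is used later. The extra index
  2^q is attained only at y = M/2, the left end of its interval.\<close>

lemma dyadic_cell_interval: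
  assumes M: "M > 0" and y: "- M / 2 \<le> y" "y \<le> M / 2" and k: "dyadic_cell q (y / M + 1/2) = k"
  shows "y \<in> {M * (real k / 2 ^ q - 1/2) .. M * ((real k + 1) / 2 ^ q - 1/2)}"
proof -
  define z where "z = y / M + 1/2"
  have z: "0 \<le> z" "z \<le> 1" using M y by (auto simp: z_def field_simps)
  have yz: "y = M * (z - 1/2)" using M by (simp add: z_def)
  have "2 ^ q * z \<le> 2 ^ q * 1" using z by (intro mult_left_mono) auto
  then have "\<lfloor>2 ^ q * z\<rfloor> \<le> \<lfloor>(2::real) ^ q\<rfloor>" by (intro floor_mono) simp
  then have 1: "\<lfloor>2 ^ q * z\<rfloor> \<le> 2 ^ q" by (metis floor_of_int of_int_numeral of_int_power)
  have "\<lfloor>2 ^ q * z\<rfloor> \<ge> 0" using z by simp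
  moreover have "k = nat \<lfloor>2 ^ q * z\<rfloor>" using k 1 by (simp add: z_def[symmetric] dyadic_cell_def nat_le_iff min_absorb2)
  ultimately have "int k = \<lfloor>2 ^ q * z\<rfloor>" by (simp only: int_nat_eq if_True)
  then have "real k \<le> 2 ^ q * z" "2 ^ q * z \<le> real k + 1"
    by (metis of_int_floor_le of_int_of_nat_eq, metis floor_correct less_imp_le of_int_of_nat_eq of_int_add of_int_1)
  then have "real k / 2 ^ q \<le> z" "z \<le> (real k + 1) / 2 ^ q" by (simp_all add: field_simps)
  then have "M * (real k / 2 ^ q - 1/2) \<le> y" "y \<le> M * ((real k + 1) / 2 ^ q - 1/2)"
    unfolding yz using M by (intro mult_left_mono; simp)+
  then show ?thesis by simp
qed

lemma design_law_grid:
  assumes p0m: "p0 \<in> borel_measurable (Rd d)"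
    and p0: "\<forall>x\<in>space (Rd d). p0 x \<ge> 0"
    and prob: "prob_space (design_law d p0)"
    and M: "\<forall>j\<in>{1..d}. M j > 0"
    and supp: "\<forall>x\<in>space (Rd d). x \<notin> (\<Pi>\<^sub>E j\<in>{1..d}. {- M j / 2 .. M j / 2}) \<longrightarrow> p0 x = 0"
    and bdd: "bdd_above (p0 ` space (Rd d))"
    and B: "B = (\<Prod>j=1..d. M j) * (SUP x\<in>space (Rd d). p0 x)"
  shows "grid_design d M (design_law d p0) B"
proof -
  let ?D = "design_law d p0"
  define b where "b = (SUP x\<in>space (Rd d). p0 x)"
  interpret D: prob_space ?D by (rule prob)
  have sets: "sets ?D = sets (Rd d)" by (simp add: design_law_def)
  have sp: "space ?D = space (Rd d)" by (simp add: design_law_def)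
  have spR: "space (Rd d) = ({1..d} \<rightarrow>\<^sub>E UNIV)" by (simp add: Rd_def space_PiM)
  have ub: "p0 x \<le> b" if "x \<in> space (Rd d)" for x
    unfolding b_def using that bdd by (rule cSUP_upper)
  obtain x0 where x0: "x0 \<in> space (Rd d)" using D.not_empty sp by auto
  have b0: "b \<ge> 0" using ub[OF x0] p0 x0 by fastforce
  have pm: "(\<lambda>x. ennreal (p0 x)) \<in> borel_measurable (Rd d)" using p0m by simp
  interpret P: product_sigma_finite "\<lambda>_::nat. lborel :: real measure" ..
  have comp: "(\<lambda>x. x j) \<in> borel_measurable (Rd d)" if "j \<in> {1..d}" for j
    unfolding Rd_def using measurable_component_singleton[OF that, of "\<lambda>_. lborel"] by simp
  have cell: "measure ?D {x\<in>space ?D. \<forall>j\<in>S. dyadic_cell (q j) (x j / M j + 1/2) = k j} \<le> B * (\<Prod>j\<in>S. 1 / 2 ^ q j)"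
    if S: "S \<subseteq> {1..d}" for S q k
  proof -
    define A where "A = {x\<in>space ?D. \<forall>j\<in>S. dyadic_cell (q j) (x j / M j + 1/2) = k j}"
    have fS: "finite S" using S by (rule finite_subset) simp
    have "A \<in> sets ?D" unfolding A_def
    proof (rule sets.sets_Collect_finite_All[OF _ fS])
      fix j assume "j \<in> S"
      then have c: "(\<lambda>x. x j / M j + 1/2) \<in> borel_measurable (Rd d)" using comp S by auto
      have "(\<lambda>z::real. \<lfloor>2 ^ q j * z\<rfloor>) \<in> measurable borel (count_space UNIV)" by measurable
      then have "dyadic_cell (q j) \<in> measurable borel (count_space UNIV)"
        unfolding dyadic_cell_def by (rule measurable_compose) simp
      from measurable_sets[OF measurable_compose[OF c this], of "{k j}"]
      show "{x\<in>space ?D. dyadic_cell (q j) (x j / M j + 1/2) = k j} \<in> sets ?D"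
        by (simp add: sets sp vimage_def Int_def conj_commute)
    qed
    then have AR: "A \<in> sets (Rd d)" by (simp add: sets)
    \<comment> \<open>Where p0 is positive, the cell lies in a box with sides
      \<open>M j / 2 ^ q j\<close> for j in S and \<open>M j\<close> otherwise. Its volume times the
      supremum of p0 is B times the product of the factors 2^(-q j).\<close>
    define J where "J = (\<lambda>j. if j \<in> S then {M j * (real (k j) / 2 ^ q j - 1/2) .. M j * ((real (k j) + 1) / 2 ^ q j - 1/2)} else {- M j / 2 .. M j / 2})"
    have "PiE {1..d} J \<in> sets (Rd d)"
      unfolding Rd_def by (intro sets_PiM_I_finite) (auto simp: J_def)
    have le: "ennreal (p0 x) * indicator A x \<le> ennreal b * indicator (PiE {1..d} J) x" if x: "x \<in> space (Rd d)" for x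
    proof (cases "x \<in> A \<and> p0 x \<noteq> 0")
      case True
      then have c: "x \<in> (\<Pi>\<^sub>E j\<in>{1..d}. {- M j / 2 .. M j / 2})" using supp x by blast
      have "x j \<in> J j" if j: "j \<in> {1..d}" for j
      proof -
        have y: "- M j / 2 \<le> x j" "x j \<le> M j / 2" using PiE_mem[OF c j] by auto
        then show ?thesis
          using dyadic_cell_interval[OF bspec[OF M j] y, of "q j" "k j"] True by (simp add: J_def A_def)
      qed
      then have "x \<in> PiE {1..d} J" using c by (auto simp: PiE_def)
      then show ?thesis using True ub[OF x] by (simp add: ennreal_leI)
    next
      case False
      then show ?thesis by (auto simp: indicator_def)
    qed
    have "emeasure ?D A = (\<integral>\<^sup>+x. ennreal (p0 x) * indicator A x \<partial>Rd d)"
      unfolding design_law_def by (rule emeasure_density[OF pm AR])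
    also have "\<dots> \<le> (\<integral>\<^sup>+x. ennreal b * indicator (PiE {1..d} J) x \<partial>Rd d)"
      by (rule nn_integral_mono) (rule le)
    also have "\<dots> = ennreal b * emeasure (Rd d) (PiE {1..d} J)"
      by (rule nn_integral_cmult_indicator) fact
    also have "emeasure (Rd d) (PiE {1..d} J) = (\<Prod>j\<in>{1..d}. emeasure lborel (J j))"
      unfolding Rd_def by (rule P.emeasure_PiM) (auto simp: J_def)
    also have "\<dots> = (\<Prod>j\<in>{1..d}. ennreal (M j * (if j \<in> S then 1 / 2 ^ q j else 1)))"
    proof (rule prod.cong[OF refl])
      fix j assume j: "j \<in> {1..d}"
      then have Mj: "M j > 0" using M by blast
      have "M j * (real (k j) / 2 ^ q j - 1/2) \<le> M j * ((real (k j) + 1) / 2 ^ q j - 1/2)"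
        using Mj by (intro mult_left_mono diff_right_mono divide_right_mono) auto
      moreover have "M j * ((real (k j) + 1) / 2 ^ q j - 1/2) - M j * (real (k j) / 2 ^ q j - 1/2) = M j * (1 / 2 ^ q j)"
        by (simp add: field_simps)
      ultimately show "emeasure lborel (J j) = ennreal (M j * (if j \<in> S then 1 / 2 ^ q j else 1))"
        using Mj by (simp add: J_def)
    qed
    also have "\<dots> = ennreal (\<Prod>j\<in>{1..d}. M j * (if j \<in> S then 1 / 2 ^ q j else 1))"
      using M by (intro prod_ennreal) (auto intro!: mult_nonneg_nonneg less_imp_le)
    also have "(\<Prod>j\<in>{1..d}. M j * (if j \<in> S then 1 / 2 ^ q j else 1)) = (\<Prod>j\<in>{1..d}. M j) * (\<Prod>j\<in>S. 1 / 2 ^ q j)"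
    proof -
      have "(\<Prod>j\<in>{1..d}. if j \<in> S then 1 / 2 ^ q j else 1 :: real) = (\<Prod>j\<in>{1..d} \<inter> S. 1 / 2 ^ q j)"
        by (simp add: prod.inter_restrict)
      also have "{1..d} \<inter> S = S" using S by auto
      finally show ?thesis by (simp only: prod.distrib)
    qed
    also have "ennreal b * ennreal \<dots> = ennreal (B * (\<Prod>j\<in>S. 1 / 2 ^ q j))"
    proof -
      have "0 \<le> (\<Prod>j\<in>{1..d}. M j) * (\<Prod>j\<in>S. 1 / 2 ^ q j :: real)"
        using M by (intro mult_nonneg_nonneg prod_nonneg) (auto intro: less_imp_le)
      from ennreal_mult[OF b0 this] show ?thesis
        unfolding B b_def[symmetric] by (simp only: mult_ac)
    qed
    finally have "ennreal (measure ?D A) \<le> ennreal (B * (\<Prod>j\<in>S. 1 / 2 ^ q j))"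
      by (simp only: D.emeasure_eq_measure)
    moreover have "0 \<le> B * (\<Prod>j\<in>S. 1 / 2 ^ q j)"
      unfolding B b_def[symmetric] using b0 M by (intro mult_nonneg_nonneg prod_nonneg) (auto intro: less_imp_le)
    ultimately show ?thesis by (simp add: A_def)
  qed
  \<comment> \<open>For empty S the cell is the whole space and the product is 1, so B is at least
    the total probability 1.\<close>
  have B0: "B > 0" using cell[of "{}"] D.prob_space by simp
  have cube: "AE x in ?D. \<forall>j\<in>{1..d}. 0 \<le> x j / M j + 1/2 \<and> x j / M j + 1/2 \<le> 1"
    unfolding design_law_def
  proof (subst AE_density[OF pm], rule AE_I2, rule impI)
    fix x assume x: "x \<in> space (Rd d)" and "0 < ennreal (p0 x)"
    then have c: "x \<in> (\<Pi>\<^sub>E j\<in>{1..d}. {- M j / 2 .. M j / 2})" using supp by fastforce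
    show "\<forall>j\<in>{1..d}. 0 \<le> x j / M j + 1/2 \<and> x j / M j + 1/2 \<le> 1"
    proof
      fix j assume j: "j \<in> {1..d}"
      then have "M j > 0" using M by blast
      moreover have "- M j / 2 \<le> x j" "x j \<le> M j / 2" using PiE_mem[OF c j] by auto
      ultimately show "0 \<le> x j / M j + 1/2 \<and> x j / M j + 1/2 \<le> 1" by (auto simp: field_simps)
    qed
  qed
  show ?thesis
    by (rule grid_design.intro) (use prob sets M cube B0 cell in auto)
qed

text \<open>The tail function is decreasing, so t times the cube root of the tail at t is at most
  the integral over [0, t], and thus at most \<open>norm31\<close>.\<close>

lemma weak_third_moment:
  assumes \<mu>: "prob_space \<mu>" "sets \<mu> = sets borel" and t: "t > 0" and A: "norm31 \<mu> = ennreal A" "A \<ge> 0"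
  shows "measure \<mu> {e. \<bar>e\<bar> > t} \<le> (A / t) ^ 3"
proof -
  interpret prob_space \<mu> by (rule \<mu>)
  define G where "G = (\<lambda>t. measure \<mu> {e. \<bar>e\<bar> > t})"
  have G0: "G t \<ge> 0" for t by (simp add: G_def)
  have anti: "G t \<le> G s" if "s \<le> t" for s t
    unfolding G_def using that \<mu>(2) by (intro finite_measure_mono) auto
  have "ennreal (G t powr (1/3)) * ennreal t = (\<integral>\<^sup>+s. ennreal (G t powr (1/3)) * indicator {0..t} s \<partial>lborel)"
    using t by (subst nn_integral_cmult_indicator) auto
  also have "\<dots> \<le> norm31 \<mu>"
  proof -
    have "norm31 \<mu> = (\<integral>\<^sup>+s. ennreal (G s powr (1/3)) * indicator {0..} s \<partial>lborel)"
      by (simp add: norm31_def G_def)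
    then show ?thesis
      by (simp only:) (intro nn_integral_mono, auto simp: indicator_def intro!: ennreal_leI powr_mono2 anti G0)
  qed
  finally have "ennreal (G t powr (1/3) * t) \<le> ennreal A" using A t by (simp add: ennreal_mult)
  then have "G t powr (1/3) * t \<le> A" using A by simp
  then have "G t powr (1/3) \<le> A / t" using t by (simp add: field_simps)
  then have "(G t powr (1/3)) ^ 3 \<le> (A / t) ^ 3" by (intro power_mono) auto
  moreover have "(G t powr (1/3)) ^ 3 = G t"
  proof (cases "G t = 0")
    case False
    then have "G t > 0" using G0[of t] by simp
    then show ?thesis by (simp add: powr_powr flip: powr_numeral)
  qed simp
  ultimately show ?thesis by (simp add: G_def)
qed

text \<open>A dyadic layer decomposition: if 2^j < |e| and |e| \<le> 2^(j + 1), then e^2 is at most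
  4^(j + 1). The weak third moment bounds the probability of layer j by A^3 * 8^(-j), so the
  expectations form a geometric series of ratio 1/2.\<close>

lemma noise_square_integrable:
  assumes \<mu>: "prob_space \<mu>" "sets \<mu> = sets borel" and fin: "norm31 \<mu> < \<infinity>"
  shows "integrable \<mu> (\<lambda>e. e\<^sup>2)"
proof -
  interpret prob_space \<mu> by (rule \<mu>)
  note [measurable_cong] = \<mu>(2)
  obtain A where A: "norm31 \<mu> = ennreal A" "A \<ge> 0"
    using fin by (metis enn2real_nonneg ennreal_enn2real infinity_ennreal_def)
  have ts: "{e. \<bar>e\<bar> > t} \<in> sets \<mu>" for t :: real unfolding \<mu>(2) by measurable
  have pt: "ennreal (e\<^sup>2) \<le> 1 + (\<Sum>k. ennreal (4 ^ Suc k) * indicator {e. \<bar>e\<bar> > 2 ^ k} e)" for e :: real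
  proof (cases "\<bar>e\<bar> \<le> 1")
    case True
    then have "e\<^sup>2 \<le> 1" by (simp add: abs_square_le_1)
    then have "ennreal (e\<^sup>2) \<le> 1 + 0" by (simp add: ennreal_le_1)
    also have "\<dots> \<le> 1 + (\<Sum>k. ennreal (4 ^ Suc k) * indicator {e. \<bar>e\<bar> > 2 ^ k} e)"
      by (intro add_left_mono) simp
    finally show ?thesis .
  next
    case False
    have "\<exists>k. \<bar>e\<bar> \<le> 2 ^ k"
      using real_arch_pow[of 2 "\<bar>e\<bar>"] by (auto intro: less_imp_le)
    then obtain k where k: "\<bar>e\<bar> \<le> 2 ^ k" "\<And>j. j < k \<Longrightarrow> \<not> \<bar>e\<bar> \<le> 2 ^ j"
      using exists_least_iff[of "\<lambda>k. \<bar>e\<bar> \<le> 2 ^ k"] by blast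
    then obtain j where j: "k = Suc j" using False by (cases k) auto
    have "2 ^ j < \<bar>e\<bar>" using k(2)[of j] j by simp
    have "\<bar>e\<bar>\<^sup>2 \<le> (2 ^ Suc j)\<^sup>2" using k(1) j by (intro power_mono) auto
    also have "(2 ^ Suc j)\<^sup>2 = (4::real) ^ Suc j"
      by (simp only: power_mult[symmetric] mult.commute[of "Suc j" 2]) (simp only: power_mult, simp)
    finally have "ennreal (e\<^sup>2) \<le> ennreal (4 ^ Suc j)" by (simp add: ennreal_leI del: power_Suc)
    also have "\<dots> = (\<Sum>k\<in>{j}. ennreal (4 ^ Suc k) * indicator {e. \<bar>e\<bar> > 2 ^ k} e)"
      using \<open>2 ^ j < \<bar>e\<bar>\<close> by simp
    also have "\<dots> \<le> (\<Sum>k. ennreal (4 ^ Suc k) * indicator {e. \<bar>e\<bar> > 2 ^ k} e)"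
      by (rule sum_le_suminf) auto
    also have "\<dots> \<le> 1 + (\<Sum>k. ennreal (4 ^ Suc k) * indicator {e. \<bar>e\<bar> > 2 ^ k} e)" by simp
    finally show ?thesis .
  qed
  have "(\<integral>\<^sup>+e. ennreal (e\<^sup>2) \<partial>\<mu>) \<le> (\<integral>\<^sup>+e. 1 + (\<Sum>k. ennreal (4 ^ Suc k) * indicator {e. \<bar>e\<bar> > 2 ^ k} e) \<partial>\<mu>)"
    by (rule nn_integral_mono) (rule pt)
  also have "\<dots> = 1 + (\<Sum>k. \<integral>\<^sup>+e. ennreal (4 ^ Suc k) * indicator {e. \<bar>e\<bar> > 2 ^ k} e \<partial>\<mu>)"
    using ts by (subst nn_integral_add; (subst nn_integral_suminf)?) (auto simp: emeasure_space_1 intro!: borel_measurable_suminf borel_measurable_times)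
  also have "(\<Sum>k. \<integral>\<^sup>+e. ennreal (4 ^ Suc k) * indicator {e. \<bar>e\<bar> > 2 ^ k} e \<partial>\<mu>) \<le> (\<Sum>k. ennreal (4 * A ^ 3 * (1/2) ^ k))"
  proof (rule suminf_le)
    fix k :: nat
    have "(\<integral>\<^sup>+e. ennreal (4 ^ Suc k) * indicator {e. \<bar>e\<bar> > 2 ^ k} e \<partial>\<mu>) = ennreal (4 ^ Suc k) * emeasure \<mu> {e. \<bar>e\<bar> > 2 ^ k}"
      by (rule nn_integral_cmult_indicator[OF ts])
    also have "\<dots> = ennreal (4 ^ Suc k * measure \<mu> {e. \<bar>e\<bar> > 2 ^ k})"
      by (simp add: emeasure_eq_measure ennreal_mult)
    also have "\<dots> \<le> ennreal (4 ^ Suc k * (A / 2 ^ k) ^ 3)"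
      by (intro ennreal_leI mult_left_mono weak_third_moment[OF \<mu> _ A]) auto
    also have "4 ^ Suc k * (A / 2 ^ k) ^ 3 = 4 * A ^ 3 * (1/2) ^ k"
    proof -
      have "((2::real) ^ k) ^ 3 = 4 ^ k * 2 ^ k"
        by (simp add: power_mult_distrib[symmetric] power_mult[symmetric] mult.commute[of k 3]) (simp add: power_mult)
      then show ?thesis by (simp add: power_divide)
    qed
    finally show "(\<integral>\<^sup>+e. ennreal (4 ^ Suc k) * indicator {e. \<bar>e\<bar> > 2 ^ k} e \<partial>\<mu>) \<le> ennreal (4 * A ^ 3 * (1/2) ^ k)" .
  qed auto
  also have "(\<Sum>k. ennreal (4 * A ^ 3 * (1/2) ^ k)) = ennreal (\<Sum>k. 4 * A ^ 3 * (1/2) ^ k)"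
    using A by (intro suminf_ennreal2) (auto intro!: summable_mult summable_geometric)
  finally have "(\<integral>\<^sup>+e. ennreal (e\<^sup>2) \<partial>\<mu>) < \<infinity>"
    by (auto simp: ennreal_add_eq_top add_left_mono le_less_trans)
  then show ?thesis by (intro integrableI_bounded) auto
qed

text \<open>Pairs are counted by their sizes a and b, at most d^(a + b) \<le> d^s for each choice.
  If s exceeds d, then d^s is at most s^s; the exponent of d thus drops to min s d at the price of a
  constant depending on s.\<close>

lemma card_index_pairs:
  assumes d: "d \<ge> 1"
  shows "real (card (index_pairs d s)) \<le> (real s + 1)\<^sup>2 * real s ^ s * real d ^ min s d"
proof -
  have sub: "index_pairs d s \<subseteq> (\<Union>a\<le>s. \<Union>b\<le>s - a. {L. L \<subseteq> {1..d} \<and> card L = a} \<times> {U. U \<subseteq> {1..d} \<and> card U = b})"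
    by (auto simp: index_pairs_def)
  have fin: "finite {L. L \<subseteq> {1..d} \<and> card L = a}" for a
    by (rule finite_subset[of _ "Pow {1..d}"]) auto
  have ch: "card {L. L \<subseteq> {1..d} \<and> card L = a} \<le> d ^ a" for a
  proof (cases "a \<le> d")
    case True
    then show ?thesis using n_subsets[of "{1..d}" a] binomial_le_pow[of a d] by simp
  next
    case False
    have "card L \<le> d" if "L \<subseteq> {1..d}" for L using card_mono[OF _ that] by simp
    then have "{L. L \<subseteq> {1..d} \<and> card L = a} = {}" using False by blast
    then show ?thesis by (simp only: card.empty)
  qed
  have "card (index_pairs d s) \<le> card (\<Union>a\<le>s. \<Union>b\<le>s - a. {L. L \<subseteq> {1..d} \<and> card L = a} \<times> {U. U \<subseteq> {1..d} \<and> card U = b})"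
    using fin by (intro card_mono[OF _ sub]) auto
  also have "\<dots> \<le> (\<Sum>a\<le>s. card (\<Union>b\<le>s - a. {L. L \<subseteq> {1..d} \<and> card L = a} \<times> {U. U \<subseteq> {1..d} \<and> card U = b}))"
    by (rule card_UN_le) simp
  also have "\<dots> \<le> (\<Sum>a\<le>s. \<Sum>b\<le>s - a. card ({L. L \<subseteq> {1..d} \<and> card L = a} \<times> {U. U \<subseteq> {1..d} \<and> card U = b}))"
    by (intro sum_mono card_UN_le) simp
  also have "\<dots> \<le> (\<Sum>a\<le>s. \<Sum>b\<le>s - a. d ^ s)"
  proof (intro sum_mono)
    fix a b assume ab: "a \<in> {..s}" "b \<in> {..s - a}"
    have "card ({L. L \<subseteq> {1..d} \<and> card L = a} \<times> {U. U \<subseteq> {1..d} \<and> card U = b}) \<le> d ^ a * d ^ b"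
      unfolding card_cartesian_product by (intro mult_mono ch) auto
    also have "\<dots> = d ^ (a + b)" by (simp add: power_add)
    also have "\<dots> \<le> d ^ s" using ab d by (intro power_increasing) auto
    finally show "card ({L. L \<subseteq> {1..d} \<and> card L = a} \<times> {U. U \<subseteq> {1..d} \<and> card U = b}) \<le> d ^ s" .
  qed
  also have "\<dots> \<le> (\<Sum>a\<le>s. (s + 1) * d ^ s)"
  proof (rule sum_mono)
    fix a
    have "(\<Sum>b\<le>s - a. d ^ s) = (s - a + 1) * d ^ s" by simp
    also have "\<dots> \<le> (s + 1) * d ^ s" by (rule mult_right_mono) simp_all
    finally show "(\<Sum>b\<le>s - a. d ^ s) \<le> (s + 1) * d ^ s" .
  qed
  also have "\<dots> = (s + 1)\<^sup>2 * d ^ s" by (simp add: power2_eq_square algebra_simps)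
  also have "\<dots> \<le> (s + 1)\<^sup>2 * (s ^ s * d ^ min s d)"
  proof (intro mult_left_mono)
    show "d ^ s \<le> s ^ s * d ^ min s d"
    proof (cases "s \<le> d")
      case True
      then show ?thesis by (cases "s = 0") (auto simp: min_def)
    next
      case False
      then have "d ^ s \<le> s ^ s" by (intro power_mono) auto
      also have "\<dots> \<le> s ^ s * d ^ min s d" using d by simp
      finally show ?thesis .
    qed
  qed simp
  finally have "card (index_pairs d s) \<le> (s + 1)\<^sup>2 * (s ^ s * d ^ min s d)" .
  then have "real (card (index_pairs d s)) \<le> real ((s + 1)\<^sup>2 * (s ^ s * d ^ min s d))" by (rule of_nat_mono)
  then show ?thesis by (simp add: mult.assoc add.commute)
qed

section \<open>Choice of the resolution\<close>

text \<open>With h the exponent of the logarithm, 2^q0 is essentially X = (n * (ln n)^h)^(1/3) and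
  q0 + 1 at most a multiple of ln n, for which the squared radius and the entropy over n both become
  \<rho>. The third claim covers the term ln n added to the entropy by the union bound.\<close>

lemma resolution_exists:
  fixes n s h :: nat
  assumes n: "n \<ge> 2" and h: "h < s"
  defines "\<rho> \<equiv> real n powr (- 2 / 3) * ln (real n) powr (4 * real h / 3)"
  shows "\<exists>q0::nat. (1 / 2 ^ q0)\<^sup>2 * ((real q0 + 1) ^ h)\<^sup>2 \<le> (real s + 4) ^ (2 * s) * \<rho> \<and>
    2 ^ q0 * (real q0 + 1) ^ h / real n \<le> 2 * 2 ^ s * (real s + 4) ^ s * \<rho> \<and>
    (ln (real n) + 2) / real n \<le> 15 * 4 ^ s * \<rho>"
proof -
  define l where "l = ln (real n)"
  define X where "X = real n powr (1/3) * l powr (real h / 3)"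
  have n0: "real n \<ge> 2" using n by simp
  have ln2: "ln (2::real) \<ge> 1/2"
  proof -
    have "1 - 1/2 \<le> ln (2::real)" using ln_ge_iff ln_le_minus_one[of "1/2::real"] by (simp add: ln_div)
    then show ?thesis by simp
  qed
  have l: "l \<ge> 1/2" "l > 0"
  proof -
    have "ln 2 \<le> l" unfolding l_def using n0 by simp
    then show "l \<ge> 1/2" using ln2 by linarith
    then show "l > 0" by linarith
  qed
  have X0: "X > 0" using n0 l by (simp add: X_def)
  \<comment> \<open>For n = 2 the logarithm is below 1, so its powers are only bounded below by
    powers of 1/2. This is where the factors 2^s and 4^s in the constants originate.\<close>
  have small: "(1/2) ^ (2 * s) \<le> l powr t" if "0 \<le> t" "t \<le> 2 * real s" for t
  proof -
    have "(1/2::real) ^ (2 * s) = (1/2) powr real (2 * s)" by (rule powr_realpow[symmetric]) simp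
    also have "\<dots> \<le> (1/2) powr t" using that by (intro powr_mono') auto
    also have "\<dots> \<le> l powr t" using l that by (intro powr_mono2) auto
    finally show ?thesis .
  qed
  have small': "(1/2) ^ s \<le> l powr t" if "0 \<le> t" "t \<le> real s" for t
  proof -
    have "(1/2::real) ^ s = (1/2) powr real s" by (rule powr_realpow[symmetric]) simp
    also have "\<dots> \<le> (1/2) powr t" using that by (intro powr_mono') auto
    also have "\<dots> \<le> l powr t" using l that by (intro powr_mono2) auto
    finally show ?thesis .
  qed
  \<comment> \<open>\<open>nat\<close> lifts a negative logarithm to 0, since X may be smaller than
    1 for small n.\<close>
  define q0 where "q0 = nat \<lceil>log 2 X\<rceil>"
  have q_ge: "X \<le> 2 ^ q0"
  proof -
    have "log 2 X \<le> real q0" unfolding q0_def by linarith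
    then have "2 powr (log 2 X) \<le> 2 powr real q0" by (intro powr_mono) auto
    then show ?thesis using X0 by (simp add: powr_realpow)
  qed
  have q_le: "real q0 \<le> max 0 (log 2 X) + 1" unfolding q0_def by linarith
  have p_le: "2 ^ q0 \<le> 2 * 2 ^ s * X"
  proof (cases "log 2 X \<ge> 0")
    case True
    have "(2::real) ^ q0 = 2 powr real q0" by (simp add: powr_realpow)
    also have "\<dots> \<le> 2 powr (log 2 X + 1)" using q_le True by (intro powr_mono) auto
    also have "\<dots> = 2 * X" using X0 by (simp add: powr_add)
    also have "\<dots> \<le> 2 * 2 ^ s * X" using X0 by simp
    finally show ?thesis .
  next
    case False
    then have q: "q0 = 0" by (simp add: q0_def)
    have "1 \<le> real n powr (1/3)" using n0 by (intro ge_one_powr_ge_zero) auto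
    moreover have "(1/2) ^ s \<le> l powr (real h / 3)" using h by (intro small') auto
    ultimately have "1 * (1/2) ^ s \<le> X" unfolding X_def by (intro mult_mono) auto
    then have "2 ^ s * (1/2) ^ s \<le> 2 ^ s * X" by (intro mult_left_mono) auto
    then have "1 \<le> 2 ^ s * X" by (simp add: power_divide)
    then show ?thesis using q by simp
  qed
  have q1: "real q0 + 1 \<le> (real s + 4) * l"
  proof -
    have "ln X = l / 3 + real h / 3 * ln l"
      using n0 l by (simp add: X_def ln_mult ln_powr l_def[symmetric])
    also have "\<dots> \<le> l / 3 + real h / 3 * l"
      using less_imp_le[OF ln_less_self[OF l(2)]] by (intro add_left_mono mult_left_mono) auto
    also have "\<dots> = (real h + 1) * l / 3" by (simp add: field_simps)
    also have "\<dots> \<le> real s * l / 3" using h l by (intro divide_right_mono mult_right_mono) auto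
    finally have lx: "ln X \<le> real s * l / 3" .
    have "log 2 X \<le> real s * l"
    proof (cases "ln X \<le> 0")
      case True
      then have "log 2 X \<le> 0" by (simp add: log_def divide_nonpos_pos)
      also have "0 \<le> real s * l" using l by simp
      finally show ?thesis .
    next
      case False
      then have "log 2 X \<le> ln X / (1/2)" unfolding log_def using ln2 by (intro divide_left_mono) auto
      also have "\<dots> \<le> real s * l" using lx False l by simp
      finally show ?thesis .
    qed
    then have "max 0 (log 2 X) \<le> real s * l" using l by simp
    then have "real q0 + 1 \<le> real s * l + 2" using q_le by linarith
    also have "\<dots> \<le> (real s + 4) * l" using l by (simp add: algebra_simps)
    finally show ?thesis .
  qed
  have s4: "1 \<le> real s + 4" by simp
  have qh: "(real q0 + 1) ^ h \<le> (real s + 4) ^ h * l ^ h"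
    unfolding power_mult_distrib[symmetric] using q1 by (intro power_mono) auto
  have lh: "l ^ h = l powr real h" using l by (simp add: powr_realpow)
  have 1: "(1 / 2 ^ q0)\<^sup>2 * ((real q0 + 1) ^ h)\<^sup>2 \<le> (real s + 4) ^ (2 * s) * \<rho>"
  proof -
    have "(1 / 2 ^ q0)\<^sup>2 * ((real q0 + 1) ^ h)\<^sup>2 \<le> (1 / X)\<^sup>2 * ((real s + 4) ^ h * l ^ h)\<^sup>2"
      using q_ge X0 qh by (intro mult_mono power_mono divide_left_mono) auto
    also have "\<dots> = ((real s + 4) ^ h)\<^sup>2 * ((l ^ h)\<^sup>2 / X\<^sup>2)" by (simp add: power_mult_distrib power_divide)
    also have "(l ^ h)\<^sup>2 / X\<^sup>2 = \<rho>"
    proof -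
      have "(l ^ h)\<^sup>2 = l powr (2 * real h)" unfolding lh using l by (simp add: power2_eq_square powr_add[symmetric])
      moreover have "X\<^sup>2 = real n powr (2/3) * l powr (2 * real h / 3)"
        unfolding X_def power_mult_distrib by (simp add: power2_eq_square powr_add[symmetric])
      moreover have "l powr (2 * real h) / (real n powr (2/3) * l powr (2 * real h / 3))
          = 1 / real n powr (2/3) * (l powr (2 * real h) / l powr (2 * real h / 3))" by simp
      moreover have "1 / real n powr (2/3) = real n powr (- 2 / 3)" by (simp add: powr_minus_divide)
      moreover have "l powr (2 * real h) / l powr (2 * real h / 3) = l powr (4 * real h / 3)"
      proof -
        have "2 * real h - 2 * real h / 3 = 4 * real h / 3" by simp
        then show ?thesis by (simp only: powr_diff[symmetric])
      qed
      ultimately show ?thesis by (simp only: \<rho>_def l_def)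
    qed
    also have "((real s + 4) ^ h)\<^sup>2 * \<rho> \<le> (real s + 4) ^ (2 * s) * \<rho>"
    proof (rule mult_right_mono)
      have "((real s + 4) ^ h)\<^sup>2 = (real s + 4) ^ (2 * h)" by (simp add: power_mult[symmetric] mult.commute)
      also have "\<dots> \<le> (real s + 4) ^ (2 * s)" using h by (intro power_increasing) auto
      finally show "((real s + 4) ^ h)\<^sup>2 \<le> (real s + 4) ^ (2 * s)" .
    qed (simp add: \<rho>_def)
    finally show ?thesis .
  qed
  have 2: "2 ^ q0 * (real q0 + 1) ^ h / real n \<le> 2 * 2 ^ s * (real s + 4) ^ s * \<rho>"
  proof -
    have "2 ^ q0 * (real q0 + 1) ^ h / real n \<le> (2 * 2 ^ s * X) * ((real s + 4) ^ h * l ^ h) / real n"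
      using p_le qh X0 by (intro divide_right_mono mult_mono) auto
    also have "\<dots> = 2 * 2 ^ s * (real s + 4) ^ h * (X * l ^ h / real n)" by simp
    also have "X * l ^ h / real n = \<rho>"
    proof -
      have "X * l ^ h / real n = real n powr (1/3) / real n * (l powr (real h / 3) * l powr real h)"
        unfolding X_def lh by simp
      moreover have "real n powr (1/3) / real n = real n powr (- 2 / 3)"
        using n0 powr_diff[of "real n" "1/3" 1] by simp
      moreover have "l powr (real h / 3) * l powr real h = l powr (4 * real h / 3)"
      proof -
        have "real h / 3 + real h = 4 * real h / 3" by simp
        then show ?thesis by (simp only: powr_add[symmetric])
      qed
      ultimately show ?thesis by (simp only: \<rho>_def l_def)
    qed
    also have "2 * 2 ^ s * (real s + 4) ^ h * \<rho> \<le> 2 * 2 ^ s * (real s + 4) ^ s * \<rho>"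
      using h by (intro mult_right_mono mult_left_mono power_increasing) (auto simp: \<rho>_def)
    finally show ?thesis .
  qed
  have 3: "(l + 2) / real n \<le> 15 * 4 ^ s * \<rho>"
  proof -
    have "ln (real n powr (1/3)) \<le> real n powr (1/3)"
      using n0 ln_less_self[of "real n powr (1/3)"] by simp
    then have "l \<le> 3 * real n powr (1/3)" using n0 by (simp add: ln_powr l_def)
    \<comment> \<open>As l is at least 1/2, the preceding bound l \<le> 3 * n^(1/3) gives n^(1/3)
      \<ge> 1/6, so that 2 \<le> 12 * n^(1/3).\<close>
    then have "l + 2 \<le> 15 * real n powr (1/3)" using l by linarith
    then have "(l + 2) / real n \<le> 15 * real n powr (1/3) / real n" by (rule divide_right_mono) simp
    also have "\<dots> = 15 * real n powr (- 2 / 3)"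
      using n0 powr_diff[of "real n" "1/3" 1] by simp
    also have "\<dots> \<le> 15 * (4 ^ s * \<rho>)"
    proof (rule mult_left_mono)
      have "(1/2) ^ (2 * s) \<le> l powr (4 * real h / 3)" using h by (intro small) auto
      then have "4 ^ s * (1/2) ^ (2 * s) \<le> 4 ^ s * l powr (4 * real h / 3)" by (intro mult_left_mono) auto
      moreover have "(4::real) ^ s * (1/2) ^ (2 * s) = 1" by (simp add: power_mult power_divide power_mult_distrib[symmetric] power2_eq_square)
      ultimately have "1 \<le> 4 ^ s * l powr (4 * real h / 3)" by simp
      then have "real n powr (- 2 / 3) * 1 \<le> real n powr (- 2 / 3) * (4 ^ s * l powr (4 * real h / 3))"
        by (intro mult_left_mono) auto
      then show "real n powr (- 2 / 3) \<le> 4 ^ s * \<rho>" by (simp add: \<rho>_def l_def mult_ac)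
    qed simp
    finally show ?thesis by simp
  qed
  show ?thesis using 1 2 3 by (auto simp: l_def)
qed

section \<open>The minimax bound\<close>

text \<open>Passing from V to V + 1 creates the strict inequality that turns the infimum into an
  actual representation.\<close>

lemma bounded_class_superset:
  assumes f: "f \<in> F_ST d s" and v: "V_XGB d s f \<le> ennreal V" and V: "V > 0"
  shows "f \<in> bounded_class d s (V + 1)"
proof -
  have "V_XGB d s f < ennreal (V + 1)"
    by (rule le_less_trans[OF v]) (use V in \<open>simp add: ennreal_less_iff\<close>)
  then show ?thesis
    unfolding V_XGB_def bounded_class_def by (auto simp: INF_less_iff)
qed

text \<open>One representative is chosen for each code that occurs. Since representatives belong to
  the class, they are measurable with oscillation at most 2 V, and centring them gives the bounded
  mean-zero functions the selection requires.\<close>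

lemma (in grid_design) net_of_class:
  assumes V: "V > 0" and s: "s \<ge> 1" and ne: "bounded_class d s V \<noteq> {}"
  obtains m and g :: "nat \<Rightarrow> (nat \<Rightarrow> real) \<Rightarrow> real" where "m > 0"
    and "real m \<le> exp (entropy_bound d s q0)"
    and "\<And>i. g i \<in> borel_measurable D" "\<And>i x. x \<in> space D \<Longrightarrow> \<bar>g i x\<bar> \<le> 2 * V" "\<And>i. (\<integral>x. g i x \<partial>D) = 0"
    and "\<And>f. f \<in> bounded_class d s V \<Longrightarrow> \<exists>i<m. (\<integral>x. (f x - (\<integral>x. f x \<partial>D) - g i x)\<^sup>2 \<partial>D)
          \<le> (real (card (index_pairs d s)) * pair_error s V q0)\<^sup>2"
proof -
  let ?F = "bounded_class d s V"
  let ?e = "real (card (index_pairs d s)) * pair_error s V q0"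
  obtain Z and code :: "((nat \<Rightarrow> real) \<Rightarrow> real) \<Rightarrow> (nat set \<times> nat set) \<times> (nat \<Rightarrow> nat) \<Rightarrow> (nat \<Rightarrow> nat) \<Rightarrow> int"
    where Z: "finite Z" and cZ: "real (card Z) \<le> exp (entropy_bound d s q0)"
      and codeZ: "\<forall>f\<in>?F. code f \<in> Z"
      and close: "\<forall>f\<in>?F. \<forall>g\<in>?F. code f = code g \<longrightarrow> (\<exists>c. (\<integral>\<^sup>+x. ennreal ((f x - g x - c)\<^sup>2) \<partial>D) \<le> ennreal (?e\<^sup>2))"
    using finite_cover[OF V s, of q0] by blast
  define W where "W = code ` ?F"
  have W: "W \<subseteq> Z" "finite W" "W \<noteq> {}" using codeZ Z ne by (auto simp: W_def intro: finite_subset)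
  define m where "m = card W"
  obtain h where h: "bij_betw h {0..<m} W" using ex_bij_betw_nat_finite[OF W(2)] by (auto simp: m_def)
  define rep where "rep = (\<lambda>i. SOME f. f \<in> ?F \<and> code f = h i)"
  have rep: "rep i \<in> ?F \<and> code (rep i) = h i" if "i < m" for i
  proof -
    have "h i \<in> W" using h that by (auto simp: bij_betw_def)
    then have "\<exists>f. f \<in> ?F \<and> code f = h i" by (auto simp: W_def)
    then show ?thesis unfolding rep_def by (rule someI_ex)
  qed
  define E where "E = (\<lambda>f :: (nat \<Rightarrow> real) \<Rightarrow> real. \<integral>x. f x \<partial>D)"
  \<comment> \<open>Zero beyond m, so that measurability, bound and mean zero hold for every
    index.\<close>
  define g where "g = (\<lambda>i x. if i < m then rep i x - E (rep i) else 0)"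
  have int: "integrable D f" and cen: "\<And>x. x \<in> space D \<Longrightarrow> \<bar>f x - E f\<bar> \<le> 2 * V" and meas: "f \<in> borel_measurable D"
    if f: "f \<in> ?F" for f
  proof -
    note bc = bounded_class_facts[OF f V s]
    show "f \<in> borel_measurable D" by (rule bc(1))
    obtain x0 where x0: "x0 \<in> space D" using D.not_empty by blast
    show i: "integrable D f"
    proof (rule D.integrable_const_bound[where B="\<bar>f x0\<bar> + 2 * V"])
      show "AE x in D. norm (f x) \<le> \<bar>f x0\<bar> + 2 * V"
      proof (rule AE_I2)
        fix x assume "x \<in> space D"
        from bc(2)[OF this x0] show "norm (f x) \<le> \<bar>f x0\<bar> + 2 * V" by simp
      qed
    qed (rule bc(1))
    fix x assume x: "x \<in> space D"
    have "f x - E f = (\<integral>y. f x - f y \<partial>D)" using i by (simp add: E_def D.prob_space)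
    also have "\<bar>\<dots>\<bar> \<le> (\<integral>y. \<bar>f x - f y\<bar> \<partial>D)" by (rule integral_abs_bound)
    also have "\<dots> \<le> (\<integral>y. 2 * V \<partial>D)" using bc(2)[OF x] i by (intro integral_mono) auto
    finally show "\<bar>f x - E f\<bar> \<le> 2 * V" by (simp add: D.prob_space)
  qed
  show ?thesis
  proof (rule that[of m g])
    show "m > 0" using W by (simp add: m_def card_gt_0_iff)
    have "card W \<le> card Z" using W Z by (intro card_mono) auto
    then have "real m \<le> real (card Z)" by (simp add: m_def)
    then show "real m \<le> exp (entropy_bound d s q0)"
      using cZ by linarith
    show "g i \<in> borel_measurable D" for i
    proof (cases "i < m")
      case True
      have "rep i \<in> borel_measurable D" by (rule meas) (use rep[OF True] in blast)
      then show ?thesis using True by (simp add: g_def)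
    qed (simp add: g_def)
    show "\<bar>g i x\<bar> \<le> 2 * V" if "x \<in> space D" for i x
      using cen[OF _ that, of "rep i"] rep[of i] V by (auto simp: g_def)
    show "(\<integral>x. g i x \<partial>D) = 0" for i
      using int[of "rep i"] rep[of i] by (cases "i < m") (auto simp: g_def E_def D.prob_space)
    fix f assume f: "f \<in> ?F"
    then have "code f \<in> h ` {0..<m}" using h by (auto simp: bij_betw_def W_def)
    then obtain i where i: "i < m" "code f = h i" by auto
    have ri: "rep i \<in> ?F" "code f = code (rep i)" using rep[OF i(1)] i(2) by auto
    define u where "u = (\<lambda>x. f x - E f - g i x)"
    obtain c where c: "(\<integral>\<^sup>+x. ennreal ((f x - rep i x - c)\<^sup>2) \<partial>D) \<le> ennreal (?e\<^sup>2)"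
      using close f ri by blast
    define c' where "c' = E f - E (rep i) - c"
    have uc: "f x - rep i x - c = u x + c'" for x using i by (simp add: u_def g_def c'_def)
    have um: "u \<in> borel_measurable D" unfolding u_def g_def using meas[OF f] meas[OF ri(1)] i by simp
    have ub: "\<bar>u x\<bar> \<le> 4 * V" if "x \<in> space D" for x
      using cen[OF f that] cen[OF ri(1) that] i by (simp add: u_def g_def)
    have iu: "integrable D u"
      by (rule D.integrable_const_bound[where B="4 * V"]) (use um ub in auto)
    have iu2: "integrable D (\<lambda>x. (u x)\<^sup>2)"
    proof (rule D.integrable_const_bound[where B="(4 * V)\<^sup>2"])
      show "AE x in D. norm ((u x)\<^sup>2) \<le> (4 * V)\<^sup>2"
      proof (rule AE_I2)
        fix x assume "x \<in> space D"
        from power_mono[OF ub[OF this] abs_ge_zero, of 2] show "norm ((u x)\<^sup>2) \<le> (4 * V)\<^sup>2" by simp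
      qed
    qed (use um in simp)
    have u0: "(\<integral>x. u x \<partial>D) = 0"
      using int[OF f] int[OF ri(1)] i by (simp add: u_def g_def E_def D.prob_space)
    have sq: "(u x + c')\<^sup>2 = (u x)\<^sup>2 + 2 * c' * u x + c'\<^sup>2" for x by (simp add: power2_sum mult_ac)
    have isq: "integrable D (\<lambda>x. (u x + c')\<^sup>2)" unfolding sq using iu iu2 by simp
    \<comment> \<open>Closeness is known only up to some constant. Among all constants the mean is
      the best one, so centring both functions cannot increase the distance.\<close>
    have "(\<integral>x. (u x)\<^sup>2 \<partial>D) \<le> (\<integral>x. (u x + c')\<^sup>2 \<partial>D)"
      unfolding sq using iu iu2 u0 by (simp add: D.prob_space)
    also have "\<dots> \<le> ?e\<^sup>2"
    proof -
      have "ennreal (\<integral>x. (u x + c')\<^sup>2 \<partial>D) = (\<integral>\<^sup>+x. ennreal ((f x - rep i x - c)\<^sup>2) \<partial>D)"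
        unfolding uc using isq by (intro nn_integral_eq_integral[symmetric]) auto
      also note c
      finally show ?thesis by simp
    qed
    finally show "\<exists>i<m. (\<integral>x. (f x - (\<integral>x. f x \<partial>D) - g i x)\<^sup>2 \<partial>D) \<le> ?e\<^sup>2"
      using i(1) by (auto simp: u_def E_def)
  qed
qed

text \<open>The first summand comes from the squared radius of the net, the second from the noise
  and the entropy divided by n; the exact form is what the termwise estimates of
  \<open>rate_bound\<close> produce.\<close>

definition risk_const :: "real \<Rightarrow> nat \<Rightarrow> real \<Rightarrow> real" where
  "risk_const B s \<sigma>2 = 18 * (((real s + 1)\<^sup>2 * real s ^ s)\<^sup>2 * B * (4 * sqrt (real s) + 4 * 2 ^ s * level_const s)\<^sup>2 * (real s + 4) ^ (2 * s))
    + 40000 * (4 + \<sigma>2) * (32 * 2 ^ s * 2 ^ s * level_const s * ((real s + 1)\<^sup>2 * real s ^ s) * (real s + 4) ^ s + 15 * 4 ^ s)"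

text \<open>The number P of pairs enters the squared radius quadratically and the entropy linearly.
  As P is of order d^(min s d), both are absorbed by d^(4 * min s d).\<close>

lemma rate_bound:
  fixes P :: real and s d n q0 :: nat
  assumes d: "d \<ge> 1" and s: "s \<ge> 1" and V: "V > 0" and B: "B > 0" and \<sigma>2: "\<sigma>2 \<ge> 0"
    and P: "0 \<le> P" "P \<le> (real s + 1)\<^sup>2 * real s ^ s * real d ^ min s d"
    and \<rho>: "\<rho> \<ge> 0"
    and q0: "(1 / 2 ^ q0)\<^sup>2 * ((real q0 + 1) ^ h)\<^sup>2 \<le> (real s + 4) ^ (2 * s) * \<rho>"
      "2 ^ q0 * (real q0 + 1) ^ h / real n \<le> 2 * 2 ^ s * (real s + 4) ^ s * \<rho>"
      "(ln (real n) + 2) / real n \<le> 15 * 4 ^ s * \<rho>"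
    and k: "k \<le> 2 * (8 * 2 ^ s * 2 ^ q0 * P * level_const s * (real q0 + 1) ^ h) + ln (real n) + 2"
    and n: "n \<ge> 1"
  shows "18 * (P * ((V + 1) * sqrt B / 2 ^ q0 * (real q0 + 1) ^ h * (4 * sqrt (real s) + 4 * 2 ^ s * level_const s)))\<^sup>2
      + 40000 * ((2 * (V + 1))\<^sup>2 + \<sigma>2) * k / real n
    \<le> risk_const B s \<sigma>2 * (real d ^ (4 * min s d) * (V + 1)\<^sup>2 * \<rho>)"
proof -
  define Cp where "Cp = (real s + 1)\<^sup>2 * real s ^ s"
  define Es where "Es = 4 * sqrt (real s) + 4 * 2 ^ s * level_const s"
  define T where "T = real d ^ (4 * min s d)"
  define L where "L = level_const s"
  have L1: "L \<ge> 1" unfolding L_def by (rule level_const_ge_1)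
  have Cp0: "Cp \<ge> 0" by (simp add: Cp_def)
  have d1: "1 \<le> real d" using d by simp
  have T1: "T \<ge> 1" unfolding T_def using d1 by (rule one_le_power)
  have PT: "P \<le> Cp * T"
  proof -
    have "real d ^ min s d \<le> T" unfolding T_def using d1 by (intro power_increasing) auto
    then have "Cp * real d ^ min s d \<le> Cp * T" using Cp0 by (rule mult_left_mono)
    then show ?thesis using P(2) unfolding Cp_def by (rule order_trans[rotated])
  qed
  have P2T: "P\<^sup>2 \<le> Cp\<^sup>2 * T"
  proof -
    have "P\<^sup>2 \<le> (Cp * real d ^ min s d)\<^sup>2" using P by (intro power_mono) (auto simp: Cp_def)
    also have "\<dots> = Cp\<^sup>2 * real d ^ (2 * min s d)" by (simp add: power_mult_distrib power_mult[symmetric] mult.commute)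
    also have "\<dots> \<le> Cp\<^sup>2 * T" unfolding T_def using d1 by (intro mult_left_mono power_increasing) auto
    finally show ?thesis .
  qed
  have V1: "(V + 1)\<^sup>2 \<ge> 1" using V by (intro one_le_power) simp
  have 1: "(P * ((V + 1) * sqrt B / 2 ^ q0 * (real q0 + 1) ^ h * Es))\<^sup>2
      \<le> Cp\<^sup>2 * B * Es\<^sup>2 * (real s + 4) ^ (2 * s) * (T * (V + 1)\<^sup>2 * \<rho>)"
  proof -
    have "(P * ((V + 1) * sqrt B / 2 ^ q0 * (real q0 + 1) ^ h * Es))\<^sup>2
        = P\<^sup>2 * ((V + 1)\<^sup>2 * B * Es\<^sup>2 * ((1 / 2 ^ q0)\<^sup>2 * ((real q0 + 1) ^ h)\<^sup>2))"
      using B by (simp add: power_mult_distrib power_divide)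
    also have "\<dots> \<le> (Cp\<^sup>2 * T) * ((V + 1)\<^sup>2 * B * Es\<^sup>2 * ((real s + 4) ^ (2 * s) * \<rho>))"
      by (rule mult_mono[OF P2T mult_left_mono[OF q0(1)]]) (use B Cp0 T1 in auto)
    finally show ?thesis by (simp add: mult_ac)
  qed
  have 2: "k / real n \<le> (32 * 2 ^ s * 2 ^ s * L * Cp * (real s + 4) ^ s + 15 * 4 ^ s) * (T * \<rho>)"
  proof -
    have "k / real n \<le> (2 * (8 * 2 ^ s * 2 ^ q0 * P * L * (real q0 + 1) ^ h) + ln (real n) + 2) / real n"
      using k by (intro divide_right_mono) (auto simp: L_def)
    also have "\<dots> = 16 * 2 ^ s * L * P * (2 ^ q0 * (real q0 + 1) ^ h / real n) + (ln (real n) + 2) / real n"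
      by (simp add: add_divide_distrib)
    also have "\<dots> \<le> 16 * 2 ^ s * L * (Cp * T) * (2 * 2 ^ s * (real s + 4) ^ s * \<rho>) + 15 * 4 ^ s * \<rho>"
      by (intro add_mono q0(3) mult_mono[OF mult_left_mono[OF PT] q0(2)]) (use L1 Cp0 T1 in auto)
    also have "15 * 4 ^ s * \<rho> \<le> 15 * 4 ^ s * (T * \<rho>)"
      using T1 \<rho> by (intro mult_left_mono) (auto simp: mult_le_cancel_right1)
    finally show ?thesis by (simp add: algebra_simps)
  qed
  have 3: "(2 * (V + 1))\<^sup>2 + \<sigma>2 \<le> (4 + \<sigma>2) * (V + 1)\<^sup>2"
  proof -
    have "\<sigma>2 * 1 \<le> \<sigma>2 * (V + 1)\<^sup>2" using V1 \<sigma>2 by (intro mult_left_mono)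
    moreover have "(2 * (V + 1))\<^sup>2 = 4 * (V + 1)\<^sup>2" unfolding power_mult_distrib by simp
    ultimately show ?thesis unfolding distrib_right by linarith
  qed
  have X0: "0 \<le> (32 * 2 ^ s * 2 ^ s * L * Cp * (real s + 4) ^ s + 15 * 4 ^ s) * (T * \<rho>)"
    using L1 Cp0 T1 \<rho> by (intro mult_nonneg_nonneg add_nonneg_nonneg) auto
  have "40000 * ((2 * (V + 1))\<^sup>2 + \<sigma>2) * k / real n = 40000 * (((2 * (V + 1))\<^sup>2 + \<sigma>2) * (k / real n))" by simp
  also have "\<dots> \<le> 40000 * (((2 * (V + 1))\<^sup>2 + \<sigma>2) * ((32 * 2 ^ s * 2 ^ s * L * Cp * (real s + 4) ^ s + 15 * 4 ^ s) * (T * \<rho>)))"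
    using 2 \<sigma>2 by (intro mult_left_mono) auto
  also have "\<dots> \<le> 40000 * (((4 + \<sigma>2) * (V + 1)\<^sup>2) * ((32 * 2 ^ s * 2 ^ s * L * Cp * (real s + 4) ^ s + 15 * 4 ^ s) * (T * \<rho>)))"
    using 3 X0 by (intro mult_left_mono mult_right_mono) auto
  also have "\<dots> = 40000 * (4 + \<sigma>2) * (32 * 2 ^ s * 2 ^ s * L * Cp * (real s + 4) ^ s + 15 * 4 ^ s) * (T * (V + 1)\<^sup>2 * \<rho>)"
    by (simp only: mult_ac)
  finally have b: "40000 * ((2 * (V + 1))\<^sup>2 + \<sigma>2) * k / real n
    \<le> 40000 * (4 + \<sigma>2) * (32 * 2 ^ s * 2 ^ s * L * Cp * (real s + 4) ^ s + 15 * 4 ^ s) * (T * (V + 1)\<^sup>2 * \<rho>)" .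
  have a: "18 * (P * ((V + 1) * sqrt B / 2 ^ q0 * (real q0 + 1) ^ h * Es))\<^sup>2
      \<le> 18 * (Cp\<^sup>2 * B * Es\<^sup>2 * (real s + 4) ^ (2 * s)) * (T * (V + 1)\<^sup>2 * \<rho>)"
    using 1 by (simp only: mult.assoc)
  have "risk_const B s \<sigma>2 * (T * (V + 1)\<^sup>2 * \<rho>) = 18 * (Cp\<^sup>2 * B * Es\<^sup>2 * (real s + 4) ^ (2 * s)) * (T * (V + 1)\<^sup>2 * \<rho>)
      + 40000 * (4 + \<sigma>2) * (32 * 2 ^ s * 2 ^ s * L * Cp * (real s + 4) ^ s + 15 * 4 ^ s) * (T * (V + 1)\<^sup>2 * \<rho>)"
    unfolding risk_const_def Cp_def Es_def L_def by (rule distrib_right)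
  with add_mono[OF a b] show ?thesis
    unfolding Es_def[symmetric] T_def[symmetric] by (simp only:)
qed

lemma minimax_upper_bound:
  fixes d s n :: nat and V :: real
  assumes d: "d \<ge> 1" and s: "s \<ge> 1" and n: "n \<ge> 2" and V: "V > 0"
    and p0m: "p0 \<in> borel_measurable (Rd d)" and p0: "\<forall>x\<in>space (Rd d). p0 x \<ge> 0"
    and grid: "grid_design d M (design_law d p0) B"
    and \<mu>: "prob_space \<mu>" "sets \<mu> = sets borel" and mean: "(\<integral>e. e \<partial>\<mu>) = 0" and fin: "norm31 \<mu> < \<infinity>"
  shows "minimax_risk d s n V p0 \<mu> \<le> ennreal (risk_const B s (enn2real (abs_moments \<mu> 2)) *
    (real d ^ (4 * min s d) * (V + 1)\<^sup>2 * (real n powr (- 2 / 3) * ln (real n) powr (4 * real (min s d - 1) / 3))))"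
    (is "_ \<le> ennreal ?R")
proof -
  let ?D = "design_law d p0"
  let ?F = "{f \<in> F_ST d s. V_XGB d s f \<le> ennreal V}"
  interpret G: grid_design d M ?D B by (rule grid)
  have sq: "integrable \<mu> (\<lambda>e. e\<^sup>2)" by (rule noise_square_integrable[OF \<mu> fin])
  interpret R: regression_model ?D \<mu> n
    by (rule regression_model.intro) (use G.D \<mu> sq mean n in auto)
  have sets_D: "sets ?D = sets (Rd d)" by (rule G.sets_D)
  have s2: "enn2real (abs_moments \<mu> 2) = R.\<sigma>2"
  proof -
    have "abs_moments \<mu> 2 = ennreal (\<integral>e. e\<^sup>2 \<partial>\<mu>)"
      unfolding abs_moments_def using sq by (simp add: nn_integral_eq_integral)
    then show ?thesis by (simp add: R.\<sigma>2_def integral_nonneg_AE)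
  qed
  have s20: "R.\<sigma>2 \<ge> 0" by (auto simp: R.\<sigma>2_def intro!: integral_nonneg_AE)
  have sub: "f \<in> bounded_class d s (V + 1)" if "f \<in> ?F" for f
    using bounded_class_superset[OF _ _ V] that by blast
  have V1: "V + 1 > 0" using V by simp
  define h where "h = min s d - 1"
  define \<rho> where "\<rho> = real n powr (- 2 / 3) * ln (real n) powr (4 * real h / 3)"
  have hs: "h < s" using s d by (simp add: h_def)
  obtain q0 where q0: "(1 / 2 ^ q0)\<^sup>2 * ((real q0 + 1) ^ h)\<^sup>2 \<le> (real s + 4) ^ (2 * s) * \<rho>"
      "2 ^ q0 * (real q0 + 1) ^ h / real n \<le> 2 * 2 ^ s * (real s + 4) ^ s * \<rho>"
      "(ln (real n) + 2) / real n \<le> 15 * 4 ^ s * \<rho>"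
    using resolution_exists[OF n hs] unfolding \<rho>_def by blast
  let ?P = "real (card (index_pairs d s))"
  define E where "E = 8 * 2 ^ s * 2 ^ q0 * ?P * level_const s * (real q0 + 1) ^ h"
  define \<epsilon> where "\<epsilon> = ?P * G.pair_error s (V + 1) q0"
  have E0: "E \<ge> 0" using level_const_ge_1[of s] by (simp add: E_def)
  show ?thesis
  proof (cases "bounded_class d s (V + 1) = {}")
    \<comment> \<open>A net needs a member of the class to represent it; the supremum of the risk
      over an empty class is 0.\<close>
    case True
    then have "?F = {}" using sub by blast
    moreover have "(\<lambda>_ _. 0) \<in> estimators d n" by (simp add: estimators_def case_prod_beta)
    moreover from this have "minimax_risk d s n V p0 \<mu> \<le> (SUP f\<in>?F. risk d n p0 \<mu> (\<lambda>_ _. 0) f)"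
      unfolding minimax_risk_def by (rule INF_lower)
    ultimately have "minimax_risk d s n V p0 \<mu> \<le> bot" by (simp only: image_empty Sup_empty)
    then show ?thesis by (simp add: bot_ennreal)
  next
    case False
    obtain m g where m: "m > 0" and mE: "real m \<le> exp E"
      and gm: "\<And>i. g i \<in> borel_measurable ?D" and gb: "\<And>i x. x \<in> space ?D \<Longrightarrow> \<bar>g i x\<bar> \<le> 2 * (V + 1)"
      and g0: "\<And>i. (\<integral>x. g i x \<partial>?D) = 0"
      and net: "\<And>f. f \<in> bounded_class d s (V + 1) \<Longrightarrow> \<exists>i<m. (\<integral>x. (f x - (\<integral>x. f x \<partial>?D) - g i x)\<^sup>2 \<partial>?D) \<le> \<epsilon>\<^sup>2"
      using G.net_of_class[OF V1 s False, of q0 thesis] unfolding E_def \<epsilon>_def h_def by blast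
    \<comment> \<open>Chosen so that m^2 * n \<le> exp (2 * E + ln n) \<le> exp k \<le> 4^k; the
      added 1 ensures that there is at least one block.\<close>
    define k where "k = nat \<lceil>2 * E + ln (real n)\<rceil> + 1"
    have n0: "real n > 0" "ln (real n) \<ge> 0" using n by auto
    have kE: "2 * E + ln (real n) \<le> real k" "real k \<le> 2 * E + ln (real n) + 2"
      using E0 n0 unfolding k_def by linarith+
    have k1: "k \<ge> 1" by (simp add: k_def)
    have mk: "(real m)\<^sup>2 * real n \<le> 4 ^ k"
    proof -
      have "(real m)\<^sup>2 * real n \<le> (exp E)\<^sup>2 * real n" using mE by (intro mult_right_mono power_mono) auto
      also have "\<dots> = exp (2 * E + ln (real n))" by (simp only: exp_add exp_double exp_ln[OF n0(1)])
      also have "\<dots> \<le> exp (real k)" using kE by simp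
      also have "\<dots> = exp 1 ^ k" using exp_of_nat_mult[of k "1::real"] by simp
      also have "\<dots> \<le> 4 ^ k" using exp_le by (intro power_mono) auto
      finally show ?thesis .
    qed
    have \<epsilon>0: "\<epsilon> \<ge> 0"
      unfolding \<epsilon>_def G.pair_error_def using G.B V level_const_ge_1[of s]
      by (intro mult_nonneg_nonneg add_nonneg_nonneg divide_nonneg_nonneg zero_le_power) simp_all
    obtain T where Tm: "case_prod T \<in> borel_measurable ((\<Pi>\<^sub>M i\<in>{1..n}. ?D \<Otimes>\<^sub>M borel) \<Otimes>\<^sub>M ?D)"
      and Tr: "\<And>f. f \<in> borel_measurable ?D \<Longrightarrow> (\<forall>x\<in>space ?D. \<forall>x'\<in>space ?D. \<bar>f x - f x'\<bar> \<le> 2 * (V + 1)) \<Longrightarrow>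
        (\<exists>i<m. (\<integral>x. (f x - (\<integral>x. f x \<partial>?D) - g i x)\<^sup>2 \<partial>?D) \<le> \<epsilon>\<^sup>2) \<Longrightarrow>
        (\<integral>\<^sup>+\<omega>. (\<integral>\<^sup>+x. ennreal ((T (data n f \<omega>) x - f x)\<^sup>2) \<partial>?D) \<partial>R.N)
          \<le> ennreal (18 * \<epsilon>\<^sup>2 + 40000 * ((2 * (V + 1))\<^sup>2 + R.\<sigma>2) * real k / real n)"
    proof -
      have "\<exists>T. case_prod T \<in> borel_measurable ((\<Pi>\<^sub>M i\<in>{1..n}. ?D \<Otimes>\<^sub>M borel) \<Otimes>\<^sub>M ?D) \<and>
        (\<forall>f\<in>borel_measurable ?D. (\<forall>x\<in>space ?D. \<forall>x'\<in>space ?D. \<bar>f x - f x'\<bar> \<le> 2 * (V + 1)) \<longrightarrow>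
          (\<exists>i<m. (\<integral>x. (f x - (\<integral>x. f x \<partial>?D) - g i x)\<^sup>2 \<partial>?D) \<le> \<epsilon>\<^sup>2) \<longrightarrow>
          (\<integral>\<^sup>+\<omega>. (\<integral>\<^sup>+x. ennreal ((T (data n f \<omega>) x - f x)\<^sup>2) \<partial>?D) \<partial>R.N)
            \<le> ennreal (18 * \<epsilon>\<^sup>2 + 40000 * ((2 * (V + 1))\<^sup>2 + R.\<sigma>2) * real k / real n))"
        by (rule R.finite_net_estimator) (fact m gm gb g0 \<epsilon>0 k1 mk | rule gb, assumption)+
      then show ?thesis using that by blast
    qed
    have sets_Z: "sets (\<Pi>\<^sub>M i\<in>{1..n}. ?D \<Otimes>\<^sub>M (borel :: real measure)) = sets (\<Pi>\<^sub>M i\<in>{1..n}. Rd d \<Otimes>\<^sub>M (borel :: real measure))"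
      by (intro sets_PiM_cong sets_pair_measure_cong refl sets_D)
    have Te: "T \<in> estimators d n"
      using Tm unfolding estimators_def mem_Collect_eq
        measurable_cong_sets[OF sets_pair_measure_cong[OF sets_Z sets_D] refl] .
    have N: "model_space d n p0 \<mu> = R.N" by (simp add: model_space_def R.N_def R.P_def)
    have "risk d n p0 \<mu> T f \<le> ennreal ?R" if f: "f \<in> ?F" for f
    proof -
      note fb = G.bounded_class_facts[OF sub[OF f] V1 s]
      have fm: "f \<in> borel_measurable (Rd d)" using fb(1) measurable_cong_sets[OF sets_D refl] by auto
      have "risk d n p0 \<mu> T f = (\<integral>\<^sup>+\<omega>. (\<integral>\<^sup>+x. ennreal ((T (data n f \<omega>) x - f x)\<^sup>2) \<partial>?D) \<partial>R.N)"
        unfolding risk_def N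
      proof (rule nn_integral_cong)
        fix \<omega> assume \<omega>: "\<omega> \<in> space R.N"
        have "data n f \<omega> \<in> space (\<Pi>\<^sub>M i\<in>{1..n}. ?D \<Otimes>\<^sub>M (borel :: real measure))"
          using \<omega> by (auto simp: data_def R.N_def space_PiM space_pair_measure R.space_P PiE_iff)
        then have "(\<lambda>x. T (data n f \<omega>) x) \<in> borel_measurable ?D"
          using measurable_Pair2[OF Tm] by simp
        then have Tx: "(\<lambda>x. T (data n f \<omega>) x) \<in> borel_measurable (Rd d)"
          using measurable_cong_sets[OF sets_D refl] by auto
        have "L2_sq d p0 (\<lambda>x. T (data n f \<omega>) x - f x) = (\<integral>\<^sup>+x. ennreal (p0 x) * ennreal ((T (data n f \<omega>) x - f x)\<^sup>2) \<partial>Rd d)"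
          unfolding L2_sq_def using p0 by (intro nn_integral_cong) (simp add: ennreal_mult mult.commute)
        also have "\<dots> = (\<integral>\<^sup>+x. ennreal ((T (data n f \<omega>) x - f x)\<^sup>2) \<partial>?D)"
          unfolding design_law_def using p0m Tx fm by (subst nn_integral_density) auto
        finally show "L2_sq d p0 (\<lambda>x. T (data n f \<omega>) x - f x) = (\<integral>\<^sup>+x. ennreal ((T (data n f \<omega>) x - f x)\<^sup>2) \<partial>?D)" .
      qed
      also have "\<dots> \<le> ennreal (18 * \<epsilon>\<^sup>2 + 40000 * ((2 * (V + 1))\<^sup>2 + R.\<sigma>2) * real k / real n)"
        by (rule Tr[OF fb(1) _ net[OF sub[OF f]]]) (use fb(2) in blast)
      also have "\<dots> \<le> ennreal ?R"
      proof (rule ennreal_leI)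
        have "18 * (?P * ((V + 1) * sqrt B / 2 ^ q0 * (real q0 + 1) ^ h * (4 * sqrt (real s) + 4 * 2 ^ s * level_const s)))\<^sup>2
            + 40000 * ((2 * (V + 1))\<^sup>2 + R.\<sigma>2) * real k / real n
          \<le> risk_const B s R.\<sigma>2 * (real d ^ (4 * min s d) * (V + 1)\<^sup>2 * \<rho>)"
          by (rule rate_bound[OF d s V G.B s20 _ card_index_pairs[OF d] _ q0 kE(2)[unfolded E_def]])
            (use n in \<open>auto simp: \<rho>_def\<close>)
        then show "18 * \<epsilon>\<^sup>2 + 40000 * ((2 * (V + 1))\<^sup>2 + R.\<sigma>2) * real k / real n \<le> ?R"
          unfolding s2 \<epsilon>_def G.pair_error_def h_def[symmetric] \<rho>_def by simp
      qed
      finally show ?thesis .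
    qed
    then have "(SUP f\<in>?F. risk d n p0 \<mu> T f) \<le> ennreal ?R" by (intro SUP_least) auto
    then show ?thesis unfolding minimax_risk_def by (intro INF_lower2[OF Te])
  qed
qed

theorem corollary1:
  "\<exists>K :: real \<Rightarrow> nat \<Rightarrow> (nat \<Rightarrow> ennreal) \<Rightarrow> ennreal \<Rightarrow> real.
     \<forall>(d::nat) (s::nat) (sb::nat) (n::nat) (V::real) (M :: nat \<Rightarrow> real)
       (p0 :: (nat \<Rightarrow> real) \<Rightarrow> real) (B::real) (\<mu> :: real measure).
       d \<ge> 1 \<longrightarrow> s \<ge> 1 \<longrightarrow> sb = min s d \<longrightarrow> n \<ge> 2 \<longrightarrow> V > 0 \<longrightarrow>
       p0 \<in> borel_measurable (Rd d) \<longrightarrow>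
       (\<forall>x\<in>space (Rd d). p0 x \<ge> 0) \<longrightarrow>
       prob_space (design_law d p0) \<longrightarrow>
       (\<forall>j\<in>{1..d}. M j > 0) \<longrightarrow>
       (\<forall>x\<in>space (Rd d). x \<notin> (\<Pi>\<^sub>E j\<in>{1..d}. {- M j / 2 .. M j / 2}) \<longrightarrow> p0 x = 0) \<longrightarrow>
       bdd_above (p0 ` space (Rd d)) \<longrightarrow>
       B = (\<Prod>j=1..d. M j) * (SUP x\<in>space (Rd d). p0 x) \<longrightarrow>
       prob_space \<mu> \<longrightarrow> sets \<mu> = sets borel \<longrightarrow>
       integrable \<mu> (\<lambda>e. e) \<longrightarrow> (\<integral>e. e \<partial>\<mu>) = 0 \<longrightarrow>
       norm31 \<mu> < \<infinity> \<longrightarrow>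
       minimax_risk d s n V p0 \<mu> \<le>
         ennreal (K B s (abs_moments \<mu>) (norm31 \<mu>) *
           (real d ^ (4 * sb) * (1 + ln (real d)) ^ (4 * (sb - 1)) * (V + 1)\<^sup>2 *
            real n powr (- 2 / 3) * ln (real n) powr (4 * (real sb - 1) / 3)))"
\<comment> \<open>The constant reads the second absolute moment from the sequence of moments;
  finiteness of \<open>norm31\<close> makes it finite, so \<open>enn2real\<close> returns its true
  value.\<close>
proof (intro exI[of _ "\<lambda>B s mom _. risk_const B s (enn2real (mom 2))"] allI impI)
  fix d s sb n :: nat and V :: real and M :: "nat \<Rightarrow> real" and p0 :: "(nat \<Rightarrow> real) \<Rightarrow> real"
    and B :: real and \<mu> :: "real measure"
  assume d: "d \<ge> 1" and s: "s \<ge> 1" and sb: "sb = min s d" and n: "n \<ge> 2" and V: "V > 0"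
    and p0m: "p0 \<in> borel_measurable (Rd d)" and p0: "\<forall>x\<in>space (Rd d). p0 x \<ge> 0"
    and prob: "prob_space (design_law d p0)" and M: "\<forall>j\<in>{1..d}. M j > 0"
    and supp: "\<forall>x\<in>space (Rd d). x \<notin> (\<Pi>\<^sub>E j\<in>{1..d}. {- M j / 2 .. M j / 2}) \<longrightarrow> p0 x = 0"
    and bdd: "bdd_above (p0 ` space (Rd d))"
    and B: "B = (\<Prod>j=1..d. M j) * (SUP x\<in>space (Rd d). p0 x)"
    and \<mu>: "prob_space \<mu>" "sets \<mu> = sets borel" and mean: "(\<integral>e. e \<partial>\<mu>) = 0" and fin: "norm31 \<mu> < \<infinity>"
  have grid: "grid_design d M (design_law d p0) B"
    by (rule design_law_grid[OF p0m p0 prob M supp bdd B])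
  let ?C = "risk_const B s (enn2real (abs_moments \<mu> 2))"
  let ?X = "real d ^ (4 * sb)" and ?Y = "(V + 1)\<^sup>2"
  let ?Z = "real n powr (- 2 / 3) * ln (real n) powr (4 * (real sb - 1) / 3)"
  let ?W = "(1 + ln (real d)) ^ (4 * (sb - 1))"
  have sb1: "real (sb - 1) = real sb - 1" using d s sb by (simp add: of_nat_diff)
  have "minimax_risk d s n V p0 \<mu> \<le> ennreal (?C * (?X * ?Y * ?Z))"
    using minimax_upper_bound[OF d s n V p0m p0 grid \<mu> mean fin] unfolding sb[symmetric] sb1 .
  also have "\<dots> \<le> ennreal (?C * (?X * ?W * ?Y * real n powr (- 2 / 3) * ln (real n) powr (4 * (real sb - 1) / 3)))"
  proof (intro ennreal_leI mult_left_mono)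
    \<comment> \<open>The logarithm of d is nonnegative, so inserting this factor only enlarges the
      bound already obtained.\<close>
    have "1 \<le> ?W" using d by (intro one_le_power) simp
    then have "(?X * ?Y * ?Z) * 1 \<le> (?X * ?Y * ?Z) * ?W" by (intro mult_left_mono) auto
    then show "?X * ?Y * ?Z \<le> ?X * ?W * ?Y * real n powr (- 2 / 3) * ln (real n) powr (4 * (real sb - 1) / 3)"
      by (simp only: mult_ac mult_1_right)
    have "B > 0" using grid by (rule grid_design.B)
    then show "0 \<le> ?C" unfolding risk_const_def using level_const_ge_1[of s]
      by (intro add_nonneg_nonneg mult_nonneg_nonneg) auto
  qed
  finally show "minimax_risk d s n V p0 \<mu> \<le>
         ennreal (?C * (real d ^ (4 * sb) * (1 + ln (real d)) ^ (4 * (sb - 1)) * (V + 1)\<^sup>2 *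
            real n powr (- 2 / 3) * ln (real n) powr (4 * (real sb - 1) / 3)))" .
qed

end
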